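(* Let $U$ be an open subset of $\mathbb{R}^d$, let $\mu$ be a Federer measure on $U$, and let $F:U\to \mathrm{Mat}_{m,n}$ be a continuous map such that the pair $(F,\mu)$ is (i) good and (ii) weakly non-planar. Then the pushforward measure $F_*\mu$ is strongly extremal.
   Context: $\mathrm{Mat}_{m,n}$ is the space of real $m\times n$ matrices; $\|\cdot\|$ is the Euclidean norm. For $\mathbf{x}\in\mathbb{R}^k$ let $\Pi(\mathbf{x})=\prod_i|x_i|$ and $\Pi_+(\mathbf{x})=\prod_i\max\{1,|x_i|\}$. A matrix $Y\in\mathrm{Mat}_{m,n}$ is VWMA (very well multiplicatively approximable) if there is $\varepsilon>0$ such that for arbitrarily large $Q>1$ there exist $\mathbf{q}\in\mathbb{Z}^n\setminus\{0\}$ and $\mathbf{p}\in\mathbb{Z}^m$ with $\Pi(Y\mathbf{q}-\mathbf{p})<Q^{-1-\varepsilon}$ and $\Pi_+(\mathbf{q})\le Q$. A measure on $\mathrm{Mat}_{m,n}$ is strongly extremal if almost every $Y$ with respect to it is not VWMA. $F_*\mu(S)=\mu(F^{-1}(S))$. All measures are Radon. For a ball $V=B(x,r)$, $cV=B(x,cr)$. A measure $\mu$ is $D$-Federer on an open set $U$ if $\mu(3V)<D\mu(V)$ for every ball $V\subset U$ centred in $\operatorname{supp}\mu$; $\mu$ is Federer if for $\mu$-a.e. $x$ there are a neighbourhood $U$ of $x$ and $D>0$ with $\mu$ $D$-Federer on $U$. For $V$ with $\mu(V)>0$ and $f:V\to\mathbb{R}$ put $\|f\|_{\mu,V}=\sup_{x\in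 V\cap\operatorname{supp}\mu}|f(x)|$. A function $f$ is $(C,\alpha)$-good on an open $U$ with respect to $\mu$ if for every ball $V\subset U$ centred in $\operatorname{supp}\mu$ and every $\varepsilon>0$, $\mu(\{x\in V:|f(x)|<\varepsilon\})\le C(\varepsilon/\|f\|_{\mu,V})^\alpha\mu(V)$. For $\mathbf{f}=(f_1,\dots,f_N):U\to\mathbb{R}^N$, the pair $(\mathbf{f},\mu)$ is good if for $\mu$-a.e. $x\in U$ there are a neighbourhood $V\subset U$ of $x$ and $C,\alpha>0$ such that every real linear combination of $1,f_1,\dots,f_N$ is $(C,\alpha)$-good on $V$ w.r.t. $\mu$. Let $\mathbf{d}:\mathrm{Mat}_{m,n}\to\mathbb{R}^N$, $N=\binom{m+n}{n}-1$, assign to a matrix the list of all its minors (of all orders) in a fixed order; $(F,\mu)$ is good if $(\mathbf{d}\circ F,\mu)$ is good. For $A\in\mathrm{Mat}_{n,m}$ and $B\in\mathrm{Mat}_{n,n}$ let $\mathcal{H}_{A,B}=\{Y\in\mathrm{Mat}_{m,n}:\det(AY+B)=0\}$, and let $\mathbf{H}_{m,n}$ be the collection of all $\mathcal{H}_{A,B}$ with $\operatorname{rank}(A|B)=n$. The pair $(F,\mu)$ is weakly non-planar if $F(V\cap\operatorname{supp}\mu)\not\subset\mathcal{H}$ for every ball $V\subset U$ centred in $\operatorname{supp}\mu$ and every $\mathcal{H}\in\mathbf{H}_{m,n}$. *)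

theory Defs
  imports "HOL-Analysis.Analysis"
begin

section \<open>Measures on an open subset of a Euclidean space\<close>

text \<open>
  A measure on an open set \<open>U\<close> has space \<open>U\<close> and the Borel subsets of \<open>U\<close> as measurable sets.
\<close>

definition radon_measure_on :: "'a::euclidean_space set \<Rightarrow> 'a measure \<Rightarrow> bool" where
  "radon_measure_on U \<mu> \<longleftrightarrow>
     sets \<mu> = sets (restrict_space borel U) \<and>
     (\<forall>K. compact K \<and> K \<subseteq> U \<longrightarrow> emeasure \<mu> K < \<infinity>) \<and>
     (\<forall>A\<in>sets \<mu>. emeasure \<mu> A = (SUP K\<in>{K. compact K \<and> K \<subseteq> A}. emeasure \<mu> K))"

text \<open>The support is closed relative to \<open>space \<mu>\<close>.\<close>

definition supp_measure :: "'a::topological_space measure \<Rightarrow> 'a set" where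
  "supp_measure \<mu> = {x \<in> space \<mu>. \<forall>W. open W \<and> x \<in> W \<longrightarrow> emeasure \<mu> (W \<inter> space \<mu>) > 0}"

text \<open>
  All balls are open balls of positive radius. A ball contained in \<open>U\<close> need not have its dilate
  contained in \<open>U\<close>; the measure of the dilate is that of its part inside \<open>U = space \<mu>\<close>
  (\<^const>\<open>emeasure\<close> would be \<open>0\<close> on a set that is not measurable).
\<close>

definition D_federer_on :: "real \<Rightarrow> 'a::metric_space measure \<Rightarrow> 'a set \<Rightarrow> bool" where
  "D_federer_on D \<mu> W \<longleftrightarrow>
     (\<forall>x\<in>supp_measure \<mu>. \<forall>r>0. ball x r \<subseteq> W \<longrightarrow>
        emeasure \<mu> (ball x (3 * r) \<inter> space \<mu>) < ennreal D * emeasure \<mu> (ball x r))"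

definition federer :: "'a::metric_space measure \<Rightarrow> bool" where
  "federer \<mu> \<longleftrightarrow>
     (AE x in \<mu>. \<exists>W D. open W \<and> x \<in> W \<and> W \<subseteq> space \<mu> \<and> D > 0 \<and> D_federer_on D \<mu> W)"

section \<open>Good functions\<close>

definition sup_norm_on :: "'a::topological_space measure \<Rightarrow> 'a set \<Rightarrow> ('a \<Rightarrow> real) \<Rightarrow> ennreal" where
  "sup_norm_on \<mu> V f = (SUP x\<in>V \<inter> supp_measure \<mu>. ennreal \<bar>f x\<bar>)"

text \<open>Power with a positive real exponent, extended by \<open>\<infinity>\<^sup>\<alpha> = \<infinity>\<close>.\<close>

definition ennpowr :: "ennreal \<Rightarrow> real \<Rightarrow> ennreal" where
  "ennpowr t \<alpha> = (if t = \<infinity> then \<infinity> else ennreal (enn2real t powr \<alpha>))"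

text \<open>
  The supremum may be \<open>0\<close> or \<open>\<infinity>\<close>. In \<^typ>\<open>ennreal\<close>, \<open>\<epsilon> / 0 = \<infinity>\<close> (so the inequality holds
  trivially, the centre of the ball being in the support) and \<open>\<epsilon> / \<infinity> = 0\<close>.
\<close>

definition C_alpha_good_on ::
  "real \<Rightarrow> real \<Rightarrow> ('a::metric_space \<Rightarrow> real) \<Rightarrow> 'a set \<Rightarrow> 'a measure \<Rightarrow> bool" where
  "C_alpha_good_on C \<alpha> f W \<mu> \<longleftrightarrow>
     (\<forall>x\<in>supp_measure \<mu>. \<forall>r>0. ball x r \<subseteq> W \<longrightarrow>
        (\<forall>\<epsilon>>0. emeasure \<mu> {y \<in> ball x r. \<bar>f y\<bar> < \<epsilon>}
           \<le> ennreal C * ennpowr (ennreal \<epsilon> / sup_norm_on \<mu> (ball x r) f) \<alpha> * emeasure \<mu> (ball x r)))"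

text \<open>
  A tuple \<open>(f\<^sub>1, \<dots>, f\<^sub>N)\<close> of functions is a family \<open>f\<close> over a finite index set \<open>I\<close>.
\<close>

definition good_family ::
  "'i set \<Rightarrow> ('i \<Rightarrow> 'a::metric_space \<Rightarrow> real) \<Rightarrow> 'a set \<Rightarrow> 'a measure \<Rightarrow> bool" where
  "good_family I f U \<mu> \<longleftrightarrow>
     (AE x in \<mu>. \<exists>W C \<alpha>. open W \<and> x \<in> W \<and> W \<subseteq> U \<and> C > 0 \<and> \<alpha> > 0 \<and>
        (\<forall>c\<^sub>0 c. C_alpha_good_on C \<alpha> (\<lambda>y. c\<^sub>0 + (\<Sum>i\<in>I. c i * f i y)) W \<mu>))"

section \<open>Minors\<close>

text \<open>
  An \<open>m \<times> n\<close> matrix has type \<^typ>\<open>real^'n^'m\<close>. A linear order on the index types is needed to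
  fix the signs of the minors.
\<close>

definition minor_indices :: "('m::finite set \<times> 'n::finite set) set" where
  "minor_indices = {(I, J). I \<noteq> {} \<and> card I = card J}"

text \<open>
  The determinant, by the Leibniz formula, of the square submatrix of \<open>Y\<close> with rows \<open>I\<close> and
  columns \<open>J\<close>, each listed in increasing order.
\<close>

definition minor ::
  "'m set \<Rightarrow> 'n set \<Rightarrow> real^'n::{finite,linorder}^'m::{finite,linorder} \<Rightarrow> real" where
  "minor I J Y =
     (\<Sum>p | p permutes {..<card I}. of_int (sign p) *
        (\<Prod>i<card I. Y $ (sorted_list_of_set I ! i) $ (sorted_list_of_set J ! p i)))"

lemma card_minor_indices:
  "card (minor_indices :: ('m::finite set \<times> 'n::finite set) set)
     = ((CARD('m) + CARD('n)) choose CARD('n)) - 1"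
proof -
  let ?S = "\<lambda>k. {I::'m set. card I = k} \<times> {J::'n set. card J = k}"
  have eq: "insert ({}, {}) minor_indices = (\<Union>k\<le>CARD('n). ?S k)"
    using card_mono[of "UNIV :: 'n set"] by (auto simp: minor_indices_def)
  have "card (\<Union>k\<le>CARD('n). ?S k) = (\<Sum>k\<le>CARD('n). card (?S k))"
    by (rule card_UN_disjoint) auto
  also have "\<dots> = (\<Sum>k\<le>CARD('n). (CARD('m) choose k) * (CARD('n) choose (CARD('n) - k)))"
    using n_subsets[of "UNIV :: 'm set"] n_subsets[of "UNIV :: 'n set"]
    by (intro sum.cong) (auto simp: card_cartesian_product binomial_symmetric[symmetric])
  also have "\<dots> = (CARD('m) + CARD('n)) choose CARD('n)"
    by (simp add: vandermonde)
  finally have "card (insert ({}, {}) (minor_indices :: ('m set \<times> 'n set) set))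
      = (CARD('m) + CARD('n)) choose CARD('n)"
    by (simp add: eq)
  moreover have "({}, {}) \<notin> (minor_indices :: ('m set \<times> 'n set) set)"
    by (simp add: minor_indices_def)
  ultimately show ?thesis by (simp add: card_insert_disjoint)
qed

definition good_pair ::
  "('a::metric_space \<Rightarrow> real^'n::{finite,linorder}^'m::{finite,linorder}) \<Rightarrow> 'a set \<Rightarrow> 'a measure \<Rightarrow> bool" where
  "good_pair F U \<mu> \<longleftrightarrow>
     good_family (minor_indices :: ('m set \<times> 'n set) set) (\<lambda>(I, J) x. minor I J (F x)) U \<mu>"

section \<open>Weak non-planarity\<close>

definition block_row :: "real^'m^'n \<Rightarrow> real^'k^'n \<Rightarrow> real^('m + 'k)^'n" where
  "block_row A B = (\<chi> i j. case j of Inl k \<Rightarrow> A $ i $ k | Inr k \<Rightarrow> B $ i $ k)"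

definition H_set :: "real^'m^'n \<Rightarrow> real^'n^'n \<Rightarrow> (real^'n^'m) set" where
  "H_set A B = {Y. det (A ** Y + B) = 0}"

definition H_collection :: "(real^'n^'m) set set" where
  "H_collection = {H_set A B | (A :: real^'m^'n) (B :: real^'n^'n). rank (block_row A B) = CARD('n)}"

definition weakly_nonplanar ::
  "('a::metric_space \<Rightarrow> real^'n^'m) \<Rightarrow> 'a set \<Rightarrow> 'a measure \<Rightarrow> bool" where
  "weakly_nonplanar F U \<mu> \<longleftrightarrow>
     (\<forall>x\<in>supp_measure \<mu>. \<forall>r>0. ball x r \<subseteq> U \<longrightarrow>
        (\<forall>H\<in>H_collection. \<not> F ` (ball x r \<inter> supp_measure \<mu>) \<subseteq> H))"

section \<open>Multiplicative approximation\<close>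

definition Pi_abs :: "real^'k \<Rightarrow> real" where
  "Pi_abs x = (\<Prod>i\<in>UNIV. \<bar>x $ i\<bar>)"

definition Pi_plus :: "real^'k \<Rightarrow> real" where
  "Pi_plus x = (\<Prod>i\<in>UNIV. max 1 \<bar>x $ i\<bar>)"

definition real_of_int_vec :: "int^'k \<Rightarrow> real^'k" where
  "real_of_int_vec z = (\<chi> i. real_of_int (z $ i))"

definition VWMA :: "real^'n^'m \<Rightarrow> bool" where
  "VWMA Y \<longleftrightarrow>
     (\<exists>\<epsilon>>0. \<forall>Q\<^sub>0. \<exists>Q>1. Q > Q\<^sub>0 \<and>
        (\<exists>(q :: int^'n) (p :: int^'m). q \<noteq> 0 \<and>
           Pi_abs (Y *v real_of_int_vec q - real_of_int_vec p) < Q powr (- 1 - \<epsilon>) \<and>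
           Pi_plus (real_of_int_vec q) \<le> Q))"

definition strongly_extremal :: "(real^'n^'m) measure \<Rightarrow> bool" where
  "strongly_extremal \<nu> \<longleftrightarrow> (AE Y in \<nu>. \<not> VWMA Y)"

end

theory Submission
  imports Defs
begin

text \<open>
  If \<open>Y\<close> is VWMA, then for infinitely many \<open>a\<close> some diagonal element \<open>g\<close> with
  exponents bounded by a multiple of \<open>a\<close>, expanding the first \<open>m\<close> coordinates and contracting the
  last \<open>n\<close>, maps a nonzero vector of the lattice attached to \<open>Y\<close> to a vector of size \<open>2^(-a)\<close>. There
  are only polynomially many such \<open>g\<close>, so by Borel-Cantelli it suffices that for each \<open>g\<close> the set of
  \<open>x\<close> with an \<open>\<epsilon>\<close>-short vector has measure \<open>O(\<epsilon>^\<alpha>)\<close>, uniformly in \<open>g\<close>. This is quantitative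
  nondivergence in the style of Kleinbock and Margulis. It needs a lower bound, uniform in \<open>g\<close>, for
  the supremum over a ball of the covolume of every rational subspace. Some coordinates of the exterior
  product are not contracted by any \<open>g\<close>; by weak non-planarity, used for subspaces of dimension \<open>m\<close>,
  they do not vanish identically on the ball, and the bound follows from the compactness of the
  orthogonal group.
\<close>

section \<open>Marked points\<close>

text \<open>Weak non-planarity concerns only \<open>n\<close> by \<open>n\<close> determinants, that
  is, subspaces of dimension \<open>m\<close>. It suffices in every dimension because the rows
  carrying a frame are indexed by a flag of index sets passing through \<open>range Inl\<close>: an
  orthonormal frame of smaller dimension is extended to \<open>m\<close> rows, one of larger
  dimension contains \<open>m\<close> rows, and an exchange argument turns the nonvanishing
  coordinate in dimension \<open>m\<close> into a non-contracted one in the given dimension.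
  Uniformity over the infinitely many subspaces and all \<open>g\<close> has two sources. All
  coordinates of the exterior products are affine combinations of minors of \<open>F x\<close>, so
  one pair \<open>C\<close>, \<alpha> serves them all. And an integral frame has a maximal minor of
  size at least 1, so replacing it by an orthonormal frame of the same subspace costs only a
  factorial; this reduces the lower bound to a compact family of matrices.\<close>

text \<open>
  \<open>F\<close> plays the role of a flag of subspaces whose covolumes lie between \<open>\<epsilon>\<close> and \<open>\<rho>\<close>, and which no
  subspace of covolume less than \<open>\<rho>\<close> refines.
\<close>

definition marked :: "('s \<Rightarrow> 's \<Rightarrow> bool) \<Rightarrow> ('s \<Rightarrow> 'a \<Rightarrow> real) \<Rightarrow> real \<Rightarrow> real \<Rightarrow> 's set \<Rightarrow> 'a \<Rightarrow> bool" where
  "marked cmp \<psi> \<epsilon> \<rho> P x \<longleftrightarrow> (\<exists>F\<subseteq>P. pairwise cmp F \<and> (\<forall>s\<in>F. \<epsilon> \<le> \<psi> s x \<and> \<psi> s x \<le> \<rho>) \<and>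
     (\<forall>s\<in>P - F. (\<forall>t\<in>F. cmp s t) \<longrightarrow> \<rho> \<le> \<psi> s x))"

lemma marked_insert:
  assumes "symp cmp" "s0 \<in> P" "\<epsilon> \<le> \<psi> s0 x" "\<psi> s0 x \<le> \<rho>"
    and "marked cmp \<psi> \<epsilon> \<rho> {s \<in> P. s \<noteq> s0 \<and> cmp s s0} x"
  shows "marked cmp \<psi> \<epsilon> \<rho> P x"
proof -
  obtain F where F: "F \<subseteq> {s \<in> P. s \<noteq> s0 \<and> cmp s s0}" "pairwise cmp F"
    "\<forall>s\<in>F. \<epsilon> \<le> \<psi> s x \<and> \<psi> s x \<le> \<rho>"
    "\<forall>s\<in>{s \<in> P. s \<noteq> s0 \<and> cmp s s0} - F. (\<forall>t\<in>F. cmp s t) \<longrightarrow> \<rho> \<le> \<psi> s x"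
    using assms(5) unfolding marked_def by blast
  have "pairwise cmp (insert s0 F)"
    using F(1,2) assms(1) by (auto simp: pairwise_insert symp_def)
  with F assms show ?thesis
    unfolding marked_def by (intro exI[of _ "insert s0 F"]) auto
qed

text \<open>Each level of the induction loses three triplings: two lead from a ball of radius
  \<open>r / 5\<close> to one of radius \<open>9/5 * r\<close>, the third from
  \<open>ball x0 r0\<close> to \<open>ball x0 (3 * r0)\<close>. The summand 1 pays for the set where
  the chosen index is itself below \<epsilon>, the other for the previous level.\<close>

fun nondiv_const :: "real \<Rightarrow> nat \<Rightarrow> real" where
  "nondiv_const D 0 = 0"
| "nondiv_const D (Suc k) = D ^ 3 * (1 + nondiv_const D k)"

lemma nondiv_const_nonneg: "D \<ge> 0 \<Longrightarrow> nondiv_const D k \<ge> 0"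
  by (induction k) auto

lemma federer_dilate:
  assumes "D_federer_on D \<mu> W" "x \<in> supp_measure \<mu>" "r > 0" "ball x r \<subseteq> W"
  shows "emeasure \<mu> (ball x (3 * r) \<inter> space \<mu>) \<le> ennreal D * emeasure \<mu> (ball x r)"
  using assms unfolding D_federer_on_def by (meson less_imp_le)

text \<open>The set \<open>R\<close> of radii on which some index stays below \<rho> contains a
  positive number, by continuity of \<open>\<psi> s1\<close>, and is bounded by \<open>b\<close>.
  Any \<open>r\<close> in \<open>R\<close> exceeding 5/9 of the supremum works: \<open>r\<close> has
  its own witness \<open>s\<close>, while \<open>9/5 * r\<close> lies beyond the supremum, so no
  index stays below \<rho> there.\<close>

lemma almost_maximal_radius:
  fixes \<psi> :: "'s \<Rightarrow> 'a::euclidean_space \<Rightarrow> real"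
  assumes W: "open W" "y \<in> W \<inter> A" and cont: "\<And>s. s \<in> P \<Longrightarrow> continuous_on W (\<psi> s)"
    and small: "s1 \<in> P" "\<psi> s1 y < \<rho>"
    and large: "\<And>s. s \<in> P \<Longrightarrow> \<exists>z\<in>ball y b \<inter> A. \<rho> \<le> \<psi> s z"
  obtains s r where "s \<in> P" "0 < r" "r \<le> b" "\<And>z. z \<in> ball y r \<inter> A \<Longrightarrow> \<psi> s z < \<rho>"
    "\<And>s'. s' \<in> P \<Longrightarrow> \<exists>z\<in>ball y (9/5 * r) \<inter> A. \<rho> \<le> \<psi> s' z"
proof -
  define R where "R = {r. 0 < r \<and> (\<exists>s\<in>P. \<forall>z\<in>ball y r \<inter> A. \<psi> s z < \<rho>)}"
  have ub: "r \<le> b" if "r \<in> R" for r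
  proof (rule ccontr)
    assume "\<not> r \<le> b"
    then have "ball y b \<subseteq> ball y r" by auto
    with that large show False unfolding R_def by (fastforce simp: not_less[symmetric])
  qed
  have "open {z \<in> W. \<psi> s1 z < \<rho>}"
    using continuous_on_open_vimage[OF W(1), of "\<psi> s1"] cont[OF small(1)]
    by (auto simp: vimage_def Int_def conj_commute dest!: spec[of _ "{..<\<rho>}"])
  then obtain e where e: "e > 0" "ball y e \<subseteq> {z \<in> W. \<psi> s1 z < \<rho>}"
    using W(2) small(2) openE[of "{z \<in> W. \<psi> s1 z < \<rho>}" y] by auto
  then have eR: "e \<in> R" using small(1) by (auto simp: R_def)
  have bdd: "bdd_above R" using ub by (auto simp: bdd_above_def)
  have pos: "Sup R > 0" using cSup_upper[OF eR bdd] e(1) by linarith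
  have "Sup R / (9/5) < Sup R" using pos by (simp add: field_simps)
  then obtain r where r: "r \<in> R" "Sup R / (9/5) < r"
    using less_cSup_iff[of R "Sup R / (9/5)"] eR bdd by auto
  have "9/5 * r \<notin> R"
  proof
    assume "9/5 * r \<in> R"
    then have "9/5 * r \<le> Sup R" using cSup_upper bdd by blast
    with r(2) show False by (simp add: field_simps)
  qed
  moreover have "0 < 9/5 * r" using r(1) by (simp add: R_def)
  ultimately have "\<And>s'. s' \<in> P \<Longrightarrow> \<exists>z\<in>ball y (9/5 * r) \<inter> A. \<rho> \<le> \<psi> s' z"
    unfolding R_def mem_Collect_eq by (meson not_less)
  moreover obtain s where "s \<in> P" "\<forall>z\<in>ball y r \<inter> A. \<psi> s z < \<rho>" using r(1) by (auto simp: R_def)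
  moreover have "0 < r" "r \<le> b" using r(1) ub by (auto simp: R_def)
  ultimately show ?thesis using that by blast
qed

text \<open>The bound is an integral over \<open>count_space C\<close> because the Vitali covering
  yields a set of centres that is countable but not enumerated and may be finite.\<close>

lemma emeasure_UN_countable_le:
  assumes "countable C" "\<And>y. y \<in> C \<Longrightarrow> A y \<in> sets M"
  shows "emeasure M (\<Union>y\<in>C. A y) \<le> (\<integral>\<^sup>+y. emeasure M (A y) \<partial>count_space C)"
proof -
  have "emeasure M (\<Union>y\<in>C. A y) = (\<integral>\<^sup>+x. indicator (\<Union>y\<in>C. A y) x \<partial>M)"
    using assms by (intro nn_integral_indicator[symmetric] sets.countable_UN') auto
  also have "\<dots> \<le> (\<integral>\<^sup>+x. (\<integral>\<^sup>+y. indicator (A y) x \<partial>count_space C) \<partial>M)"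
  proof (rule nn_integral_mono)
    fix x
    show "indicator (\<Union>y\<in>C. A y) x \<le> (\<integral>\<^sup>+y. indicator (A y) x \<partial>count_space C)"
    proof (cases "x \<in> (\<Union>y\<in>C. A y)")
      case True
      then obtain y where y: "y \<in> C" "x \<in> A y" by auto
      have "1 = (\<integral>\<^sup>+z. indicator {y} z \<partial>count_space C)"
        using y by (subst nn_integral_indicator) auto
      also have "\<dots> \<le> (\<integral>\<^sup>+y. indicator (A y) x \<partial>count_space C)"
        using y by (intro nn_integral_mono) (auto split: split_indicator)
      finally show ?thesis using True by simp
    qed simp
  qed
  also have "\<dots> = (\<integral>\<^sup>+y. (\<integral>\<^sup>+x. indicator (A y) x \<partial>M) \<partial>count_space C)"
    using assms by (subst nn_integral_count_space_nn_integral) auto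
  also have "\<dots> = (\<integral>\<^sup>+y. emeasure M (A y) \<partial>count_space C)"
    using assms(2) by (intro nn_integral_cong) auto
  finally show ?thesis .
qed

text \<open>
  A point where some \<open>\<psi> s\<close> is small is surrounded by a ball of almost maximal radius on which some
  \<open>\<psi> s\<close> stays below \<open>\<rho>\<close>. Then every \<open>\<psi> s'\<close> reaches \<open>\<rho>\<close> on a slightly larger ball, so the induction
  hypothesis applies there to the indices comparable with \<open>s\<close>. Taking the radius only almost maximal
  avoids assuming that finitely many \<open>\<psi> s\<close> are small at each point. The factor \<open>9/5 = 3 \<cdot> 3 / 5\<close>
  allows for the Vitali covering by balls of a fifth of the radius and two tripled balls.
\<close>

theorem marked_points_bound:
  fixes \<mu> :: "'a::euclidean_space measure" and \<psi> :: "'s \<Rightarrow> 'a \<Rightarrow> real" and c :: ennreal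
  assumes sets: "sets \<mu> = sets (restrict_space borel U)" and U: "open U" "W \<subseteq> U" "open W"
    and fed: "D_federer_on D \<mu> W" "D \<ge> 0"
    and cmp: "symp cmp"
    and "\<And>s. s \<in> P \<Longrightarrow> continuous_on W (\<psi> s)"
    and "\<And>s x r. s \<in> P \<Longrightarrow> x \<in> supp_measure \<mu> \<Longrightarrow> r > 0 \<Longrightarrow> ball x r \<subseteq> W \<Longrightarrow>
      \<exists>z\<in>ball x r \<inter> supp_measure \<mu>. \<rho> \<le> \<psi> s z \<Longrightarrow>
      emeasure \<mu> {y \<in> ball x r. \<psi> s y < \<epsilon>} \<le> c * emeasure \<mu> (ball x r)"
    and "\<And>F. F \<subseteq> P \<Longrightarrow> pairwise cmp F \<Longrightarrow> finite F \<and> card F \<le> k"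
    and "x0 \<in> supp_measure \<mu>" "r0 > 0" "ball x0 (5 ^ k * r0) \<subseteq> W"
    and "\<And>s. s \<in> P \<Longrightarrow> \<exists>z\<in>ball x0 r0 \<inter> supp_measure \<mu>. \<rho> \<le> \<psi> s z"
  shows "\<exists>N\<in>sets \<mu>. emeasure \<mu> N \<le> ennreal (nondiv_const D k) * c * emeasure \<mu> (ball x0 r0) \<and>
    (\<forall>x\<in>ball x0 r0 \<inter> supp_measure \<mu> - N. marked cmp \<psi> \<epsilon> \<rho> P x)"
  using assms(8-)
proof (induction k arbitrary: P x0 r0)
  case 0
  have "P = {}"
  proof (rule ccontr)
    assume "P \<noteq> {}"
    then obtain s where "s \<in> P" by blast
    then show False using "0.prems"(3)[of "{s}"] by auto
  qed
  then show ?case by (intro bexI[of _ "{}"]) (auto simp: marked_def)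
next
  case (Suc k)
  let ?S = "supp_measure \<mu>"
  have sp: "space \<mu> = U" using sets_eq_imp_space_eq[OF sets] by (simp add: space_restrict_space)
  have meas: "X \<in> sets \<mu>" if "X \<subseteq> U" "open X" for X
    using that U by (auto simp: sets sets_restrict_space_iff)
  have sub0: "ball x0 r0 \<subseteq> W"
    by (rule subset_trans[OF subset_ball Suc.prems(6)]) (use Suc.prems(5) in \<open>simp add: mult_le_cancel_right1 del: power_Suc\<close>)
  \<comment> \<open>Outside \<open>E\<close> the empty flag already marks the point, so only
    \<open>E\<close> has to be covered.\<close>
  define E where "E = {y \<in> ball x0 r0 \<inter> ?S. \<exists>s\<in>P. \<psi> s y < \<rho>}"
  have "\<forall>y\<in>E. \<exists>s r. s \<in> P \<and> 0 < r \<and> r \<le> 2 * r0 \<and> (\<forall>z \<in> ball y r \<inter> ?S. \<psi> s z < \<rho>) \<and>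
     (\<forall>s'\<in>P. \<exists>z\<in>ball y (9/5 * r) \<inter> ?S. \<rho> \<le> \<psi> s' z)"
  proof
    fix y assume y: "y \<in> E"
    then obtain s1 where s1: "s1 \<in> P" "\<psi> s1 y < \<rho>" by (auto simp: E_def)
    have sub: "ball x0 r0 \<subseteq> ball y (2 * r0)"
    proof
      fix z assume "z \<in> ball x0 r0"
      then have "dist x0 z < r0" "dist x0 y < r0" using y by (auto simp: E_def)
      then show "z \<in> ball y (2 * r0)" using dist_triangle[of y z x0] by (simp add: dist_commute)
    qed
    have *: "\<exists>z\<in>ball y (2 * r0) \<inter> ?S. \<rho> \<le> \<psi> s z" if "s \<in> P" for s
      using Suc.prems(7)[OF that] sub by blast
    have "y \<in> W \<inter> ?S" using y sub0 by (auto simp: E_def)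
    then show "\<exists>s r. s \<in> P \<and> 0 < r \<and> r \<le> 2 * r0 \<and> (\<forall>z \<in> ball y r \<inter> ?S. \<psi> s z < \<rho>) \<and>
     (\<forall>s'\<in>P. \<exists>z\<in>ball y (9/5 * r) \<inter> ?S. \<rho> \<le> \<psi> s' z)"
      by (rule almost_maximal_radius[where P = P and \<psi> = \<psi> and \<rho> = \<rho> and b = "2 * r0", OF \<open>open W\<close> _ Suc.prems(1) s1 *])
        blast+
  qed
  then obtain sf rf where sr: "\<And>y. y \<in> E \<Longrightarrow> sf y \<in> P" "\<And>y. y \<in> E \<Longrightarrow> 0 < rf y"
    "\<And>y. y \<in> E \<Longrightarrow> rf y \<le> 2 * r0"
    "\<And>y z. y \<in> E \<Longrightarrow> z \<in> ball y (rf y) \<inter> ?S \<Longrightarrow> \<psi> (sf y) z < \<rho>"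
    "\<And>y s. y \<in> E \<Longrightarrow> s \<in> P \<Longrightarrow> \<exists>z\<in>ball y (9/5 * rf y) \<inter> ?S. \<rho> \<le> \<psi> s z"
    unfolding bchoice_iff by blast
  define Py where "Py y = {s \<in> P. s \<noteq> sf y \<and> cmp s (sf y)}" for y
  \<comment> \<open>The centre lies in \<open>ball x0 r0\<close> and
    \<open>rf y \<le> 2 * r0\<close>, so everything is within \<open>(1 + 18/5 * 5 ^ k) * r0\<close>
    of \<open>x0\<close>, and this is at most \<open>5 * 5 ^ k * r0\<close>. Hence the factor 5 per
    level in the hypothesis on \<open>W\<close>.\<close>
  have ballW: "ball y (5 ^ k * (9/5 * rf y)) \<subseteq> W" if y: "y \<in> E" for y
  proof -
    have "ball y (5 ^ k * (9/5 * rf y)) \<subseteq> ball x0 (5 ^ Suc k * r0)"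
    proof
      fix z assume "z \<in> ball y (5 ^ k * (9/5 * rf y))"
      then have "dist y z < 5 ^ k * (9/5 * rf y)" by simp
      also have "\<dots> \<le> 5 ^ k * (9/5 * (2 * r0))" using sr(3)[OF y] by (intro mult_left_mono) auto
      finally have "dist x0 z < r0 + 5 ^ k * (18/5 * r0)"
        using y dist_triangle[of x0 z y] by (auto simp: E_def)
      moreover have "r0 * 1 \<le> r0 * 5 ^ k" using Suc.prems(5) by (intro mult_left_mono) auto
      moreover have "5 ^ k * (18/5 * r0) = 18/5 * (r0 * 5 ^ k)" "5 ^ Suc k * r0 = 5 * (r0 * 5 ^ k)"
        by simp_all
      ultimately show "z \<in> ball x0 (5 ^ Suc k * r0)"
        using Suc.prems(5) unfolding mem_ball by linarith
    qed
    with Suc.prems(6) show ?thesis by blast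
  qed
  have ballW1: "ball y (9/5 * rf y) \<subseteq> W" if y: "y \<in> E" for y
    by (rule subset_trans[OF subset_ball ballW[OF y]]) (use sr(2)[OF y] in \<open>simp add: mult_le_cancel_right1\<close>)
  define K where "K = ennreal (1 + nondiv_const D k) * c * ennreal (D ^ 2)"
  have Nex: "\<exists>N\<in>sets \<mu>. emeasure \<mu> N \<le> K * emeasure \<mu> (ball y (rf y / 5)) \<and>
       (\<forall>x\<in>ball y (rf y) \<inter> ?S - N. marked cmp \<psi> \<epsilon> \<rho> P x)" if y: "y \<in> E" for y
  proof -
    let ?B = "ball y (9/5 * rf y)"
    have yS: "y \<in> ?S" and r: "rf y > 0" using y sr by (auto simp: E_def)
    \<comment> \<open>Adjoining \<open>sf y\<close> to a chain in \<open>Py y\<close> gives a chain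
      in \<open>P\<close>, so the bound on the length of chains drops by one.\<close>
    have chain: "finite F \<and> card F \<le> k" if "F \<subseteq> Py y" "pairwise cmp F" for F
    proof -
      have "pairwise cmp (insert (sf y) F)"
        using that cmp by (auto simp: pairwise_insert symp_def Py_def)
      moreover have "insert (sf y) F \<subseteq> P" using that sr(1)[OF y] by (auto simp: Py_def)
      moreover have "sf y \<notin> F" using that by (auto simp: Py_def)
      ultimately show ?thesis using Suc.prems(3)[of "insert (sf y) F"] by auto
    qed
    obtain N where N: "N \<in> sets \<mu>"
       "emeasure \<mu> N \<le> ennreal (nondiv_const D k) * c * emeasure \<mu> ?B"
       "\<forall>x\<in>?B \<inter> ?S - N. marked cmp \<psi> \<epsilon> \<rho> (Py y) x"
    proof -
      have "\<exists>N\<in>sets \<mu>. emeasure \<mu> N \<le> ennreal (nondiv_const D k) * c * emeasure \<mu> ?B \<and>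
          (\<forall>x\<in>?B \<inter> ?S - N. marked cmp \<psi> \<epsilon> \<rho> (Py y) x)"
        by (rule Suc.IH[OF Suc.prems(1) Suc.prems(2) chain yS _ ballW[OF y]])
          (use r sr(5)[OF y] in \<open>auto simp: Py_def\<close>)
      then show ?thesis using that by blast
    qed
    \<comment> \<open>On \<open>M\<close> the index \<open>sf y\<close> is too small to join the
      flag. Since it reaches \<rho> somewhere on \<open>?B\<close>, the sublevel hypothesis bounds
      the measure of \<open>M\<close>.\<close>
    define M where "M = {z \<in> ?B. \<psi> (sf y) z < \<epsilon>}"
    have cM: "continuous_on ?B (\<psi> (sf y))"
      using Suc.prems(1)[OF sr(1)[OF y]] ballW1[OF y] continuous_on_subset by blast
    have "open M"
      using continuous_on_open_vimage[of ?B "\<psi> (sf y)"] cM unfolding M_def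
      by (auto simp: vimage_def Int_def conj_commute dest!: spec[of _ "{..<\<epsilon>}"])
    then have M: "M \<in> sets \<mu>" using ballW1[OF y] U by (intro meas) (auto simp: M_def)
    have Mle: "emeasure \<mu> M \<le> c * emeasure \<mu> ?B"
      unfolding M_def
      by (rule Suc.prems(2)[OF sr(1)[OF y] yS _ ballW1[OF y] sr(5)[OF y sr(1)[OF y]]]) (use r in auto)
    have Ble: "emeasure \<mu> ?B \<le> ennreal (D ^ 2) * emeasure \<mu> (ball y (rf y / 5))"
    proof -
      have s1: "ball y (rf y / 5) \<subseteq> W" "ball y (3 * (rf y / 5)) \<subseteq> W"
        using ballW1[OF y] r by (auto intro!: subset_trans[OF _ ballW1[OF y]])
      have "?B = ball y (3 * (3 * (rf y / 5))) \<inter> space \<mu>"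
        using ballW1[OF y] U sp by (auto simp: algebra_simps)
      then have "emeasure \<mu> ?B \<le> ennreal D * emeasure \<mu> (ball y (3 * (rf y / 5)))"
        using federer_dilate[OF fed(1) yS _ s1(2)] r by simp
      also have "ball y (3 * (rf y / 5)) = ball y (3 * (rf y / 5)) \<inter> space \<mu>"
        using s1(2) U sp by auto
      also have "emeasure \<mu> \<dots> \<le> ennreal D * emeasure \<mu> (ball y (rf y / 5))"
        using federer_dilate[OF fed(1) yS _ s1(1)] r by simp
      finally show ?thesis using fed(2)
        by (simp add: power2_eq_square ennreal_mult mult.assoc mult_left_mono)
    qed
    have "emeasure \<mu> (N \<union> M) \<le> emeasure \<mu> N + emeasure \<mu> M"
      using N(1) M by (rule emeasure_subadditive)
    also have "\<dots> \<le> ennreal (nondiv_const D k) * c * emeasure \<mu> ?B + c * emeasure \<mu> ?B"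
      using N(2) Mle by (rule add_mono)
    also have "\<dots> = ennreal (1 + nondiv_const D k) * c * emeasure \<mu> ?B"
      using nondiv_const_nonneg[OF fed(2)] by (simp add: ennreal_plus algebra_simps)
    also have "\<dots> \<le> K * emeasure \<mu> (ball y (rf y / 5))"
      unfolding K_def mult.assoc by (intro mult_left_mono Ble) auto
    finally have "emeasure \<mu> (N \<union> M) \<le> K * emeasure \<mu> (ball y (rf y / 5))" .
    moreover have "marked cmp \<psi> \<epsilon> \<rho> P x" if x: "x \<in> ball y (rf y) \<inter> ?S - (N \<union> M)" for x
    proof -
      have xB: "x \<in> ?B" using x r by auto
      then have "marked cmp \<psi> \<epsilon> \<rho> (Py y) x" using N(3) x by blast
      moreover have "\<epsilon> \<le> \<psi> (sf y) x" using x xB by (auto simp: M_def)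
      moreover have "\<psi> (sf y) x \<le> \<rho>" using sr(4)[OF y, of x] x by auto
      ultimately show ?thesis using marked_insert[OF cmp sr(1)[OF y]] by (simp add: Py_def)
    qed
    ultimately show ?thesis using N(1) M by blast
  qed
  then obtain Nf where Nf: "\<And>y. y \<in> E \<Longrightarrow> Nf y \<in> sets \<mu>"
    "\<And>y. y \<in> E \<Longrightarrow> emeasure \<mu> (Nf y) \<le> K * emeasure \<mu> (ball y (rf y / 5))"
    "\<And>y x. y \<in> E \<Longrightarrow> x\<in>ball y (rf y) \<inter> ?S - Nf y \<Longrightarrow> marked cmp \<psi> \<epsilon> \<rho> P x"
    by metis
  \<comment> \<open>Marking is known on the balls of radius \<open>rf y\<close>, which are the
    fivefold dilates of the disjoint balls. The bounds in \<open>Nex\<close> are relative to those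
    disjoint balls and therefore add up to at most the measure of one ball around
    \<open>x0\<close>.\<close>
  obtain C where C: "countable C" "C \<subseteq> E"
    "pairwise (\<lambda>i j. disjnt (ball i (rf i / 5)) (ball j (rf j / 5))) C"
    "E \<subseteq> (\<Union>i\<in>C. ball i (5 * (rf i / 5)))"
  proof (rule Vitali_covering_lemma_balls[of E "\<lambda>y. y" "\<lambda>y. rf y / 5" E "2 * r0"])
    show "E \<subseteq> (\<Union>i\<in>E. ball i (rf i / 5))" using sr(2) by force
    show "0 < rf i / 5 \<and> rf i / 5 \<le> 2 * r0" if "i \<in> E" for i using sr(2,3)[OF that] by simp
  qed (use that in auto)
  let ?N = "\<Union>y\<in>C. Nf y"
  have Nmeas: "?N \<in> sets \<mu>" using C Nf(1) by (intro sets.countable_UN') auto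
  have sub3: "ball y (rf y / 5) \<subseteq> ball x0 (3 * r0) \<inter> U" if y: "y \<in> E" for y
  proof -
    have "ball y (rf y / 5) \<subseteq> ball x0 (3 * r0)"
    proof
      fix z assume "z \<in> ball y (rf y / 5)"
      then show "z \<in> ball x0 (3 * r0)"
        using y sr(3)[OF y] dist_triangle[of x0 z y] Suc.prems(5) by (auto simp: E_def)
    qed
    moreover have "ball y (rf y / 5) \<subseteq> W"
      by (rule subset_trans[OF subset_ball ballW1[OF y]]) (use sr(2)[OF y] in simp)
    ultimately show ?thesis using U by auto
  qed
  have "emeasure \<mu> ?N \<le> (\<integral>\<^sup>+y. emeasure \<mu> (Nf y) \<partial>count_space C)"
    using C Nf(1) by (intro emeasure_UN_countable_le) auto
  also have "\<dots> \<le> (\<integral>\<^sup>+y. K * emeasure \<mu> (ball y (rf y / 5)) \<partial>count_space C)"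
    using C(2) Nf(2) by (intro nn_integral_mono) auto
  also have "\<dots> = K * (\<integral>\<^sup>+y. emeasure \<mu> (ball y (rf y / 5)) \<partial>count_space C)"
    by (rule nn_integral_cmult) auto
  also have "(\<integral>\<^sup>+y. emeasure \<mu> (ball y (rf y / 5)) \<partial>count_space C)
      = emeasure \<mu> (\<Union>y\<in>C. ball y (rf y / 5))"
  proof (rule emeasure_UN_countable[symmetric])
    show "ball y (rf y / 5) \<in> sets \<mu>" if "y \<in> C" for y
      using sub3[of y] that C(2) by (intro meas) auto
    show "disjoint_family_on (\<lambda>y. ball y (rf y / 5)) C"
      using C(3) unfolding disjoint_family_on_def pairwise_def disjnt_def by blast
  qed (rule C(1))
  also have "emeasure \<mu> (\<Union>y\<in>C. ball y (rf y / 5)) \<le> emeasure \<mu> (ball x0 (3 * r0) \<inter> space \<mu>)"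
  proof (rule emeasure_mono)
    show "(\<Union>y\<in>C. ball y (rf y / 5)) \<subseteq> ball x0 (3 * r0) \<inter> space \<mu>"
      using C(2) sub3 unfolding sp by blast
    show "ball x0 (3 * r0) \<inter> space \<mu> \<in> sets \<mu>" using U by (intro meas) (auto simp: sp)
  qed
  also have "\<dots> \<le> ennreal D * emeasure \<mu> (ball x0 r0)"
    by (rule federer_dilate[OF fed(1) Suc.prems(4,5) sub0])
  finally have "emeasure \<mu> ?N \<le> K * (ennreal D * emeasure \<mu> (ball x0 r0))"
    by (simp add: mult_left_mono)
  also have "\<dots> = ennreal (nondiv_const D (Suc k)) * c * emeasure \<mu> (ball x0 r0)"
    using fed(2) nondiv_const_nonneg[OF fed(2), of k]
    by (simp add: K_def ennreal_mult power3_eq_cube power2_eq_square ac_simps)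
  finally have "emeasure \<mu> ?N \<le> ennreal (nondiv_const D (Suc k)) * c * emeasure \<mu> (ball x0 r0)" .
  moreover have "marked cmp \<psi> \<epsilon> \<rho> P x" if x: "x \<in> ball x0 r0 \<inter> ?S - ?N" for x
  proof (cases "x \<in> E")
    case True
    then obtain y where "y \<in> C" "x \<in> ball y (rf y)" using C(4) by auto
    then show ?thesis using Nf(3)[of y x] x C(2) by auto
  next
    case False
    with x show ?thesis unfolding marked_def E_def by (intro exI[of _ "{}"]) auto
  qed
  ultimately show ?case using Nmeas by blast
qed

section \<open>Exterior products of rows\<close>

text \<open>
  The coordinates of the exterior product of the rows in \<open>J\<close>, that is, the maximal minors of these rows
  up to sign. Filling up with unit vectors keeps all determinants of one fixed size.
\<close>

definition wedge :: "'k set \<Rightarrow> ('k \<Rightarrow> 'k) \<Rightarrow> real^'k^'k \<Rightarrow> real" where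
  "wedge J b M = det (\<chi> c. if c \<in> J then M $ c else axis (b c) 1)"

text \<open>Ranging over all maps \<open>b\<close> does no harm: a map that is not injective on the
  complement of \<open>J\<close> produces two equal rows and hence the value 0.\<close>

definition wnorm :: "'k::finite set \<Rightarrow> real^'k^'k \<Rightarrow> real" where
  "wnorm J M = Max (range (\<lambda>b. \<bar>wedge J b M\<bar>))"

definition diag_mat :: "('k \<Rightarrow> real) \<Rightarrow> real^'k^'k" where
  "diag_mat g = (\<chi> i j. if i = j then g i else 0)"

lemma wedge_le_wnorm: "\<bar>wedge J b M\<bar> \<le> wnorm J M"
  unfolding wnorm_def by (intro Max_ge) auto

lemma wnorm_attained: obtains b where "wnorm J M = \<bar>wedge J b M\<bar>"
proof -
  have "wnorm J M \<in> range (\<lambda>b. \<bar>wedge J b M\<bar>)" unfolding wnorm_def by (intro Max_in) auto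
  then show ?thesis using that by blast
qed

lemma wnorm_nonneg: "wnorm J M \<ge> 0"
  using wedge_le_wnorm[of J id M] by linarith

lemma wnorm_le_iff: "wnorm J M \<le> r \<longleftrightarrow> (\<forall>b. \<bar>wedge J b M\<bar> \<le> r)"
  unfolding wnorm_def by (subst Max_le_iff) auto

lemma wedge_cong: "(\<And>c. c \<in> J \<Longrightarrow> M $ c = N $ c) \<Longrightarrow> wedge J b M = wedge J b N"
  unfolding wedge_def by (rule arg_cong[where f = det]) (auto simp: vec_eq_iff)

lemma wnorm_cong: "(\<And>c. c \<in> J \<Longrightarrow> M $ c = N $ c) \<Longrightarrow> wnorm J M = wnorm J N"
  unfolding wnorm_def using wedge_cong[of J M N] by simp

lemma mat_mult_row: "(M ** H) $ c = M $ c v* H"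
  by (simp add: vec_eq_iff matrix_matrix_mult_def vector_matrix_mult_def mult.commute)

lemma det_row_repl_linear:
  fixes A :: "'k::finite \<Rightarrow> real^'k"
  shows "linear (\<lambda>x. det (\<chi> i. if i = c then x else A i))"
proof (rule linearI)
  show "det (\<chi> i. if i = c then x + y else A i) =
      det (\<chi> i. if i = c then x else A i) + det (\<chi> i. if i = c then y else A i)" for x y
    using det_row_add[of c "\<lambda>_. x" "\<lambda>_. y" A] by simp
  show "det (\<chi> i. if i = c then r *\<^sub>R x else A i) = r *\<^sub>R det (\<chi> i. if i = c then x else A i)" for r x
    using det_row_mul[of c r "\<lambda>_. x" A] unfolding scalar_mult_eq_scaleR by simp
qed

lemma det_eq_rows:
  fixes A :: "'k::finite \<Rightarrow> real^'k"
  assumes "i \<noteq> j" "A i = A j"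
  shows "det (\<chi> i. A i) = 0"
  using assms by (intro det_identical_rows[of i j]) (auto simp: row_def)

text \<open>Steinitz exchange for determinants. As a function of row \<open>c\<close> the
  determinant is linear and vanishes on every other row; if it vanished on \<open>T\<close> too, it
  would vanish on a span containing \<open>A c\<close>, against \<open>det \<noteq> 0\<close>. Hence
  some \<open>t\<close> in \<open>T\<close> can replace row \<open>c\<close>, and the span condition
  persists for the remaining rows.\<close>

lemma det_exchange:
  fixes A :: "'k::finite \<Rightarrow> real^'k"
  assumes "finite R" "det (\<chi> c. A c) \<noteq> 0" "\<And>c. c \<in> R \<Longrightarrow> A c \<in> span (T \<union> A ` (- R))"
  shows "\<exists>A'. (\<forall>c. c \<notin> R \<longrightarrow> A' c = A c) \<and> (\<forall>c\<in>R. A' c \<in> T) \<and> det (\<chi> c. A' c) \<noteq> 0"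
  using assms
proof (induction R arbitrary: A rule: finite_induct)
  case empty
  then show ?case by (intro exI[of _ A]) auto
next
  case (insert c R)
  let ?d = "\<lambda>x. det (\<chi> i. if i = c then x else A i)"
  have "\<exists>t\<in>T. ?d t \<noteq> 0"
  proof (rule ccontr)
    assume "\<not> (\<exists>t\<in>T. ?d t \<noteq> 0)"
    then have "?d t = 0" if "t \<in> T \<union> A ` (- insert c R)" for t
      using that det_eq_rows[of c _ "\<lambda>i. if i = c then t else A i"] by force
    then have "?d (A c) = 0"
      using insert.prems(2)[of c] linear_eq_0_on_span[OF det_row_repl_linear] by blast
    moreover have "(\<lambda>i. if i = c then A c else A i) = A" by auto
    ultimately show False using insert.prems(1) by simp
  qed
  then obtain t where t: "t \<in> T" "?d t \<noteq> 0" by blast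
  let ?A = "A(c := t)"
  have "?d t = det (\<chi> i. ?A i)" by (rule arg_cong[where f = det]) (auto simp: vec_eq_iff)
  moreover have "?A c' \<in> span (T \<union> ?A ` (- R))" if "c' \<in> R" for c'
  proof -
    have "A c' \<in> span (T \<union> A ` (- insert c R))" using insert.prems(2)[of c'] that by auto
    also have "\<dots> \<subseteq> span (T \<union> ?A ` (- R))" by (intro span_mono) (auto simp: image_iff)
    finally show ?thesis using that insert.hyps by auto
  qed
  ultimately obtain A' where "\<forall>c. c \<notin> R \<longrightarrow> A' c = ?A c" "\<forall>c\<in>R. A' c \<in> T" "det (\<chi> c. A' c) \<noteq> 0"
    using insert.IH[of ?A] t by auto
  then show ?case using t(1) insert.hyps by (intro exI[of _ A']) auto
qed

lemma in_span_image_sum: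
  assumes "finite J" "x \<in> span (f ` J)"
  shows "\<exists>u. x = (\<Sum>a\<in>J. u a *\<^sub>R f a)"
  using assms(2)
proof (induction rule: span_induct_alt)
  case base
  show ?case by (intro exI[of _ "\<lambda>_. 0"]) auto
next
  case (step c y z)
  then obtain a u where a: "a \<in> J" "y = f a" and u: "z = (\<Sum>a\<in>J. u a *\<^sub>R f a)" by auto
  have "c *\<^sub>R y + z = (\<Sum>i\<in>J. (u i + (if i = a then c else 0)) *\<^sub>R f i)"
    using a assms(1) u by (simp add: scaleR_left_distrib sum.distrib if_distrib[of "\<lambda>r. r *\<^sub>R f _"] sum.delta cong: if_cong)
  then show ?case by (intro exI)
qed

text \<open>The coefficients of the rows of \<open>N\<close> in those of \<open>M\<close>, completed
  by the identity outside \<open>J\<close>, form a matrix \<open>C\<close> that carries the padded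
  \<open>M ** H\<close> to the padded \<open>N ** H\<close>; so \<open>d\<close> is
  \<open>det C\<close>. That one \<open>d\<close> serves all \<open>b\<close> and \<open>H\<close>
  is what allows two frames of a subspace to be compared before and after a transformation.\<close>

lemma wedge_change_basis:
  fixes M N :: "real^'k^'k"
  assumes "\<And>c. c \<in> J \<Longrightarrow> N $ c \<in> span ((\<lambda>c. M $ c) ` J)"
  obtains d where "\<And>b H. wedge J b (N ** H) = d * wedge J b (M ** H)"
proof -
  have "\<forall>c. \<exists>u. c \<in> J \<longrightarrow> N $ c = (\<Sum>a\<in>J. u a *\<^sub>R M $ a)"
    using in_span_image_sum[OF finite assms] by blast
  then obtain u where u: "\<And>c. c \<in> J \<Longrightarrow> N $ c = (\<Sum>a\<in>J. u c a *\<^sub>R M $ a)" by metis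
  define C :: "real^'k^'k" where
    "C = (\<chi> c a. if c \<in> J then (if a \<in> J then u c a else 0) else (if a = c then 1 else 0))"
  have "wedge J b (N ** H) = det C * wedge J b (M ** H)" for b H
  proof -
    let ?X = "(\<chi> c. if c \<in> J then (M ** H) $ c else axis (b c) 1) :: real^'k^'k"
    have "(\<chi> c. if c \<in> J then (N ** H) $ c else axis (b c) 1) = C ** ?X"
    proof (simp add: vec_eq_iff, intro allI conjI impI)
      fix c i assume "c \<in> J"
      then have "(C ** ?X) $ c $ i = (\<Sum>a\<in>UNIV. if a \<in> J then u c a * (M ** H) $ a $ i else 0)"
        by (auto simp: matrix_matrix_mult_def C_def intro!: sum.cong)
      also have "\<dots> = (\<Sum>a\<in>J. u c a * (M ** H) $ a $ i)" by (simp add: sum.If_cases)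
      also have "\<dots> = (\<Sum>r\<in>UNIV. \<Sum>a\<in>J. u c a * M $ a $ r * H $ r $ i)"
        by (subst sum.swap) (simp add: matrix_matrix_mult_def sum_distrib_left mult.assoc)
      also have "\<dots> = (N ** H) $ c $ i"
        using u[OF \<open>c \<in> J\<close>] by (simp add: matrix_matrix_mult_def sum_component sum_distrib_right)
      finally show "(N ** H) $ c $ i = (C ** ?X) $ c $ i" by simp
    next
      fix c i assume "c \<notin> J"
      have "(C ** ?X) $ c $ i = (\<Sum>a\<in>UNIV. if a = c then ?X $ c $ i else 0)"
        unfolding matrix_matrix_mult_def C_def vec_lambda_beta using \<open>c \<notin> J\<close> by (intro sum.cong) auto
      also have "\<dots> = ?X $ c $ i" by simp
      finally show "axis (b c) 1 $ i = (C ** ?X) $ c $ i" using \<open>c \<notin> J\<close> by simp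
    qed
    then show ?thesis by (simp add: wedge_def det_mul)
  qed
  then show ?thesis by (rule that)
qed

lemma axis_expansion: "(x :: real^'k) = (\<Sum>i\<in>UNIV. x $ i *\<^sub>R axis i 1)"
  using basis_expansion[of x] by (simp add: scalar_mult_eq_scaleR)

lemma in_span_axis: "(x :: real^'k) \<in> span (range (\<lambda>i. axis i 1) \<union> A)"
  by (subst axis_expansion) (auto intro!: span_sum span_scale intro: span_base)

text \<open>Expanding row \<open>c\<close> in unit vectors turns it into padding, and each term
  becomes a coordinate of the exterior product over \<open>J\<close>.\<close>

lemma wnorm_insert_le:
  fixes M :: "real^'k^'k"
  assumes "c \<notin> J"
  shows "wnorm (insert c J) M \<le> (\<Sum>i\<in>UNIV. \<bar>M $ c $ i\<bar>) * wnorm J M"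
  unfolding wnorm_le_iff
proof
  fix b
  let ?d = "\<lambda>x. det (\<chi> i. if i = c then x else if i \<in> J then M $ i else axis (b i) 1) :: real"
  have eq: "wedge (insert c J) b M = ?d (M $ c)"
    unfolding wedge_def by (rule arg_cong[where f = det]) (auto simp: vec_eq_iff)
  have "M $ c = (\<Sum>i\<in>UNIV. M $ c $ i *\<^sub>R axis i 1)"
    by (rule axis_expansion)
  then have "?d (M $ c) = ?d (\<Sum>i\<in>UNIV. M $ c $ i *\<^sub>R axis i 1)" by (rule arg_cong)
  also have "\<dots> = (\<Sum>i\<in>UNIV. M $ c $ i * ?d (axis i 1))"
    by (simp add: linear_sum[OF det_row_repl_linear] linear_scale[OF det_row_repl_linear])
  also have "\<bar>\<dots>\<bar> \<le> (\<Sum>i\<in>UNIV. \<bar>M $ c $ i * ?d (axis i 1)\<bar>)" by (rule sum_abs)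
  also have "\<dots> \<le> (\<Sum>i\<in>UNIV. \<bar>M $ c $ i\<bar> * wnorm J M)"
  proof (rule sum_mono)
    fix i
    have "?d (axis i 1) = wedge J (b(c := i)) M"
      unfolding wedge_def using assms by (intro arg_cong[where f = det]) (auto simp: vec_eq_iff)
    then show "\<bar>M $ c $ i * ?d (axis i 1)\<bar> \<le> \<bar>M $ c $ i\<bar> * wnorm J M"
      using wedge_le_wnorm[of J "b(c := i)" M] by (simp add: abs_mult mult_left_mono)
  qed
  finally show "\<bar>wedge (insert c J) b M\<bar> \<le> (\<Sum>i\<in>UNIV. \<bar>M $ c $ i\<bar>) * wnorm J M"
    by (simp add: eq sum_distrib_right)
qed

lemma det_abs_le_fact:
  fixes A :: "real^'k^'k"
  assumes "\<And>i j. \<bar>A $ i $ j\<bar> \<le> 1"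
  shows "\<bar>det A\<bar> \<le> fact CARD('k)"
proof -
  have "\<bar>det A\<bar> \<le> (\<Sum>p | p permutes (UNIV::'k set). \<bar>of_int (sign p) * (\<Prod>i\<in>UNIV. A $ i $ p i)\<bar>)"
    unfolding det_def by (rule sum_abs)
  also have "\<dots> \<le> (\<Sum>p | p permutes (UNIV::'k set). 1)"
    using assms by (intro sum_mono) (auto simp: abs_mult abs_prod sign_def intro!: prod_le_1)
  also have "\<dots> = fact CARD('k)" using card_permutations[of "UNIV::'k set"] by simp
  finally show ?thesis .
qed

lemma wedge_abs_le_fact:
  fixes E :: "real^'k^'k"
  assumes "\<And>i j. \<bar>E $ i $ j\<bar> \<le> 1"
  shows "\<bar>wedge J b E\<bar> \<le> fact CARD('k)"
  unfolding wedge_def using assms by (intro det_abs_le_fact) (auto simp: axis_def)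

lemma wedge_Ints:
  assumes "\<And>c i. c \<in> J \<Longrightarrow> M $ c $ i \<in> \<int>"
  shows "wedge J b M \<in> \<int>"
  unfolding wedge_def det_def using assms
  by (intro Ints_sum Ints_mult Ints_prod) (auto simp: axis_def)

lemma wedge_nonzero_inj:
  assumes "wedge J b M \<noteq> 0"
  shows "inj_on b (- J)"
proof (rule inj_onI, rule ccontr)
  fix x y assume "x \<in> - J" "y \<in> - J" "b x = b y" "x \<noteq> y"
  then have "wedge J b M = 0"
    unfolding wedge_def by (intro det_eq_rows[of x y]) auto
  with assms show False by simp
qed

text \<open>Multiplying the padded matrix by \<open>diag_mat g\<close> scales its padding row
  \<open>c\<close> by \<open>g (b c)\<close> and turns the rows in \<open>J\<close> into those of
  \<open>N ** diag_mat g\<close>. Up to sign, a coordinate is thus multiplied by the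
  \<open>g\<close> of the columns that the padding leaves free.\<close>

lemma wedge_diag:
  fixes N :: "real^'k^'k"
  shows "wedge J b (N ** diag_mat g) * (\<Prod>c\<in>-J. g (b c)) = wedge J b N * (\<Prod>i\<in>UNIV. g i)"
proof -
  let ?X = "(\<chi> c. if c \<in> J then N $ c else axis (b c) 1) :: real^'k^'k"
  let ?Y = "\<lambda>c. if c \<in> J then (N ** diag_mat g) $ c else axis (b c) 1"
  let ?s = "\<lambda>c. if c \<in> J then 1 else g (b c)"
  have row: "(A ** diag_mat g) $ c $ i = A $ c $ i * g i" for A :: "real^'k^'k" and c i
  proof -
    have "(A ** diag_mat g) $ c $ i = (\<Sum>k\<in>UNIV. if k = i then A $ c $ k * g k else 0)"
      unfolding matrix_matrix_mult_def diag_mat_def vec_lambda_beta by (intro sum.cong) auto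
    then show ?thesis by (simp add: sum.delta del: mult_cancel_left)
  qed
  have "?X ** diag_mat g = (\<chi> c. ?s c *s ?Y c)"
    by (auto simp: vec_eq_iff row axis_def)
  then have "det ?X * det (diag_mat g) = prod ?s UNIV * det (\<chi> c. ?Y c)"
    by (simp add: det_rows_mul flip: det_mul)
  moreover have "det (diag_mat g) = (\<Prod>i\<in>UNIV. g i)"
    by (subst det_diagonal) (auto simp: diag_mat_def)
  moreover have "prod ?s UNIV = (\<Prod>c\<in>-J. g (b c))"
    by (simp add: prod.If_cases Compl_eq)
  ultimately show ?thesis by (simp add: wedge_def mult.commute)
qed

text \<open>Orthonormal bases of \<open>L\<close> and of its orthogonal complement, indexed by
  \<open>J\<close> and \<open>- J\<close>, together form the rows. All subspaces of one dimension
  are thereby parametrised by a compact set of matrices.\<close>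

lemma orthogonal_matrix_spanning:
  fixes L :: "(real^'k) set"
  assumes "subspace L" "card J = dim L"
  obtains E :: "real^'k^'k" where "orthogonal_matrix E" "span ((\<lambda>c. E $ c) ` J) = L"
proof -
  obtain B where B: "B \<subseteq> L" "pairwise orthogonal B" "\<And>x. x \<in> B \<Longrightarrow> norm x = 1"
    "independent B" "card B = dim L" "span B = L"
    using orthonormal_basis_subspace[OF assms(1)] by blast
  let ?L' = "{y. \<forall>x\<in>L. orthogonal x y}"
  obtain B' where B': "B' \<subseteq> ?L'" "pairwise orthogonal B'" "\<And>x. x \<in> B' \<Longrightarrow> norm x = 1"
    "independent B'" "card B' = dim ?L'" "span B' = ?L'"
    using orthonormal_basis_subspace[OF subspace_orthogonal_to_vectors] by blast
  have "dim L + dim ?L' = CARD('k)"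
    using dim_subspace_orthogonal_to_vectors[OF assms(1) subspace_UNIV] by simp
  then have "card (- J) = card B'"
    using assms(2) B'(5) card_Diff_subset[of J UNIV] by (simp add: Compl_eq_Diff_UNIV)
  moreover have "finite B" "finite B'" using B(4) B'(4) by (auto intro: independent_imp_finite)
  ultimately obtain f f' where f: "bij_betw f J B" "bij_betw f' (- J) B'"
    using assms(2) B(5) by (metis finite bij_betw_iff_card)
  define E :: "real^'k^'k" where "E = (\<chi> c. if c \<in> J then f c else f' c)"
  have fin: "f c \<in> B" if "c \<in> J" for c using f(1) that by (auto simp: bij_betw_def)
  have fin': "f' c \<in> B'" if "c \<notin> J" for c using f(2) that by (auto simp: bij_betw_def)
  have BB': "orthogonal x y" if "x \<in> B" "y \<in> B'" for x y
    using that B(1) B'(1) by auto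
  have "orthogonal_matrix E"
    unfolding orthogonal_matrix_orthonormal_rows
  proof (intro conjI allI impI)
    fix i j :: 'k
    have row: "row c E = (if c \<in> J then f c else f' c)" for c by (simp add: row_def E_def vec_eq_iff)
    show "norm (row i E) = 1" using B(3) B'(3) fin fin' by (simp add: row)
    assume "i \<noteq> j"
    then have "i \<in> J \<Longrightarrow> j \<in> J \<Longrightarrow> f i \<noteq> f j" "i \<notin> J \<Longrightarrow> j \<notin> J \<Longrightarrow> f' i \<noteq> f' j"
      using f by (auto simp: bij_betw_def inj_on_def)
    then show "orthogonal (row i E) (row j E)"
      using B(2) B'(2) fin fin' BB' BB'[THEN orthogonal_commute[THEN iffD1]]
      by (auto simp: row pairwise_def)
  qed
  moreover have "(\<lambda>c. E $ c) ` J = B" using f(1) by (auto simp: E_def bij_betw_def)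
  ultimately show ?thesis using that B(6) by metis
qed

lemma orthogonal_matrix_entry_le_1:
  assumes "orthogonal_matrix (E :: real^'k^'k)"
  shows "\<bar>E $ i $ j\<bar> \<le> 1"
proof -
  have "norm (row i E) = 1" using assms by (simp add: orthogonal_matrix_orthonormal_rows)
  then have "norm (E $ i) = 1" by (simp add: row_def)
  then show ?thesis using component_le_norm_cart[of "E $ i" j] by simp
qed

lemma orthogonal_matrix_det_nonzero:
  "orthogonal_matrix (E :: real^'k^'k) \<Longrightarrow> det E \<noteq> 0"
  using det_orthogonal_matrix[of E] by auto

text \<open>For an orthogonal matrix whose rows in \<open>J\<close> have the same span, the rows
  outside \<open>J\<close> can be exchanged for unit vectors without killing the determinant. The
  resulting nonzero coordinate is a multiple of the same coordinate of \<open>M\<close>.\<close>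

lemma ex_wedge_nonzero:
  fixes M :: "real^'k^'k"
  assumes "card J = dim (span ((\<lambda>c. M $ c) ` J))"
  shows "\<exists>b. wedge J b M \<noteq> 0"
proof -
  let ?L = "span ((\<lambda>c. M $ c) ` J)"
  obtain E :: "real^'k^'k" where E: "orthogonal_matrix E" "span ((\<lambda>c. E $ c) ` J) = ?L"
    using orthogonal_matrix_spanning[OF subspace_span assms] .
  have "det (\<chi> c. E $ c) \<noteq> 0" using orthogonal_matrix_det_nonzero[OF E(1)] by simp
  from det_exchange[OF finite this in_span_axis, of "- J"]
  obtain A' where A': "\<forall>c. c \<notin> -J \<longrightarrow> A' c = E $ c" "\<forall>c\<in>-J. A' c \<in> range (\<lambda>i. axis i 1)"
      "det (\<chi> c. A' c) \<noteq> 0" by blast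
  then obtain b where b: "\<And>c. c \<notin> J \<Longrightarrow> A' c = axis (b c) 1"
    unfolding image_iff Bex_def by (metis ComplI)
  have "wedge J b E = det (\<chi> c. A' c)"
    unfolding wedge_def using A'(1) b by (intro arg_cong[where f = det]) (auto simp: vec_eq_iff)
  moreover obtain d where "\<And>b H. wedge J b (E ** H) = d * wedge J b (M ** H)"
  proof (rule wedge_change_basis)
    show "E $ c \<in> ?L" if "c \<in> J" for c unfolding E(2)[symmetric] using that by (intro span_base) auto
  qed (use that in blast)
  from this[of b "mat 1"] have "wedge J b E = d * wedge J b M" by simp
  ultimately have "wedge J b M \<noteq> 0" using A'(3) by auto
  then show ?thesis by blast
qed

section \<open>Unipotent and diagonal matrices\<close>

definition nested :: "('m::finite + 'n::finite) set \<Rightarrow> bool" where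
  "nested J \<longleftrightarrow> J \<subseteq> range Inl \<or> range Inl \<subseteq> J"

lemma Inr_notin_range_Inl [simp]: "Inr x \<notin> range Inl"
  by auto

text \<open>The coordinates that are not contracted by the diagonal matrices considered below.\<close>

definition admissible :: "('m::finite + 'n::finite \<Rightarrow> 'm + 'n) \<Rightarrow> ('m + 'n) set \<Rightarrow> bool" where
  "admissible b J \<longleftrightarrow> (J \<subseteq> range Inl \<and> (\<forall>l. b (Inr l) = Inr l)) \<or>
     (range Inl \<subseteq> J \<and> (\<forall>c\<in>-J. b c \<in> range Inr))"

text \<open>As a map on row vectors, \<open>(p, q) \<mapsto> (Yq - p, q)\<close>.\<close>

definition unip :: "real^'n^'m \<Rightarrow> real^('m + 'n)^('m + 'n)" where
  "unip Y = (\<chi> r i. case i of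
     Inl i' \<Rightarrow> (case r of Inl a \<Rightarrow> if a = i' then - 1 else 0 | Inr l \<Rightarrow> Y $ i' $ l)
   | Inr l' \<Rightarrow> (case r of Inl a \<Rightarrow> 0 | Inr l \<Rightarrow> if l = l' then 1 else 0))"

definition top_part :: "real^('m::finite + 'n::finite) \<Rightarrow> real^'m" where
  "top_part v = (\<chi> i. v $ Inl i)"

definition bot_part :: "real^('m::finite + 'n::finite) \<Rightarrow> real^'n" where
  "bot_part v = (\<chi> l. v $ Inr l)"

lemma sum_UNIV_Plus:
  "(\<Sum>c\<in>(UNIV::('m::finite + 'n::finite) set). f c) = (\<Sum>i\<in>UNIV. f (Inl i)) + (\<Sum>l\<in>UNIV. f (Inr l))"
  by (subst UNIV_sum, subst sum.union_disjoint) (auto simp: sum.reindex)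

lemma vec_unip_Inl: "(v v* unip Y) $ Inl i = (Y *v bot_part v) $ i - v $ Inl i"
proof -
  have "(\<Sum>x\<in>UNIV. v $ Inl x * (if x = i then - 1 else 0)) = (\<Sum>x\<in>UNIV. if x = i then - v $ Inl x else 0)"
    by (intro sum.cong) auto
  then show ?thesis
    by (simp add: vector_matrix_mult_def unip_def sum_UNIV_Plus matrix_vector_mult_def bot_part_def mult.commute[of "Y $ _ $ _"])
qed

lemma vec_unip_Inr: "(v v* unip Y) $ Inr l = v $ Inr l"
proof -
  have "(\<Sum>x\<in>UNIV. v $ Inr x * (if x = l then 1 else 0)) = (\<Sum>x\<in>UNIV. if x = l then v $ Inr x else 0)"
    by (intro sum.cong) auto
  then show ?thesis
    by (simp add: vector_matrix_mult_def unip_def sum_UNIV_Plus)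
qed

lemma linear_vec_mat_mult: "linear (\<lambda>v. v v* (A :: real^'k^'l))"
  by (intro linearI vector_matrix_left_distrib) (simp add: scaleR_vector_matrix_assoc)

text \<open>The block \<open>- 1\<close> in \<open>unip\<close> makes the map an involution, since
  Yq - (Yq - p) = p.\<close>

lemma unip_involutive:
  fixes Y :: "real^'n::finite^'m::finite"
  shows "unip Y ** unip Y = mat 1"
proof -
  have "v v* (unip Y ** unip Y) = v v* mat 1" for v :: "real^('m+'n)"
  proof -
    have "bot_part (v v* unip Y) = bot_part v" by (simp add: bot_part_def vec_unip_Inr)
    then have "((v v* unip Y) v* unip Y) $ c = v $ c" for c
      by (cases c) (auto simp: vec_unip_Inl vec_unip_Inr)
    then show ?thesis by (simp add: vec_eq_iff flip: vector_matrix_mul_assoc)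
  qed
  then have "((mat 1 :: real^('m+'n)^('m+'n)) $ c) v* (unip Y ** unip Y) = (mat 1 $ c) v* mat 1" for c by simp
  then show ?thesis unfolding mat_mult_row[symmetric] by (simp add: vec_eq_iff)
qed

lemma det_unip_nonzero: "det (unip Y) \<noteq> 0"
proof
  assume "det (unip Y) = 0"
  then have "det (unip Y ** unip Y) = 0" by (simp add: det_mul)
  then show False by (simp add: unip_involutive)
qed

text \<open>The coordinate is multiplied by the product of \<open>g\<close> over the columns missed
  by \<open>b\<close> on \<open>- J\<close>. If \<open>J\<close> lies in \<open>range Inl\<close>,
  every contracted column is hit, so only factors at least 1 remain. If \<open>J\<close> contains
  \<open>range Inl\<close>, only contracted columns are hit; their product is at most 1 while the
  full product is at least 1.\<close>

lemma admissible_wedge_diag_ge: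
  fixes N :: "real^('m::finite + 'n::finite)^('m + 'n)"
  assumes b: "admissible b J" and g: "\<And>i. g (Inl i) \<ge> 1" "\<And>l. 0 < g (Inr l)" "\<And>l. g (Inr l) \<le> 1"
    "(\<Prod>i\<in>UNIV. g i) \<ge> 1"
  shows "\<bar>wedge J b N\<bar> \<le> \<bar>wedge J b (N ** diag_mat g)\<bar>"
proof (cases "wedge J b N = 0")
  case False
  have pos: "g c > 0" for c using g(1,2) by (cases c) (auto intro: less_le_trans[OF zero_less_one])
  let ?X = "b ` (- J)"
  have inj: "inj_on b (- J)" by (rule wedge_nonzero_inj[OF False])
  then have pX: "(\<Prod>c\<in>-J. g (b c)) = prod g ?X" by (simp add: prod.reindex)
  have split: "(\<Prod>i\<in>UNIV. g i) = prod g ?X * prod g (- ?X)"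
    by (subst prod.union_disjoint[symmetric]) auto
  have "prod g (- ?X) \<ge> 1"
    using b unfolding admissible_def
  proof (elim disjE conjE)
    assume J: "J \<subseteq> range Inl" and br: "\<forall>l. b (Inr l) = Inr l"
    have "Inr l \<in> ?X" for l
    proof -
      have "Inr l \<in> - J" using J by auto
      then show ?thesis using br by (metis image_eqI)
    qed
    then have "- ?X \<subseteq> range Inl" by (metis ComplD rangeI subsetI sum.exhaust)
    then show ?thesis using g(1) by (intro prod_ge_1) auto
  next
    assume "\<forall>c\<in>-J. b c \<in> range Inr"
    then have "0 \<le> g c \<and> g c \<le> 1" if "c \<in> ?X" for c using g(3) that pos[of c] by force
    then have "prod g ?X \<le> 1" by (intro prod_le_1) auto
    moreover have "prod g (- ?X) > 0" using pos by (intro prod_pos) auto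
    ultimately have "prod g ?X * prod g (- ?X) \<le> 1 * prod g (- ?X)" by (intro mult_right_mono) auto
    then show ?thesis using g(4) split by linarith
  qed
  have "wedge J b (N ** diag_mat g) * prod g ?X = wedge J b N * prod g (- ?X) * prod g ?X"
    using wedge_diag[of J b N g] by (simp add: pX split mult_ac)
  moreover have "prod g ?X \<noteq> 0" using prod_pos[of ?X g] pos by force
  ultimately have "wedge J b (N ** diag_mat g) = wedge J b N * prod g (- ?X)"
    by (meson mult_right_cancel)
  with \<open>prod g (- ?X) \<ge> 1\<close> show ?thesis by (simp add: abs_mult mult_le_cancel_left1)
qed simp

lemma admissible_wedge_nonzero:
  fixes N :: "real^('m::finite + 'n::finite)^('m + 'n)"
  assumes "nested J" "det N \<noteq> 0" "wedge (range Inl) id N \<noteq> 0"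
  obtains b where "admissible b J" "wedge J b N \<noteq> 0"
  using assms(1) unfolding nested_def
proof (elim disjE)
  assume J: "J \<subseteq> range Inl"
  let ?A = "\<lambda>c. if c \<in> range Inl then N $ c else axis (id c) 1"
  have "det (\<chi> c. ?A c) \<noteq> 0" using assms(3) by (simp add: wedge_def)
  from det_exchange[OF finite this in_span_axis, of "range Inl - J"]
  obtain A' where A': "\<forall>c. c \<notin> range Inl - J \<longrightarrow> A' c = ?A c"
    "\<forall>c\<in>range Inl - J. A' c \<in> range (\<lambda>i. axis i 1)" "det (\<chi> c. A' c) \<noteq> 0" by blast
  define b where "b c = (SOME i. A' c = axis i 1)" for c
  have b: "A' c = axis (b c) 1" if "c \<in> range Inl - J" for c
    unfolding b_def using A'(2) that by (intro someI_ex[of "\<lambda>i. A' c = axis i 1"]) auto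
  define b' where "b' c = (if c \<in> range Inl then b c else c)" for c
  have "wedge J b' N = det (\<chi> c. A' c)"
    unfolding wedge_def using A'(1) b J
    by (intro arg_cong[where f = det]) (auto simp: vec_eq_iff b'_def)
  then show ?thesis using that[of b'] J A'(3) by (auto simp: admissible_def b'_def)
next
  assume J: "range Inl \<subseteq> J"
  let ?B = "\<lambda>c. if c \<in> range Inl then N $ c else axis (id c) 1"
  let ?T = "range (\<lambda>l. axis (Inr l) 1) :: (real^('m + 'n)) set"
  have dB: "det (\<chi> c. ?B c) \<noteq> 0" using assms(3) by (simp add: wedge_def)
  have spanB: "span (range ?B) = UNIV"
  proof -
    have "invertible (\<chi> c. ?B c)" using dB invertible_det_nz by blast
    then have "span (rows (\<chi> c. ?B c)) = UNIV"
      unfolding invertible_def using matrix_left_invertible_span_rows by blast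
    moreover have "row c (\<chi> c. ?B c) = ?B c" for c by (simp add: row_def vec_eq_iff)
    then have "rows (\<chi> c. ?B c) = range ?B" by (auto simp only: rows_def)
    ultimately show ?thesis by simp
  qed
  have "range ?B \<subseteq> ?T \<union> (\<lambda>c. N $ c) ` (- (- J))"
  proof
    fix x assume "x \<in> range ?B"
    then obtain c where "x = ?B c" by (rule rangeE)
    then show "x \<in> ?T \<union> (\<lambda>c. N $ c) ` (- (- J))" using J by (cases c) auto
  qed
  then have "span (range ?B) \<subseteq> span (?T \<union> (\<lambda>c. N $ c) ` (- (- J)))" by (rule span_mono)
  then have *: "N $ c \<in> span (?T \<union> (\<lambda>c. N $ c) ` (- (- J)))" for c using spanB by blast
  have "det (\<chi> c. N $ c) \<noteq> 0" using assms(2) by simp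
  from det_exchange[OF finite this *]
  obtain A' where A': "\<forall>c. c \<notin> - J \<longrightarrow> A' c = N $ c"
    "\<forall>c\<in>-J. A' c \<in> ?T" "det (\<chi> c. A' c) \<noteq> 0" by blast
  define b where "b c = (SOME l. A' c = axis (Inr l) 1)" for c
  have b: "A' c = axis (Inr (b c)) 1" if "c \<in> - J" for c
    unfolding b_def using A'(2) that by (intro someI_ex[of "\<lambda>l. A' c = axis (Inr l) 1"]) auto
  have "wedge J (\<lambda>c. Inr (b c)) N = det (\<chi> c. A' c)"
    unfolding wedge_def using A'(1) b
    by (intro arg_cong[where f = det]) (auto simp: vec_eq_iff)
  then show ?thesis using that[of "\<lambda>c. Inr (b c)"] J A'(3) by (auto simp: admissible_def)
qed

lemma det_eq_0_iff_kernel: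
  fixes A :: "real^'k^'k"
  shows "det A = 0 \<longleftrightarrow> (\<exists>x. x \<noteq> 0 \<and> A *v x = 0)"
  using invertible_det_nz[of A] invertible_left_inverse[of A] matrix_left_invertible_ker[of A] by blast

lemma orthogonal_rows_inner:
  assumes "orthogonal_matrix (E :: real^'k^'k)"
  shows "E $ i \<bullet> E $ j = (if i = j then 1 else 0)"
proof -
  have "row c E = E $ c" for c by (simp add: row_def)
  then show ?thesis using assms unfolding orthogonal_matrix_orthonormal_rows
    by (auto simp: orthogonal_def norm_eq_1)
qed

text \<open>
  \<open>(A|B)\<close> consists of the last rows of \<open>E\<close>, so its kernel is the span of the first rows; the exterior
  product degenerates when this kernel contains some \<open>(Yq, q)\<close> with \<open>q \<noteq> 0\<close>.
\<close>

lemma orthogonal_complement_hyperplane: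
  fixes E :: "real^('m::finite + 'n::finite)^('m + 'n)"
  assumes E: "orthogonal_matrix E"
  obtains A :: "real^'m^'n" and B :: "real^'n^'n" where "rank (block_row A B) = CARD('n)"
    "\<And>Y. wedge (range Inl) id (E ** unip Y) = 0 \<Longrightarrow> det (A ** Y + B) = 0"
proof
  define A :: "real^'m^'n" where "A = (\<chi> l. top_part (E $ Inr l))"
  define B :: "real^'n^'n" where "B = (\<chi> l. bot_part (E $ Inr l))"
  have row: "row l (block_row A B) = E $ Inr l" for l
    by (auto simp: row_def block_row_def A_def B_def top_part_def bot_part_def vec_eq_iff split: sum.split)
  have "rank (block_row A B) = dim (rows (block_row A B))" by (simp add: row_rank_def)
  also have "rows (block_row A B) = range (\<lambda>l. E $ Inr l)" by (auto simp: rows_def row)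
  also have "dim \<dots> = card (range (\<lambda>l::'n. E $ Inr l))"
  proof (rule dim_eq_card_independent, rule pairwise_orthogonal_independent)
    show "pairwise orthogonal (range (\<lambda>l. E $ Inr l))"
      by (auto simp: pairwise_def orthogonal_def orthogonal_rows_inner[OF E])
    show "0 \<notin> range (\<lambda>l. E $ Inr l)"
    proof
      assume "0 \<in> range (\<lambda>l. E $ Inr l)"
      then obtain l where "E $ Inr l = 0" by auto
      then show False using orthogonal_rows_inner[OF E, of "Inr l" "Inr l"] by simp
    qed
  qed
  also have "\<dots> = CARD('n)"
  proof (rule card_image, rule injI)
    fix x y :: 'n assume "E $ Inr x = E $ Inr y"
    then have "E $ Inr x \<bullet> E $ Inr y = 1" using orthogonal_rows_inner[OF E, of "Inr x" "Inr x"] by simp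
    then show "x = y" using orthogonal_rows_inner[OF E, of "Inr x" "Inr y"] by (auto split: if_splits)
  qed
  finally show "rank (block_row A B) = CARD('n)" .
  fix Y assume "wedge (range Inl) id (E ** unip Y) = 0"
  define X where "X = (\<chi> c. if c \<in> range Inl then (E ** unip Y) $ c else axis (id c) 1)"
  have "det (transpose X) = 0"
    using \<open>wedge (range Inl) id (E ** unip Y) = 0\<close> by (simp add: X_def wedge_def)
  then obtain x where x: "x \<noteq> 0" "transpose X *v x = 0"
    using det_eq_0_iff_kernel by blast
  then have xX: "(\<Sum>c\<in>UNIV. x $ c *\<^sub>R X $ c) = 0"
    by (simp add: vec_eq_iff matrix_vector_mult_def transpose_def sum_component mult.commute)
  \<comment> \<open>\<open>x\<close> is a linear relation between the \<open>Inl\<close> rows of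
    \<open>E ** unip Y\<close> and the unit vectors of type \<open>Inr\<close>. Its part
    \<open>w\<close> in the first rows of \<open>E\<close> is therefore mapped by
    \<open>unip Y\<close> to a vector with zero top part, so \<open>w\<close> has the form
    \<open>(Yq, q)\<close>.\<close>
  define w where "w = (\<Sum>i\<in>UNIV. x $ Inl i *\<^sub>R E $ Inl i)"
  define q where "q = bot_part w"
  have wu: "w v* unip Y = (\<Sum>i\<in>UNIV. x $ Inl i *\<^sub>R (E ** unip Y) $ Inl i)"
    by (simp add: w_def mat_mult_row linear_sum[OF linear_vec_mat_mult] linear_scale[OF linear_vec_mat_mult])
  have "w v* unip Y + (\<Sum>l\<in>UNIV. x $ Inr l *\<^sub>R axis (Inr l) 1) = 0"
    using xX unfolding sum_UNIV_Plus wu by (simp add: X_def)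
  then have comp: "(w v* unip Y) $ c + (\<Sum>l\<in>UNIV. x $ Inr l * axis (Inr l) 1 $ c) = 0" for c
    by (simp add: vec_eq_iff sum_component)
  have "(w v* unip Y) $ Inl i = 0" for i using comp[of "Inl i"] by (simp add: axis_def)
  then have Yq: "Y *v q = top_part w" by (simp add: vec_unip_Inl q_def vec_eq_iff top_part_def)
  have "q $ l + x $ Inr l = 0" for l
  proof -
    have "(\<Sum>l'\<in>UNIV. x $ Inr l' * axis (Inr l' :: 'm + 'n) 1 $ Inr l) = (\<Sum>l'\<in>UNIV. if l' = l then x $ Inr l' else 0)"
      by (intro sum.cong) (auto simp: axis_def)
    then show ?thesis using comp[of "Inr l"] by (simp add: vec_unip_Inr q_def bot_part_def)
  qed
  have inner: "E $ c \<bullet> w = (case c of Inl i \<Rightarrow> x $ Inl i | Inr l \<Rightarrow> 0)" for c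
  proof -
    have "E $ c \<bullet> w = (\<Sum>i\<in>UNIV. if c = Inl i then x $ Inl i else 0)"
      unfolding w_def inner_sum_right
      by (intro sum.cong) (auto simp: orthogonal_rows_inner[OF E])
    then show ?thesis by (cases c) auto
  qed
  \<comment> \<open>If \<open>q = 0\<close>, the top part \<open>Y *v q\<close> of \<open>w\<close>
    vanishes as well; then orthonormality kills the coefficients \<open>x $ Inl i\<close> and the
    relation kills the \<open>x $ Inr l\<close>.\<close>
  have "q \<noteq> 0"
  proof
    assume "q = 0"
    then have "top_part w = 0" "bot_part w = 0" using Yq by (simp_all add: q_def)
    then have "w $ c = 0" for c
      by (cases c) (simp_all add: vec_eq_iff top_part_def bot_part_def)
    then have "w = 0" by (simp add: vec_eq_iff)
    then have "x $ Inl i = 0" for i using inner[of "Inl i"] by simp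
    moreover have "x $ Inr l = 0" for l using \<open>q $ l + x $ Inr l = 0\<close> \<open>q = 0\<close> by simp
    ultimately have "x $ c = 0" for c by (cases c) auto
    then show False using x(1) by (simp add: vec_eq_iff)
  qed
  moreover have "(A ** Y + B) *v q = 0"
  proof -
    have "(A *v top_part w + B *v bot_part w) $ l = E $ Inr l \<bullet> w" for l
      by (simp add: matrix_vector_mult_def A_def B_def top_part_def bot_part_def inner_vec_def sum_UNIV_Plus)
    then have "A *v top_part w + B *v bot_part w = 0" by (simp add: vec_eq_iff inner)
    then show ?thesis
      by (simp add: matrix_vector_mult_add_rdistrib Yq flip: matrix_vector_mul_assoc q_def)
  qed
  ultimately show "det (A ** Y + B) = 0" using det_eq_0_iff_kernel by blast
qed

section \<open>A lower bound uniform over orthonormal frames\<close>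

lemma compact_orthogonal_matrices: "compact {E :: real^'k^'k. orthogonal_matrix E}"
proof -
  have "norm E \<le> real CARD('k)" if "orthogonal_matrix E" for E :: "real^'k^'k"
  proof -
    have "norm E \<le> (\<Sum>i\<in>UNIV. norm (E $ i))" unfolding norm_vec_def by (rule L2_set_le_sum) auto
    also have "\<dots> = real CARD('k)"
      using orthogonal_rows_inner[OF that] by (simp add: norm_eq_sqrt_inner)
    finally show ?thesis .
  qed
  then have "bounded {E :: real^'k^'k. orthogonal_matrix E}" by (auto simp: bounded_iff)
  moreover have "closed {E :: real^'k^'k. orthogonal_matrix E}"
    unfolding orthogonal_matrix matrix_matrix_mult_def transpose_def
    by (intro closed_Collect_eq continuous_intros)
  ultimately show ?thesis by (simp add: compact_eq_bounded_closed)
qed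

lemma tendsto_wedge:
  assumes "(M \<longlongrightarrow> M0) F"
  shows "((\<lambda>n. wedge J b (M n ** H)) \<longlongrightarrow> wedge J b (M0 ** H)) F"
proof -
  have "((\<lambda>n. (\<chi> c. if c \<in> J then (M n ** H) $ c else axis (b c) 1) $ i $ j :: real) \<longlongrightarrow>
     (\<chi> c. if c \<in> J then (M0 ** H) $ c else axis (b c) 1) $ i $ j) F" for i j
    using assms by (auto simp: matrix_matrix_mult_def intro!: tendsto_intros)
  then show ?thesis unfolding wedge_def det_def by (intro tendsto_sum tendsto_mult_left tendsto_prod)
qed

text \<open>A sequence of counterexamples \<open>E n\<close> with bounds \<open>1 / Suc n\<close>
  subconverges to an orthogonal \<open>E0\<close>. A point \<open>Y\<close> of \<open>S\<close> off
  the hyperplane attached to \<open>E0\<close>, and an admissible \<open>b\<close>, are chosen for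
  \<open>E0\<close> and then kept fixed; continuity of this one coordinate in \<open>E\<close> gives
  the contradiction.\<close>

lemma wedge_uniform_lower_bound:
  fixes S :: "(real^'n^'m) set"
  assumes "nested (J :: ('m::finite + 'n::finite) set)" and H: "\<And>H. H \<in> H_collection \<Longrightarrow> \<not> S \<subseteq> H"
  shows "\<exists>\<delta>>0. \<forall>E. orthogonal_matrix E \<longrightarrow> (\<exists>Y\<in>S. \<exists>b. admissible b J \<and> \<delta> \<le> \<bar>wedge J b (E ** unip Y)\<bar>)"
proof (rule ccontr)
  assume "\<not> ?thesis"
  then have "\<forall>n. \<exists>E. orthogonal_matrix E \<and>
      (\<forall>Y\<in>S. \<forall>b. admissible b J \<longrightarrow> \<bar>wedge J b (E ** unip Y)\<bar> < 1 / real (Suc n))"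
    by (metis not_le of_nat_0_less_iff zero_less_Suc zero_less_divide_1_iff)
  then obtain E where E: "\<And>n. orthogonal_matrix (E n)"
    "\<And>n Y b. Y \<in> S \<Longrightarrow> admissible b J \<Longrightarrow> \<bar>wedge J b (E n ** unip Y)\<bar> < 1 / real (Suc n)"
    by metis
  obtain E0 r where E0: "orthogonal_matrix E0" "strict_mono r" "(E \<circ> r) \<longlonglongrightarrow> E0"
    using compact_orthogonal_matrices[unfolded compact_def, rule_format, of E] E(1) by blast
  obtain A B where AB: "rank (block_row A B) = CARD('n)"
    "\<And>Y. wedge (range Inl) id (E0 ** unip Y) = 0 \<Longrightarrow> det (A ** Y + B) = 0"
    using orthogonal_complement_hyperplane[OF E0(1)] by blast
  have "H_set A B \<in> H_collection" using AB(1) by (auto simp: H_collection_def)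
  then obtain Y where Y: "Y \<in> S" "Y \<notin> H_set A B" using H by blast
  then have "wedge (range Inl) id (E0 ** unip Y) \<noteq> 0" using AB(2) by (auto simp: H_set_def)
  moreover have "det (E0 ** unip Y) \<noteq> 0"
    using orthogonal_matrix_det_nonzero[OF E0(1)] det_unip_nonzero by (simp add: det_mul)
  ultimately obtain b where b: "admissible b J" "wedge J b (E0 ** unip Y) \<noteq> 0"
    using admissible_wedge_nonzero[OF assms(1)] by blast
  have "(\<lambda>n. \<bar>wedge J b ((E \<circ> r) n ** unip Y)\<bar>) \<longlonglongrightarrow> \<bar>wedge J b (E0 ** unip Y)\<bar>"
    by (intro tendsto_rabs tendsto_wedge E0(3))
  moreover have "(\<lambda>n. 1 / real (Suc n)) \<longlonglongrightarrow> 0"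
    using LIMSEQ_inverse_real_of_nat by (simp add: inverse_eq_divide)
  then have "(\<lambda>n. 1 / real (Suc (r n))) \<longlonglongrightarrow> 0"
    using LIMSEQ_subseq_LIMSEQ[OF _ E0(2)] by (fastforce simp: o_def)
  moreover have "\<forall>\<^sub>F n in sequentially. \<bar>wedge J b ((E \<circ> r) n ** unip Y)\<bar> \<le> 1 / real (Suc (r n))"
    unfolding o_def by (intro always_eventually allI less_imp_le E(2)[OF Y(1) b(1)])
  ultimately have "\<bar>wedge J b (E0 ** unip Y)\<bar> \<le> 0"
    using tendsto_le[OF sequentially_bot] by blast
  with b(2) show False by simp
qed

section \<open>Expansion into minors\<close>

text \<open>Composed with \<open>F\<close>, these are the functions to which the goodness hypothesis
  applies with one common pair of constants.\<close>

definition minor_span :: "(real^'n::{finite,linorder}^'m::{finite,linorder} \<Rightarrow> real) \<Rightarrow> bool" where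
  "minor_span f \<longleftrightarrow> (\<exists>c0 c. \<forall>Y. f Y = c0 + (\<Sum>p\<in>minor_indices. c p * minor (fst p) (snd p) Y))"

lemma minor_span_const: "minor_span (\<lambda>_. r)"
  unfolding minor_span_def by (intro exI[of _ r] exI[of _ "\<lambda>_. 0"]) simp

lemma minor_span_add:
  assumes "minor_span f" "minor_span g"
  shows "minor_span (\<lambda>Y. f Y + g Y)"
proof -
  from assms(1) obtain c0 c where "\<And>Y. f Y = c0 + (\<Sum>p\<in>minor_indices. c p * minor (fst p) (snd p) Y)"
    unfolding minor_span_def by blast
  moreover from assms(2) obtain d0 d where "\<And>Y. g Y = d0 + (\<Sum>p\<in>minor_indices. d p * minor (fst p) (snd p) Y)"
    unfolding minor_span_def by blast
  ultimately have "\<forall>Y. f Y + g Y = (c0 + d0) + (\<Sum>p\<in>minor_indices. (c p + d p) * minor (fst p) (snd p) Y)"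
    by (simp add: distrib_right sum.distrib)
  then show ?thesis unfolding minor_span_def by (intro exI)
qed

lemma minor_span_cmult:
  assumes "minor_span f"
  shows "minor_span (\<lambda>Y. r * f Y)"
proof -
  obtain c0 c where "\<And>Y. f Y = c0 + (\<Sum>p\<in>minor_indices. c p * minor (fst p) (snd p) Y)"
    using assms unfolding minor_span_def by blast
  then have "\<forall>Y. r * f Y = r * c0 + (\<Sum>p\<in>minor_indices. (r * c p) * minor (fst p) (snd p) Y)"
    by (simp add: distrib_left sum_distrib_left mult.assoc)
  then show ?thesis unfolding minor_span_def by (intro exI)
qed

lemma minor_span_sum:
  "finite A \<Longrightarrow> (\<And>x. x \<in> A \<Longrightarrow> minor_span (f x)) \<Longrightarrow> minor_span (\<lambda>Y. \<Sum>x\<in>A. f x Y)"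
  by (induction A rule: finite_induct) (auto intro: minor_span_const minor_span_add)

text \<open>The empty minor is the constant 1; \<open>minor_indices\<close> excludes it and the
  constant term supplies it.\<close>

lemma minor_span_minor:
  fixes I :: "'m::{finite,linorder} set" and K :: "'n::{finite,linorder} set"
  assumes "card I = card K"
  shows "minor_span (minor I K)"
proof (cases "I = {}")
  case True
  have "{p :: nat \<Rightarrow> nat. \<forall>x. p x = x} = {id}" by (auto simp: fun_eq_iff)
  with True have "minor I K = (\<lambda>_. 1)" by (simp add: minor_def fun_eq_iff)
  then show ?thesis using minor_span_const by metis
next
  case False
  then have mem: "(I, K) \<in> minor_indices" using assms by (simp add: minor_indices_def)
  have "minor I K Y = 0 + (\<Sum>p\<in>minor_indices. (if p = (I, K) then 1 else 0) * minor (fst p) (snd p) Y)" for Y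
  proof -
    have "(\<Sum>p\<in>minor_indices. (if p = (I, K) then 1 else 0) * minor (fst p) (snd p) Y)
      = (\<Sum>p\<in>minor_indices. if p = (I, K) then minor I K Y else 0)"
      by (intro sum.cong) auto
    then show ?thesis using mem by simp
  qed
  then show ?thesis unfolding minor_span_def by (intro exI allI)
qed

lemma det_rows_sum_PiE:
  fixes a :: "'k::finite \<Rightarrow> 's \<Rightarrow> real^'k"
  assumes "\<And>r. finite (S r)"
  shows "det (\<chi> r. \<Sum>s\<in>S r. a r s) = (\<Sum>f\<in>PiE UNIV S. det (\<chi> r. a r (f r)))"
proof -
  have "det (\<chi> r. \<Sum>s\<in>S r. a r s)
      = (\<Sum>p | p permutes UNIV. of_int (sign p) * (\<Prod>r\<in>UNIV. \<Sum>s\<in>S r. a r s $ p r))"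
    by (simp add: det_def sum_component)
  also have "\<dots> = (\<Sum>p | p permutes UNIV. \<Sum>f\<in>PiE UNIV S. of_int (sign p) * (\<Prod>r\<in>UNIV. a r (f r) $ p r))"
    using assms by (subst prod_sum_PiE) (auto simp: sum_distrib_left)
  also have "\<dots> = (\<Sum>f\<in>PiE UNIV S. det (\<chi> r. a r (f r)))"
    by (subst sum.swap) (simp add: det_def)
  finally show ?thesis .
qed

text \<open>If \<open>I\<close> and \<open>J\<close> differ in size, every partial map
  \<open>\<phi>\<close> in the sum repeats a value, and two rows in \<open>d \<phi>\<close> agree.
  Otherwise the \<open>\<phi>\<close> are the bijections from \<open>I\<close> to \<open>J\<close>.
  Through the increasing enumerations they correspond to permutations \<open>p\<close> of
  \<open>{..<k}\<close>; permuting rows gives \<open>d \<phi>\<close> the sign of \<open>p\<close>,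
  and the sum becomes a constant times the Leibniz formula of one minor.\<close>

lemma minor_span_bijections:
  fixes X :: "'n::{finite,linorder} \<Rightarrow> real^('m::{finite,linorder} + 'n)"
    and Z :: "'m \<Rightarrow> real^('m + 'n)" and K :: "'n \<Rightarrow> real^('m + 'n)"
  defines "d \<equiv> \<lambda>\<phi>. det (\<chi> r. case r of Inl i \<Rightarrow> (case \<phi> i of None \<Rightarrow> Z i | Some l \<Rightarrow> X l) | Inr l \<Rightarrow> K l)"
  shows "minor_span (\<lambda>Y. \<Sum>\<phi> | dom \<phi> = I \<and> ran \<phi> = J. (\<Prod>i\<in>I. Y $ i $ the (\<phi> i)) * d \<phi>)"
proof (cases "card I = card J")
  case False
  have "d \<phi> = 0" if "dom \<phi> = I" "ran \<phi> = J" for \<phi>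
  proof -
    have "J = (\<lambda>i. the (\<phi> i)) ` I" using that by (force simp: ran_def dom_def image_iff)
    then have "\<not> inj_on (\<lambda>i. the (\<phi> i)) I" using False card_image by metis
    then obtain i j where ij: "i \<in> I" "j \<in> I" "i \<noteq> j" "the (\<phi> i) = the (\<phi> j)" by (auto simp: inj_on_def)
    then have "\<phi> i = \<phi> j" "\<phi> j \<noteq> None" using that(1) by (auto simp: dom_def)
    then show ?thesis unfolding d_def using ij(3) by (intro det_eq_rows[of "Inl i" "Inl j"]) auto
  qed
  then have "(\<lambda>Y. \<Sum>\<phi> | dom \<phi> = I \<and> ran \<phi> = J. (\<Prod>i\<in>I. Y $ i $ the (\<phi> i)) * d \<phi>) = (\<lambda>_. 0)"
    by (auto intro!: sum.neutral)
  then show ?thesis using minor_span_const by metis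
next
  case True
  define k where "k = card I"
  define iof where "iof = (\<lambda>a. sorted_list_of_set I ! a)"
  define ks where "ks = (\<lambda>a. sorted_list_of_set J ! a)"
  have bi: "bij_betw iof {..<k} I" unfolding iof_def k_def by (intro bij_betw_nth) auto
  have bk: "bij_betw ks {..<k} J" unfolding ks_def k_def True by (intro bij_betw_nth) auto
  let ?ii = "inv_into {..<k} iof"
  define \<Phi> where "\<Phi> p = (\<lambda>i. if i \<in> I then Some (ks (p (?ii i))) else None)" for p
  have ii: "?ii (iof a) = a" if "a < k" for a using bi that by (simp add: bij_betw_def)
  have isI: "iof a \<in> I" if "a < k" for a using bi that by (auto simp: bij_betw_def)
  have \<Phi>_is: "\<Phi> p (iof a) = Some (ks (p a))" if "a < k" for p a by (simp add: \<Phi>_def isI ii that)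
  have bij: "bij_betw \<Phi> {p. p permutes {..<k}} {\<phi>. dom \<phi> = I \<and> ran \<phi> = J}"
    unfolding bij_betw_def
  proof (intro conjI inj_onI set_eqI iffI)
    fix p q assume pq: "p \<in> {p. p permutes {..<k}}" "q \<in> {p. p permutes {..<k}}" "\<Phi> p = \<Phi> q"
    show "p = q"
    proof
      fix a show "p a = q a"
      proof (cases "a < k")
        case True
        then have "ks (p a) = ks (q a)" using \<Phi>_is[of a p] \<Phi>_is[of a q] pq(3) by simp
        moreover have "p a \<in> {..<k}" "q a \<in> {..<k}" using pq True permutes_in_image by fastforce+
        ultimately show ?thesis using bk by (auto simp: bij_betw_def inj_on_def)
      next
        case False
        then show ?thesis using pq by (auto simp: permutes_def)
      qed
    qed
  next
    fix \<phi> assume "\<phi> \<in> \<Phi> ` {p. p permutes {..<k}}"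
    then obtain p where p: "p permutes {..<k}" "\<phi> = \<Phi> p" by auto
    have "dom \<phi> = I" by (auto simp: p(2) \<Phi>_def dom_def)
    moreover have "ran \<phi> = (\<lambda>i. ks (p (?ii i))) ` I" by (auto simp: p(2) \<Phi>_def ran_def)
    moreover have "\<dots> = (\<lambda>a. ks (p a)) ` {..<k}"
      using bi by (auto simp: bij_betw_def ii image_image)
    moreover have "\<dots> = J" using bk permutes_image[OF p(1)] by (metis bij_betw_def image_image)
    ultimately show "\<phi> \<in> {\<phi>. dom \<phi> = I \<and> ran \<phi> = J}" by simp
  next
    fix \<phi> assume "\<phi> \<in> {\<phi>. dom \<phi> = I \<and> ran \<phi> = J}"
    then have \<phi>: "dom \<phi> = I" "ran \<phi> = J" by auto
    have "J = (\<lambda>i. the (\<phi> i)) ` I" using \<phi> by (force simp: ran_def dom_def image_iff)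
    then have b\<phi>: "bij_betw (\<lambda>i. the (\<phi> i)) I J"
      using True by (simp add: bij_betw_def eq_card_imp_inj_on)
    define p where "p a = (if a \<in> {..<k} then (inv_into {..<k} ks \<circ> (\<lambda>i. the (\<phi> i)) \<circ> iof) a else a)" for a
    have "bij_betw (inv_into {..<k} ks \<circ> (\<lambda>i. the (\<phi> i)) \<circ> iof) {..<k} {..<k}"
      by (intro bij_betw_trans[OF bi] bij_betw_trans[OF b\<phi>] bij_betw_inv_into[OF bk])
    then have "bij_betw p {..<k} {..<k}" by (rule bij_betw_cong[THEN iffD1, rotated]) (simp add: p_def)
    then have p: "p permutes {..<k}" by (rule bij_imp_permutes) (simp add: p_def)
    have "\<Phi> p i = \<phi> i" for i
    proof (cases "i \<in> I")
      case True
      then obtain a where a: "a < k" "i = iof a" using bi by (auto simp: bij_betw_def)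
      have "the (\<phi> i) \<in> ks ` {..<k}" using True bk b\<phi> by (auto simp: bij_betw_def)
      then have "ks (p a) = the (\<phi> i)" using a by (simp add: p_def f_inv_into_f)
      moreover have "\<phi> i \<noteq> None" using True \<phi>(1) by auto
      ultimately show ?thesis using a \<Phi>_is by auto
    next
      case False
      then show ?thesis using \<phi>(1) by (auto simp: \<Phi>_def)
    qed
    then have "\<phi> = \<Phi> p" by auto
    with p show "\<phi> \<in> \<Phi> ` {p. p permutes {..<k}}" by blast
  qed
  have dp: "d (\<Phi> p) = of_int (sign p) * d (\<Phi> id)" if p: "p permutes {..<k}" for p
  proof -
    let ?e = "\<lambda>a. Inl (iof a) :: 'm + 'n"
    let ?q = "map_permutation {..<k} ?e p"
    let ?M = "\<lambda>\<phi>. (\<chi> r. case r of Inl i \<Rightarrow> (case \<phi> i of None \<Rightarrow> Z i | Some l \<Rightarrow> X l) | Inr l \<Rightarrow> K l) :: real^('m+'n)^('m+'n)"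
    have inj: "inj_on ?e {..<k}" using bi by (auto simp: bij_betw_def inj_on_def)
    have be: "bij_betw ?e {..<k} (?e ` {..<k})" using inj by (rule inj_on_imp_bij_betw)
    have q: "?q permutes ?e ` {..<k}" by (rule map_permutation_permutes[OF be p])
    have "?M (\<Phi> p) $ r = ?M (\<Phi> id) $ (?q r)" for r
    proof (cases "r \<in> ?e ` {..<k}")
      case True
      then obtain a where a: "a < k" "r = ?e a" by auto
      then have "?q r = ?e (p a)" using map_permutation_apply[OF inj, of a p] by simp
      moreover have "p a < k" using a(1) permutes_in_image[OF p, of a] by simp
      ultimately show ?thesis using a by (simp add: \<Phi>_is)
    next
      case False
      have "?q r = r" using q False by (simp add: permutes_def)
      moreover have "i \<notin> I" if "r = Inl i" for i using that False bi by (auto simp: bij_betw_def)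
      ultimately show ?thesis by (cases r) (auto simp: \<Phi>_def)
    qed
    then have "?M (\<Phi> p) = (\<chi> r. ?M (\<Phi> id) $ (?q r))" by (simp add: vec_eq_iff)
    then have "d (\<Phi> p) = of_int (sign ?q) * d (\<Phi> id)"
      unfolding d_def using det_permute_rows[OF permutes_subset[OF q subset_UNIV], of "?M (\<Phi> id)"] by simp
    then show ?thesis using sign_map_permutation[OF inj p] by simp
  qed
  have "(\<Sum>\<phi> | dom \<phi> = I \<and> ran \<phi> = J. (\<Prod>i\<in>I. Y $ i $ the (\<phi> i)) * d \<phi>) = d (\<Phi> id) * minor I J Y" for Y
  proof -
    have "(\<Sum>\<phi> | dom \<phi> = I \<and> ran \<phi> = J. (\<Prod>i\<in>I. Y $ i $ the (\<phi> i)) * d \<phi>)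
       = (\<Sum>p | p permutes {..<k}. (\<Prod>i\<in>I. Y $ i $ the (\<Phi> p i)) * d (\<Phi> p))"
      by (rule sum.reindex_bij_betw[OF bij, symmetric])
    also have "\<dots> = (\<Sum>p | p permutes {..<k}. (\<Prod>a<k. Y $ iof a $ ks (p a)) * (of_int (sign p) * d (\<Phi> id)))"
    proof (rule sum.cong)
      fix p assume p: "p \<in> {p. p permutes {..<k}}"
      have "(\<Prod>i\<in>I. Y $ i $ the (\<Phi> p i)) = (\<Prod>a<k. Y $ iof a $ the (\<Phi> p (iof a)))"
        by (rule prod.reindex_bij_betw[OF bi, symmetric])
      also have "\<dots> = (\<Prod>a<k. Y $ iof a $ ks (p a))" by (intro prod.cong) (auto simp: \<Phi>_is)
      finally have eq: "(\<Prod>i\<in>I. Y $ i $ the (\<Phi> p i)) = (\<Prod>a<k. Y $ iof a $ ks (p a))" .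
      have dd: "d (\<Phi> p) = of_int (sign p) * d (\<Phi> id)" using dp p by blast
      show "(\<Prod>i\<in>I. Y $ i $ the (\<Phi> p i)) * d (\<Phi> p)
          = (\<Prod>a<k. Y $ iof a $ ks (p a)) * (of_int (sign p) * d (\<Phi> id))"
        unfolding eq dd ..
    qed simp
    also have "\<dots> = d (\<Phi> id) * minor I J Y"
      by (simp add: minor_def iof_def ks_def k_def sum_distrib_left mult_ac)
    finally show ?thesis .
  qed
  then show ?thesis using minor_span_cmult[OF minor_span_minor[OF True]] by simp
qed

text \<open>Multilinearity in the rows \<open>Inl i\<close>: a partial map \<open>\<phi>\<close>
  records which summand each of them contributes, \<open>None\<close> for \<open>Z i\<close> and
  \<open>Some l\<close> for \<open>Y $ i $ l *s X l\<close>. The terms are then grouped by the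
  domain and range of \<open>\<phi>\<close>, each group giving one minor.\<close>

lemma minor_span_det:
  fixes X :: "'n::{finite,linorder} \<Rightarrow> real^('m::{finite,linorder} + 'n)"
    and Z :: "'m \<Rightarrow> real^('m + 'n)" and K :: "'n \<Rightarrow> real^('m + 'n)"
  shows "minor_span (\<lambda>Y. det (\<chi> r. case r of Inl i \<Rightarrow> Z i + (\<Sum>l\<in>UNIV. Y $ i $ l *s X l) | Inr l \<Rightarrow> K l))"
proof -
  define d where
    "d = (\<lambda>\<phi>. det (\<chi> r. case r of Inl i \<Rightarrow> (case \<phi> i of None \<Rightarrow> Z i | Some l \<Rightarrow> X l) | Inr l \<Rightarrow> K l))"
  define S :: "'m + 'n \<Rightarrow> 'n option set" where "S r = (case r of Inl i \<Rightarrow> UNIV | Inr l \<Rightarrow> {None})" for r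
  define a where "a Y r s = (case r of Inl i \<Rightarrow> (case s of None \<Rightarrow> Z i | Some l \<Rightarrow> Y $ i $ l *s X l) | Inr l \<Rightarrow> K l)"
    for Y r s
  have fin: "finite (S r)" for r by (auto simp: S_def split: sum.split)
  have bij: "bij_betw (\<lambda>\<phi> r. case r of Inl i \<Rightarrow> \<phi> i | Inr l \<Rightarrow> None) UNIV (PiE UNIV S)"
  proof (rule bij_betwI[where g = "\<lambda>f i. f (Inl i)"])
    fix f assume "f \<in> PiE UNIV S"
    then have "f (Inr l) \<in> S (Inr l)" for l by (auto dest: PiE_mem)
    then have "f (Inr l) = None" for l by (simp add: S_def)
    then show "(\<lambda>r. case r of Inl i \<Rightarrow> f (Inl i) | Inr l \<Rightarrow> None) = f"
      by (auto split: sum.split)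
  qed (auto simp: S_def PiE_UNIV_domain split: sum.splits)
  have "det (\<chi> r. case r of Inl i \<Rightarrow> Z i + (\<Sum>l\<in>UNIV. Y $ i $ l *s X l) | Inr l \<Rightarrow> K l)
     = (\<Sum>g\<in>UNIV. \<Sum>\<phi> | dom \<phi> = fst g \<and> ran \<phi> = snd g. (\<Prod>i\<in>fst g. Y $ i $ the (\<phi> i)) * d \<phi>)" for Y
  proof -
    have "(case r of Inl i \<Rightarrow> Z i + (\<Sum>l\<in>UNIV. Y $ i $ l *s X l) | Inr l \<Rightarrow> K l) = (\<Sum>s\<in>S r. a Y r s)" for r
    proof (cases r)
      case (Inl i)
      have "(\<Sum>s\<in>(UNIV :: 'n option set). a Y r s) = a Y r None + (\<Sum>s\<in>range Some. a Y r s)"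
        by (simp add: UNIV_option_conv)
      then show ?thesis using Inl by (simp add: S_def a_def sum.reindex)
    qed (simp add: S_def a_def)
    then have "det (\<chi> r. case r of Inl i \<Rightarrow> Z i + (\<Sum>l\<in>UNIV. Y $ i $ l *s X l) | Inr l \<Rightarrow> K l)
       = (\<Sum>f\<in>PiE UNIV S. det (\<chi> r. a Y r (f r)))"
      using det_rows_sum_PiE[of S "a Y", OF fin] by simp
    also have "\<dots> = (\<Sum>\<phi>\<in>UNIV. det (\<chi> r. a Y r (case r of Inl i \<Rightarrow> \<phi> i | Inr l \<Rightarrow> None)))"
      by (rule sum.reindex_bij_betw[OF bij, symmetric])
    also have "\<dots> = (\<Sum>\<phi>\<in>UNIV. (\<Prod>i\<in>dom \<phi>. Y $ i $ the (\<phi> i)) * d \<phi>)"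
    proof (rule sum.cong)
      fix \<phi> :: "'m \<Rightarrow> 'n option"
      let ?s = "\<lambda>r :: 'm + 'n. case r of Inl i \<Rightarrow> (if i \<in> dom \<phi> then Y $ i $ the (\<phi> i) else 1) | Inr l \<Rightarrow> 1"
      have "(\<chi> r. a Y r (case r of Inl i \<Rightarrow> \<phi> i | Inr l \<Rightarrow> None))
         = (\<chi> r. ?s r *s (case r of Inl i \<Rightarrow> (case \<phi> i of None \<Rightarrow> Z i | Some l \<Rightarrow> X l) | Inr l \<Rightarrow> K l))"
        by (auto simp: vec_eq_iff a_def split: sum.split option.split)
      moreover have "prod ?s UNIV = (\<Prod>i\<in>dom \<phi>. Y $ i $ the (\<phi> i))"
      proof -
        have "prod ?s UNIV = prod ?s (range Inl) * prod ?s (range Inr)"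
          by (subst UNIV_sum, subst prod.union_disjoint) auto
        then show ?thesis by (simp add: prod.reindex prod.If_cases)
      qed
      ultimately show "det (\<chi> r. a Y r (case r of Inl i \<Rightarrow> \<phi> i | Inr l \<Rightarrow> None))
          = (\<Prod>i\<in>dom \<phi>. Y $ i $ the (\<phi> i)) * d \<phi>"
        by (simp add: det_rows_mul d_def)
    qed simp
    also have "\<dots> = (\<Sum>g\<in>UNIV. \<Sum>\<phi> | \<phi> \<in> UNIV \<and> (dom \<phi>, ran \<phi>) = g. (\<Prod>i\<in>dom \<phi>. Y $ i $ the (\<phi> i)) * d \<phi>)"
      by (rule sum.group[symmetric]) auto
    also have "\<dots> = (\<Sum>g\<in>UNIV. \<Sum>\<phi> | dom \<phi> = fst g \<and> ran \<phi> = snd g. (\<Prod>i\<in>fst g. Y $ i $ the (\<phi> i)) * d \<phi>)"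
      by (intro sum.cong) auto
    finally show ?thesis .
  qed
  moreover have "minor_span (\<lambda>Y. \<Sum>g\<in>UNIV. \<Sum>\<phi> | dom \<phi> = fst g \<and> ran \<phi> = snd g. (\<Prod>i\<in>fst g. Y $ i $ the (\<phi> i)) * d \<phi>)"
    unfolding d_def by (intro minor_span_sum minor_span_bijections) simp
  ultimately show ?thesis by simp
qed

text \<open>The matrix is transposed because \<open>Y\<close> acts on columns: column
  \<open>Inl i\<close> of \<open>V ** unip Y\<close> is minus that of \<open>V\<close> plus a
  combination of the columns \<open>Inr l\<close> with coefficients \<open>Y $ i $ l\<close>. The
  vectors \<open>X l\<close> vanish outside \<open>J\<close> since the padding rows do not involve
  \<open>Y\<close>.\<close>

lemma minor_span_wedge_unip:
  fixes V :: "real^('m::{finite,linorder} + 'n::{finite,linorder})^('m + 'n)"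
  shows "minor_span (\<lambda>Y. wedge J b (V ** unip Y))"
proof -
  define X where "X l = (\<chi> c. if c \<in> J then V $ c $ Inr l else 0)" for l
  define Z where "Z i = (\<chi> c. if c \<in> J then - V $ c $ Inl i else axis (b c) 1 $ Inl i)" for i
  define K where "K l = (\<chi> c. if c \<in> J then V $ c $ Inr l else axis (b c) 1 $ Inr l)" for l
  have "wedge J b (V ** unip Y) =
    det (\<chi> r. case r of Inl i \<Rightarrow> Z i + (\<Sum>l\<in>UNIV. Y $ i $ l *s X l) | Inr l \<Rightarrow> K l)" for Y
  proof -
    have eq: "transpose (\<chi> c. if c \<in> J then (V ** unip Y) $ c else axis (b c) 1)
      = (\<chi> r. case r of Inl i \<Rightarrow> Z i + (\<Sum>l\<in>UNIV. Y $ i $ l *s X l) | Inr l \<Rightarrow> K l)"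
      by (auto simp: vec_eq_iff transpose_def mat_mult_row vec_unip_Inl vec_unip_Inr X_def Z_def K_def
          matrix_vector_mult_def bot_part_def sum_component split: sum.split)
    show ?thesis unfolding wedge_def eq[symmetric] det_transpose ..
  qed
  then show ?thesis using minor_span_det[of Z X K] by simp
qed

lemma minor_span_wedge:
  fixes V :: "real^('m::{finite,linorder} + 'n::{finite,linorder})^('m + 'n)"
  assumes "\<And>c. g c \<noteq> 0"
  shows "minor_span (\<lambda>Y. wedge J b (V ** (unip Y ** diag_mat g)))"
proof -
  have "(\<Prod>c\<in>-J. g (b c)) \<noteq> 0" using assms by simp
  then have "wedge J b (V ** (unip Y ** diag_mat g))
     = ((\<Prod>i\<in>UNIV. g i) / (\<Prod>c\<in>-J. g (b c))) * wedge J b (V ** unip Y)" for Y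
    using wedge_diag[of J b "V ** unip Y" g] by (simp add: matrix_mul_assoc field_simps)
  then show ?thesis by (simp only: minor_span_cmult minor_span_wedge_unip)
qed

section \<open>Covolumes of rational subspaces\<close>

definition int_vecs :: "(real^'k) set" where
  "int_vecs = {v. \<forall>i. v $ i \<in> \<int>}"

definition rational_subspace :: "(real^'k) set \<Rightarrow> bool" where
  "rational_subspace L \<longleftrightarrow> (\<exists>S\<subseteq>int_vecs. L = span S)"

text \<open>\<open>J j\<close> is the set of rows that carry a frame of a
  \<open>j\<close>-dimensional subspace. Since consecutive sets differ by one index, adjoining a
  vector changes a single row.\<close>

definition index_flag :: "(nat \<Rightarrow> 'k::finite set) \<Rightarrow> bool" where
  "index_flag J \<longleftrightarrow> (\<forall>j\<le>CARD('k). card (J j) = j) \<and>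
     (\<forall>j<CARD('k). \<exists>c. c \<notin> J j \<and> J (Suc j) = insert c (J j))"

definition int_frame :: "(nat \<Rightarrow> 'k set) \<Rightarrow> (real^'k) set \<Rightarrow> real^'k^'k \<Rightarrow> bool" where
  "int_frame J L M \<longleftrightarrow> (\<forall>c\<in>J (dim L). M $ c \<in> int_vecs) \<and> span ((\<lambda>c. M $ c) ` J (dim L)) = L"

text \<open>The floor only provides a natural number for \<open>arg_min\<close>; on integral frames
  \<open>wnorm\<close> takes integer values, so it loses nothing.\<close>

definition min_frame :: "(nat \<Rightarrow> 'k::finite set) \<Rightarrow> (real^'k) set \<Rightarrow> real^'k^'k" where
  "min_frame J L = arg_min (\<lambda>M. nat \<lfloor>wnorm (J (dim L)) M\<rfloor>) (int_frame J L)"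

text \<open>The covolume of \<open>L \<inter> \<int>\<^sup>k\<close> after applying \<open>H\<close>. Minimality of the frame replaces primitivity
  of the lattice.\<close>

definition covol :: "(nat \<Rightarrow> 'k::finite set) \<Rightarrow> real^'k^'k \<Rightarrow> (real^'k) set \<Rightarrow> real" where
  "covol J H L = wnorm (J (dim L)) (min_frame J L ** H)"

lemma rational_subspace_imp_subspace: "rational_subspace L \<Longrightarrow> subspace L"
  by (auto simp: rational_subspace_def)

lemma dim_le_CARD: "dim (L :: (real^'k) set) \<le> CARD('k)"
  using dim_subset_UNIV[of L] by simp

lemma wnorm_scale:
  assumes "\<And>b. wedge J b M = d * wedge J b N"
  shows "wnorm J M = \<bar>d\<bar> * wnorm J N"
proof (rule antisym)
  show "wnorm J M \<le> \<bar>d\<bar> * wnorm J N"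
    unfolding wnorm_le_iff by (simp add: assms abs_mult mult_left_mono wedge_le_wnorm)
  obtain b where "wnorm J N = \<bar>wedge J b N\<bar>" by (rule wnorm_attained)
  then have "\<bar>d\<bar> * wnorm J N = \<bar>wedge J b M\<bar>" by (simp add: assms abs_mult)
  then show "\<bar>d\<bar> * wnorm J N \<le> wnorm J M" using wedge_le_wnorm[of J b M] by simp
qed

lemma ex_int_frame:
  fixes J :: "nat \<Rightarrow> 'k::finite set"
  assumes "index_flag J" "rational_subspace L"
  shows "\<exists>M. int_frame J L M"
proof -
  obtain S where S: "S \<subseteq> int_vecs" "L = span S" using assms(2) by (auto simp: rational_subspace_def)
  obtain B where B: "B \<subseteq> S" "independent B" "S \<subseteq> span B" "card B = dim S"
    using basis_exists[of S] by blast
  have "card B = dim L" using B(4) S(2) by simp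
  then have "card (J (dim L)) = card B" using assms(1) dim_le_CARD[of L] by (simp add: index_flag_def)
  moreover have "finite B" using B(2) by (rule independent_imp_finite)
  ultimately obtain f where f: "bij_betw f (J (dim L)) B"
    using bij_betw_iff_card[of "J (dim L)" B] by auto
  have "span B = L" using B(1,3) S(2) by (metis span_eq span_mono span_subspace subspace_span subset_trans span_superset)
  moreover have "(\<lambda>c. (\<chi> c. f c) $ c) ` J (dim L) = B" using f by (simp add: bij_betw_def)
  ultimately show ?thesis
    unfolding int_frame_def using f B(1) S(1) by (intro exI[of _ "\<chi> c. f c"]) (auto simp: bij_betw_def)
qed

lemma int_frame_min_frame:
  assumes "index_flag J" "rational_subspace L"
  shows "int_frame J L (min_frame J L)"
  using ex_int_frame[OF assms] unfolding min_frame_def by (metis arg_min_natI)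

text \<open>The maximal minors of an integral frame are integers, and one of them is nonzero because
  the rows are independent.\<close>

lemma wnorm_int_frame:
  fixes J :: "nat \<Rightarrow> 'k::finite set"
  assumes "index_flag J" "int_frame J L M"
  shows "wnorm (J (dim L)) M \<in> \<int>" "wnorm (J (dim L)) M \<ge> 1"
proof -
  have int: "wedge (J (dim L)) b M \<in> \<int>" for b
    using assms(2) by (intro wedge_Ints) (auto simp: int_frame_def int_vecs_def)
  then show "wnorm (J (dim L)) M \<in> \<int>"
    by (metis wnorm_attained Ints_abs)
  have "card (J (dim L)) = dim L" using assms(1) dim_le_CARD[of L] by (simp add: index_flag_def)
  moreover have "span ((\<lambda>c. M $ c) ` J (dim L)) = L" using assms(2) by (simp add: int_frame_def)
  ultimately obtain b where b: "wedge (J (dim L)) b M \<noteq> 0"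
    using ex_wedge_nonzero[of "J (dim L)" M] by metis
  have "1 \<le> \<bar>wedge (J (dim L)) b M\<bar>" using Ints_nonzero_abs_ge1[OF int b] .
  then show "wnorm (J (dim L)) M \<ge> 1" using wedge_le_wnorm[of "J (dim L)" b M] by linarith
qed

text \<open>All coordinates of \<open>M\<close> are the same multiple \<open>d\<close> of those of
  the minimal frame. Minimality forces \<open>1 \<le> \<bar>d\<bar>\<close> before \<open>H\<close>
  is applied, and the same \<open>d\<close> holds after applying \<open>H\<close>.\<close>

lemma covol_le:
  fixes J :: "nat \<Rightarrow> 'k::finite set"
  assumes J: "index_flag J" and L: "rational_subspace L" and M: "int_frame J L M"
  shows "covol J H L \<le> wnorm (J (dim L)) (M ** H)"
proof -
  let ?J = "J (dim L)" and ?N = "min_frame J L"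
  have N: "int_frame J L ?N" by (rule int_frame_min_frame[OF J L])
  obtain d where d: "\<And>b H. wedge ?J b (M ** H) = d * wedge ?J b (?N ** H)"
  proof (rule wedge_change_basis)
    fix c assume "c \<in> ?J"
    then have "M $ c \<in> span ((\<lambda>c. M $ c) ` ?J)" by (intro span_base) auto
    then show "M $ c \<in> span ((\<lambda>c. ?N $ c) ` ?J)" using M N by (simp add: int_frame_def)
  qed (use that in blast)
  have "nat \<lfloor>wnorm ?J ?N\<rfloor> \<le> nat \<lfloor>wnorm ?J M\<rfloor>"
    unfolding min_frame_def using M by (rule arg_min_nat_le)
  moreover have "wnorm ?J ?N \<in> \<int>" "wnorm ?J ?N \<ge> 1" "wnorm ?J M \<in> \<int>" "wnorm ?J M \<ge> 1"
    using wnorm_int_frame[OF J] M N by auto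
  ultimately have "wnorm ?J ?N \<le> wnorm ?J M" by (auto elim!: Ints_cases)
  also have "wnorm ?J M = \<bar>d\<bar> * wnorm ?J ?N" using d[of _ "mat 1"] by (intro wnorm_scale) simp
  finally have "1 \<le> \<bar>d\<bar>" using \<open>wnorm ?J ?N \<ge> 1\<close> by (simp add: mult_le_cancel_right1)
  then have "1 * wnorm ?J (?N ** H) \<le> \<bar>d\<bar> * wnorm ?J (?N ** H)"
    by (intro mult_right_mono wnorm_nonneg)
  also have "\<dots> = wnorm ?J (M ** H)" using d[of _ H] by (intro wnorm_scale[symmetric])
  finally show ?thesis by (simp add: covol_def)
qed

lemma span_insert_span: "span (insert v (span A)) = span (insert v (A :: 'a::real_vector set))"
  by (simp add: span_insert span_span)

lemma rational_subspace_span_insert: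
  assumes "rational_subspace L" "v \<in> int_vecs"
  shows "rational_subspace (span (insert v L))"
proof -
  obtain S where S: "S \<subseteq> int_vecs" "L = span S" using assms(1) by (auto simp: rational_subspace_def)
  have "span (insert v L) = span (insert v S)" unfolding S(2) by (rule span_insert_span)
  then show ?thesis unfolding rational_subspace_def using S(1) assms(2)
    by (intro exI[of _ "insert v S"]) auto
qed

text \<open>Placing \<open>v\<close> in the new row of the minimal frame of \<open>L\<close> gives
  an integral frame of the larger space, perhaps not a minimal one, so \<open>covol_le\<close>
  applies; expansion along that row then splits off the size of \<open>v v* H\<close>.\<close>

lemma covol_span_insert:
  fixes J :: "nat \<Rightarrow> 'k::finite set"
  assumes J: "index_flag J" and L: "rational_subspace L" and v: "v \<in> int_vecs" "v \<notin> L"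
  shows "covol J H (span (insert v L)) \<le> (\<Sum>i\<in>UNIV. \<bar>(v v* H) $ i\<bar>) * covol J H L"
proof -
  let ?L = "span (insert v L)" and ?N = "min_frame J L"
  have "span L = L" using rational_subspace_imp_subspace[OF L] by (simp add: span_eq_iff)
  then have dim: "dim ?L = Suc (dim L)" using v(2) unfolding dim_span dim_insert by (simp only: if_False)
  then have "dim L < CARD('k)" using dim_le_CARD[of ?L] by simp
  then obtain c where c: "c \<notin> J (dim L)" "J (Suc (dim L)) = insert c (J (dim L))"
    using J by (auto simp: index_flag_def)
  define M where "M = (\<chi> i. if i = c then v else ?N $ i)"
  have N: "int_frame J L ?N" by (rule int_frame_min_frame[OF J L])
  have im: "(\<lambda>i. M $ i) ` J (dim L) = (\<lambda>i. ?N $ i) ` J (dim L)"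
    using c(1) by (intro image_cong) (auto simp: M_def)
  have "(\<lambda>i. M $ i) ` J (dim ?L) = insert v ((\<lambda>i. ?N $ i) ` J (dim L))"
    unfolding dim c(2) image_insert im by (simp add: M_def)
  moreover have "span (insert v ((\<lambda>i. ?N $ i) ` J (dim L))) = ?L"
    using span_insert_span[of v "(\<lambda>i. ?N $ i) ` J (dim L)"] N by (simp add: int_frame_def)
  ultimately have "int_frame J ?L M"
    using N v(1) c unfolding int_frame_def dim c(2) by (auto simp: M_def)
  from covol_le[OF J rational_subspace_span_insert[OF L v(1)] this]
  have "covol J H ?L \<le> wnorm (insert c (J (dim L))) (M ** H)" by (simp only: dim c(2))
  also have "\<dots> \<le> (\<Sum>i\<in>UNIV. \<bar>(M ** H) $ c $ i\<bar>) * wnorm (J (dim L)) (M ** H)"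
    by (rule wnorm_insert_le[OF c(1)])
  also have "(M ** H) $ c = v v* H" by (simp add: mat_mult_row M_def)
  also have "wnorm (J (dim L)) (M ** H) = covol J H L"
    unfolding covol_def using c(1) by (intro wnorm_cong) (auto simp: mat_mult_row M_def)
  finally show ?thesis .
qed

text \<open>Only padding rows are left, so a nonzero coordinate is the determinant of a permutation
  matrix.\<close>

lemma covol_0:
  fixes J :: "nat \<Rightarrow> 'k::finite set"
  assumes "index_flag J"
  shows "covol J H {0} \<le> 1"
proof -
  have "card (J 0) = 0" using assms unfolding index_flag_def by (metis zero_le)
  then have J0: "J (dim {0::real^'k}) = {}" by simp
  have "\<bar>wedge {} b N\<bar> \<le> 1" for b and N :: "real^'k^'k"
  proof (cases "wedge {} b N = 0")
    case False
    have "inj b" using wedge_nonzero_inj[OF False] by simp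
    then have "orthogonal_matrix ((\<chi> c. axis (b c) 1) :: real^'k^'k)"
      unfolding orthogonal_matrix_orthonormal_rows
      by (auto simp: row_def inj_def orthogonal_def inner_axis_axis)
    then show ?thesis using det_orthogonal_matrix unfolding wedge_def by force
  qed simp
  then show ?thesis unfolding covol_def J0 wnorm_le_iff by blast
qed

section \<open>Flags of rational subspaces and short vectors\<close>

definition nested_subspaces :: "'b set \<Rightarrow> 'b set \<Rightarrow> bool" where
  "nested_subspaces L L' \<longleftrightarrow> L \<subseteq> L' \<or> L' \<subseteq> L"

text \<open>The dimension is injective on a chain and takes values in \<open>{1..CARD('k)}\<close>.
  This bounds the depth of the induction in \<open>marked_points_bound\<close>.\<close>

lemma chain_of_subspaces_card:
  fixes F :: "(real^'k) set set"
  assumes "F \<subseteq> {L. rational_subspace L \<and> L \<noteq> {0}}" "pairwise nested_subspaces F"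
  shows "finite F \<and> card F \<le> CARD('k)"
proof -
  have sub: "subspace L" "L \<noteq> {0}" if "L \<in> F" for L
    using assms(1) that rational_subspace_imp_subspace by auto
  have "inj_on dim F"
  proof (rule inj_onI, rule ccontr)
    fix L L' assume *: "L \<in> F" "L' \<in> F" "dim L = dim L'" "L \<noteq> L'"
    then consider "L \<subseteq> L'" | "L' \<subseteq> L"
      using assms(2) by (auto simp: pairwise_def nested_subspaces_def)
    then show False using subspace_dim_equal[of L L'] subspace_dim_equal[of L' L] sub * by cases auto
  qed
  moreover have "dim ` F \<subseteq> {1..CARD('k)}"
  proof
    fix j assume "j \<in> dim ` F"
    then obtain L where L: "L \<in> F" "j = dim L" by auto
    have "L \<noteq> {}" using subspace_0[OF sub(1)[OF L(1)]] by auto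
    then have "\<not> L \<subseteq> {0}" using sub(2)[OF L(1)] by blast
    then have "dim L \<noteq> 0" unfolding dim_eq_0 .
    then show "j \<in> {1..CARD('k)}" using dim_le_CARD[of L] unfolding L(2) by (simp del: dim_eq_0)
  qed
  ultimately show ?thesis
    using inj_on_finite[of dim F "{1..CARD('k)}"] card_inj_on_le[of dim F "{1..CARD('k)}"] by simp
qed

text \<open>Let \<open>L\<close> be the largest space of the flag that does not contain
  \<open>v\<close>, or \<open>{0}\<close>. Then \<open>span (insert v L)\<close> is comparable with
  the whole flag, so it either belongs to it or has covolume at least \<rho>; in both cases its
  covolume is at least \<epsilon>. It is at most the size of \<open>v v* H x\<close> times the
  covolume of \<open>L\<close>, and the latter is at most 1.\<close>

theorem marked_imp_no_short_vector:
  fixes J :: "nat \<Rightarrow> 'k::finite set"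
  assumes J: "index_flag J" and \<rho>: "\<rho> \<le> 1" "\<epsilon> \<le> \<rho>"
    and m: "marked nested_subspaces (\<lambda>L x. covol J (H x) L) \<epsilon> \<rho> {L. rational_subspace L \<and> L \<noteq> {0}} x"
    and v: "v \<in> int_vecs" "v \<noteq> 0"
  shows "\<epsilon> \<le> (\<Sum>i\<in>UNIV. \<bar>(v v* H x) $ i\<bar>)"
proof -
  let ?P = "{L. rational_subspace L \<and> L \<noteq> {0}}"
  obtain F where F: "F \<subseteq> ?P" "pairwise nested_subspaces F"
    "\<And>L. L \<in> F \<Longrightarrow> \<epsilon> \<le> covol J (H x) L \<and> covol J (H x) L \<le> \<rho>"
    "\<And>L. L \<in> ?P - F \<Longrightarrow> \<forall>L'\<in>F. nested_subspaces L L' \<Longrightarrow> \<rho> \<le> covol J (H x) L"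
    using m unfolding marked_def by blast
  have rat0: "rational_subspace {0 :: real^'k}"
    unfolding rational_subspace_def by (intro exI[of _ "{}"]) auto
  define G where "G = insert {0} {L \<in> F. v \<notin> L}"
  have G: "rational_subspace L" "v \<notin> L" "covol J (H x) L \<le> 1" if "L \<in> G" for L
  proof -
    show "rational_subspace L" "v \<notin> L" using that F(1) rat0 v(2) by (auto simp: G_def)
    show "covol J (H x) L \<le> 1" using that covol_0[OF J] F(3)[of L] \<rho>(1) by (auto simp: G_def)
  qed
  have "finite G" using chain_of_subspaces_card[OF F(1,2)] by (simp add: G_def)
  then have "Max (dim ` G) \<in> dim ` G" by (intro Max_in) (auto simp: G_def)
  then obtain L where L: "L \<in> G" "dim L = Max (dim ` G)" by auto
  have max: "L' \<subseteq> L" if "L' \<in> G" for L'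
  proof -
    have subs: "subspace L" "subspace L'" using G(1) L(1) that rational_subspace_imp_subspace by auto
    have "dim L' \<le> dim L" using that \<open>finite G\<close> L(2) by simp
    moreover have "L' \<subseteq> L \<or> L \<subseteq> L'"
      using F(2) that L(1) subspace_0[OF subs(1)] subspace_0[OF subs(2)]
      by (auto simp: G_def pairwise_def nested_subspaces_def)
    ultimately show ?thesis using subspace_dim_equal[OF subs] by auto
  qed
  let ?L = "span (insert v L)"
  have rat: "rational_subspace ?L" using rational_subspace_span_insert[OF G(1)[OF L(1)] v(1)] .
  have vL: "v \<in> ?L" by (simp add: span_base)
  have cmp: "nested_subspaces ?L L'" if "L' \<in> F" for L'
  proof (cases "v \<in> L'")
    case True
    have sub: "subspace L'" using that F(1) rational_subspace_imp_subspace by auto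
    have "L \<subseteq> L'"
    proof (cases "L = {0}")
      case True
      then show ?thesis using subspace_0[OF sub] by auto
    next
      case False
      then have "L \<in> F" using L(1) by (auto simp: G_def)
      moreover have "\<not> L' \<subseteq> L" using True G(2)[OF L(1)] by auto
      moreover have "L \<noteq> L'" using True G(2)[OF L(1)] by auto
      ultimately show ?thesis using F(2) that by (auto simp: pairwise_def nested_subspaces_def)
    qed
    then have "?L \<subseteq> L'" using True sub by (intro span_minimal) auto
    then show ?thesis by (simp add: nested_subspaces_def)
  next
    case False
    then have "L' \<subseteq> L" using max that by (auto simp: G_def)
    also have "L \<subseteq> ?L" by (auto intro: span_base)
    finally show ?thesis by (simp add: nested_subspaces_def)
  qed
  have "\<epsilon> \<le> covol J (H x) ?L"
  proof (cases "?L \<in> F")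
    case False
    moreover have "?L \<noteq> {0}" using vL v(2) by auto
    ultimately have "\<rho> \<le> covol J (H x) ?L" using F(4)[of ?L] rat cmp by auto
    with \<rho>(2) show ?thesis by linarith
  qed (use F(3) in auto)
  also have "\<dots> \<le> (\<Sum>i\<in>UNIV. \<bar>(v v* H x) $ i\<bar>) * covol J (H x) L"
    by (rule covol_span_insert[OF J G(1)[OF L(1)] v(1) G(2)[OF L(1)]])
  also have "\<dots> \<le> (\<Sum>i\<in>UNIV. \<bar>(v v* H x) $ i\<bar>) * 1"
    using G(3)[OF L(1)] by (intro mult_left_mono sum_nonneg) auto
  finally show ?thesis by simp
qed

section \<open>The uniform lower bound for covolumes\<close>

definition expanding :: "('m::finite + 'n::finite \<Rightarrow> real) \<Rightarrow> bool" where
  "expanding g \<longleftrightarrow> (\<forall>i. g (Inl i) \<ge> 1) \<and> (\<forall>l. 0 < g (Inr l) \<and> g (Inr l) \<le> 1) \<and> (\<Prod>i\<in>UNIV. g i) \<ge> 1"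

lemma ex_nested_index_flag:
  obtains J :: "nat \<Rightarrow> ('m::finite + 'n::finite) set" where "index_flag J" "\<And>j. nested (J j)"
proof -
  obtain xs :: "'m list" where xs: "set xs = UNIV" "distinct xs" using finite_distinct_list[OF finite] by blast
  obtain zs :: "'n list" where zs: "set zs = UNIV" "distinct zs" using finite_distinct_list[OF finite] by blast
  define ys where "ys = map Inl xs @ map Inr zs"
  have ys: "distinct ys" using xs zs by (auto simp: ys_def distinct_map)
  have sys: "set ys = UNIV" using xs zs by (auto simp: ys_def UNIV_sum)
  have len: "length ys = CARD('m + 'n)" using distinct_card[OF ys] sys by simp
  define J where "J j = set (take j ys)" for j
  have "card (J j) = j" if "j \<le> CARD('m + 'n)" for j
    using that distinct_card[of "take j ys"] ys len by (simp add: J_def)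
  moreover have "\<exists>c. c \<notin> J j \<and> J (Suc j) = insert c (J j)" if "j < CARD('m + 'n)" for j
  proof -
    have "take (Suc j) ys = take j ys @ [ys ! j]" using that len by (intro take_Suc_conv_app_nth) simp
    moreover have "distinct (take (Suc j) ys)" using ys by simp
    ultimately show ?thesis unfolding J_def by (intro exI[of _ "ys ! j"]) auto
  qed
  moreover have "nested (J j)" for j
  proof (cases "j \<le> length xs")
    case True
    then have "J j = Inl ` set (take j xs)" by (simp add: J_def ys_def take_map)
    then show ?thesis by (auto simp: nested_def)
  next
    case False
    then have "range Inl \<subseteq> J j" using xs(1) by (simp add: J_def ys_def)
    then show ?thesis by (auto simp: nested_def)
  qed
  ultimately show ?thesis using that unfolding index_flag_def by blast
qed

text \<open>The minimal frame is \<open>d\<close> times an orthonormal frame \<open>E\<close> in all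
  coordinates. Its largest minor is at least 1 by integrality, while those of \<open>E\<close> are
  at most \<open>fact ?k\<close>, which bounds \<open>\<bar>d\<bar>\<close> from below. The
  compactness bound for \<open>E\<close> supplies an admissible coordinate, and this survives
  multiplication by \<open>diag_mat g\<close>.\<close>

theorem covol_uniform_lower_bound:
  fixes S :: "(real^'n^'m) set" and J :: "nat \<Rightarrow> ('m::finite + 'n::finite) set"
  assumes J: "index_flag J" "\<And>j. nested (J j)" and H: "\<And>H. H \<in> H_collection \<Longrightarrow> \<not> S \<subseteq> H"
  obtains \<rho> where "0 < \<rho>" "\<rho> \<le> 1"
    "\<And>L g. rational_subspace L \<Longrightarrow> expanding g \<Longrightarrow> \<exists>Y\<in>S. \<rho> \<le> covol J (unip Y ** diag_mat g) L"
proof -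
  let ?k = "CARD('m + 'n)"
  have "\<forall>j. \<exists>\<delta>>0. \<forall>E. orthogonal_matrix E \<longrightarrow>
      (\<exists>Y\<in>S. \<exists>b. admissible b (J j) \<and> \<delta> \<le> \<bar>wedge (J j) b (E ** unip Y)\<bar>)"
    using wedge_uniform_lower_bound[OF J(2) H] by blast
  then obtain \<delta> where \<delta>: "\<And>j. \<delta> j > 0" "\<And>j E. orthogonal_matrix E \<Longrightarrow>
      \<exists>Y\<in>S. \<exists>b. admissible b (J j) \<and> \<delta> j \<le> \<bar>wedge (J j) b (E ** unip Y)\<bar>"
    by metis
  define \<rho> where "\<rho> = Min (insert 1 (\<delta> ` {..?k})) / fact ?k"
  have Mpos: "Min (insert 1 (\<delta> ` {..?k})) > 0" using \<delta>(1) by (subst Min_gr_iff) auto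
  have M1: "Min (insert 1 (\<delta> ` {..?k})) \<le> 1" by (rule Min_le) auto
  have M\<delta>: "Min (insert 1 (\<delta> ` {..?k})) \<le> \<delta> j" if "j \<le> ?k" for j using that by (intro Min_le) auto
  have f1: "(1::real) \<le> fact ?k" by (rule fact_ge_1)
  show ?thesis
  proof
    show "0 < \<rho>" using Mpos by (simp add: \<rho>_def)
    show "\<rho> \<le> 1" unfolding \<rho>_def using order_trans[OF M1 f1] by (subst divide_le_eq) auto
    fix L :: "(real^('m + 'n)) set" and g :: "'m + 'n \<Rightarrow> real" assume L: "rational_subspace L" and g: "expanding g"
    let ?J = "J (dim L)" and ?M = "min_frame J L"
    have M: "int_frame J L ?M" by (rule int_frame_min_frame[OF J(1) L])
    have "card ?J = dim L" using J(1) dim_le_CARD[of L] by (simp add: index_flag_def)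
    then obtain E where E: "orthogonal_matrix E" "span ((\<lambda>c. E $ c) ` ?J) = L"
      using orthogonal_matrix_spanning[OF rational_subspace_imp_subspace[OF L]] by blast
    obtain d where d: "\<And>b H. wedge ?J b (?M ** H) = d * wedge ?J b (E ** H)"
    proof (rule wedge_change_basis)
      fix c assume "c \<in> ?J"
      then have "?M $ c \<in> span ((\<lambda>c. ?M $ c) ` ?J)" by (intro span_base) auto
      then show "?M $ c \<in> span ((\<lambda>c. E $ c) ` ?J)" using M E by (simp add: int_frame_def)
    qed (use that in blast)
    have "1 \<le> wnorm ?J ?M" by (rule wnorm_int_frame[OF J(1) M])
    also have "wnorm ?J ?M = \<bar>d\<bar> * wnorm ?J E" using d[of _ "mat 1"] by (intro wnorm_scale) simp
    also have "\<dots> \<le> \<bar>d\<bar> * fact ?k"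
      unfolding wnorm_le_iff using wedge_abs_le_fact[of E] orthogonal_matrix_entry_le_1[OF E(1)]
      by (intro mult_left_mono) (auto simp: wnorm_le_iff)
    finally have d1: "1 / fact ?k \<le> \<bar>d\<bar>" by (simp add: divide_le_eq)
    obtain Y b where Y: "Y \<in> S" "admissible b ?J" "\<delta> (dim L) \<le> \<bar>wedge ?J b (E ** unip Y)\<bar>"
      using \<delta>(2)[OF E(1)] by blast
    have "\<rho> \<le> (1 / fact ?k) * \<delta> (dim L)"
      unfolding \<rho>_def using M\<delta>[OF dim_le_CARD] by (simp add: divide_right_mono)
    also have "\<dots> \<le> \<bar>d\<bar> * \<bar>wedge ?J b (E ** unip Y)\<bar>"
      using d1 Y(3) less_imp_le[OF \<delta>(1)] by (intro mult_mono) auto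
    also have "\<dots> \<le> \<bar>d\<bar> * \<bar>wedge ?J b ((E ** unip Y) ** diag_mat g)\<bar>"
      using admissible_wedge_diag_ge[OF Y(2)] g by (intro mult_left_mono) (auto simp: expanding_def)
    also have "\<dots> = \<bar>wedge ?J b (?M ** (unip Y ** diag_mat g))\<bar>"
      by (simp only: d abs_mult flip: matrix_mul_assoc)
    also have "\<dots> \<le> covol J (unip Y ** diag_mat g) L" unfolding covol_def by (rule wedge_le_wnorm)
    finally show "\<exists>Y\<in>S. \<rho> \<le> covol J (unip Y ** diag_mat g) L" using Y(1) by blast
  qed
qed

section \<open>Quantitative nondivergence\<close>

lemma continuous_on_Max_finite:
  fixes f :: "'i \<Rightarrow> 'a::topological_space \<Rightarrow> real"
  assumes "finite A" "A \<noteq> {}" "\<And>a. a \<in> A \<Longrightarrow> continuous_on W (f a)"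
  shows "continuous_on W (\<lambda>x. Max ((\<lambda>a. f a x) ` A))"
  using assms
proof (induction A rule: finite_ne_induct)
  case (insert a A)
  then have "(\<lambda>x. Max ((\<lambda>a. f a x) ` insert a A)) = (\<lambda>x. max (f a x) (Max ((\<lambda>a. f a x) ` A)))"
    by auto
  then show ?case using insert by (simp only:) (intro continuous_on_max, auto)
qed simp

lemma ennpowr_le:
  assumes "0 < \<rho>" "0 < \<epsilon>" "0 < \<alpha>" "ennreal \<rho> \<le> s"
  shows "ennpowr (ennreal \<epsilon> / s) \<alpha> \<le> ennreal ((\<epsilon> / \<rho>) powr \<alpha>)"
proof (cases s)
  case (real t)
  then have "\<rho> \<le> t" using assms by simp
  then have "ennreal \<epsilon> / s = ennreal (\<epsilon> / t)" using assms real by (simp add: divide_ennreal)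
  moreover have "(\<epsilon> / t) powr \<alpha> \<le> (\<epsilon> / \<rho>) powr \<alpha>"
    using assms \<open>\<rho> \<le> t\<close> by (intro powr_mono2 divide_left_mono) auto
  ultimately show ?thesis using assms \<open>\<rho> \<le> t\<close> by (simp add: ennpowr_def ennreal_leI)
next
  case top
  then show ?thesis by (simp add: ennpowr_def)
qed

lemma expanding_pos:
  assumes "expanding g"
  shows "g c > 0"
proof (cases c)
  case (Inl i)
  have "1 \<le> g (Inl i)" using assms by (simp add: expanding_def)
  then show ?thesis using Inl by simp
qed (use assms in \<open>simp add: expanding_def\<close>)

lemma wedge_affine_minors:
  fixes V :: "real^('m::{finite,linorder} + 'n::{finite,linorder})^('m + 'n)"
  assumes "expanding g"
  obtains c0 c where "\<And>Y. wedge J b (V ** (unip Y ** diag_mat g)) =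
    c0 + (\<Sum>p\<in>minor_indices. c p * minor (fst p) (snd p) Y)"
proof -
  have "g c \<noteq> 0" for c using expanding_pos[OF assms, of c] by simp
  from minor_span_wedge[of g J b V, OF this] show ?thesis
    unfolding minor_span_def using that by blast
qed

lemma continuous_on_minor:
  assumes "continuous_on W F"
  shows "continuous_on W (\<lambda>y. minor I K (F y))"
  unfolding minor_def by (intro continuous_intros assms)

text \<open>The covolumes play the role of \<open>\<psi>\<close> in
  \<open>marked_points_bound\<close>, whose sublevel hypothesis follows from goodness applied to a
  single coordinate. \<open>K\<close> and \<rho> are fixed before \<open>g\<close> and \<epsilon>,
  as the summation over all \<open>g\<close> requires.\<close>

theorem quantitative_nondivergence:
  fixes \<mu> :: "'a::euclidean_space measure" and F :: "'a \<Rightarrow> real^'n::{finite,linorder}^'m::{finite,linorder}"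
  assumes sets: "sets \<mu> = sets (restrict_space borel U)" and U: "open U" "W \<subseteq> U" "open W"
    and fed: "D_federer_on D \<mu> W" "D \<ge> 0" and C: "C > 0" "\<alpha> > 0"
    and F: "continuous_on W F"
    and good: "\<And>c0 c. C_alpha_good_on C \<alpha> (\<lambda>y. c0 + (\<Sum>p\<in>minor_indices. c p * minor (fst p) (snd p) (F y))) W \<mu>"
    and x0: "x0 \<in> supp_measure \<mu>" "r0 > 0" "ball x0 (5 ^ CARD('m + 'n) * r0) \<subseteq> W"
    and nonplanar: "\<And>H. H \<in> H_collection \<Longrightarrow> \<not> F ` (ball x0 r0 \<inter> supp_measure \<mu>) \<subseteq> H"
  obtains K \<rho> where "K \<ge> 0" "0 < \<rho>"
    "\<And>g \<epsilon>. expanding g \<Longrightarrow> 0 < \<epsilon> \<Longrightarrow> \<epsilon> \<le> \<rho> \<Longrightarrow> \<exists>N\<in>sets \<mu>.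
       emeasure \<mu> N \<le> ennreal (K * \<epsilon> powr \<alpha>) * emeasure \<mu> (ball x0 r0) \<and>
       (\<forall>x\<in>ball x0 r0 \<inter> supp_measure \<mu> - N. \<forall>v\<in>int_vecs. v \<noteq> 0 \<longrightarrow>
          \<epsilon> \<le> (\<Sum>i\<in>UNIV. g i * \<bar>(v v* unip (F x)) $ i\<bar>))"
proof -
  let ?S = "supp_measure \<mu>" and ?k = "CARD('m + 'n)"
  let ?P = "{L :: (real^('m + 'n)) set. rational_subspace L \<and> L \<noteq> {0}}"
  obtain J :: "nat \<Rightarrow> ('m + 'n) set" where J: "index_flag J" "\<And>j. nested (J j)"
    using ex_nested_index_flag by blast
  obtain \<rho> where \<rho>: "0 < \<rho>" "\<rho> \<le> 1"
    and large: "\<And>L g. rational_subspace L \<Longrightarrow> expanding g \<Longrightarrow>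
      \<exists>Y\<in>F ` (ball x0 r0 \<inter> ?S). \<rho> \<le> covol J (unip Y ** diag_mat g) L"
    using covol_uniform_lower_bound[OF J nonplanar] by blast
  define K where "K = nondiv_const D ?k * C * (1 / \<rho>) powr \<alpha>"
  have K0: "K \<ge> 0" using nondiv_const_nonneg[OF fed(2)] C by (simp add: K_def)
  have main: "\<exists>N\<in>sets \<mu>. emeasure \<mu> N \<le> ennreal (K * \<epsilon> powr \<alpha>) * emeasure \<mu> (ball x0 r0) \<and>
       (\<forall>x\<in>ball x0 r0 \<inter> ?S - N. \<forall>v\<in>int_vecs. v \<noteq> 0 \<longrightarrow>
          \<epsilon> \<le> (\<Sum>i\<in>UNIV. g i * \<bar>(v v* unip (F x)) $ i\<bar>))"
    if g: "expanding g" and \<epsilon>: "0 < \<epsilon>" "\<epsilon> \<le> \<rho>" for g \<epsilon>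
  proof -
    define H where "H x = unip (F x) ** diag_mat g" for x
    define c where "c = C * (\<epsilon> / \<rho>) powr \<alpha>"
    have cont_w: "continuous_on W (\<lambda>x. wedge I b (V ** H x))" for I b V
    proof -
      obtain c0 d where "\<And>Y. wedge I b (V ** (unip Y ** diag_mat g)) =
          c0 + (\<Sum>p\<in>minor_indices. d p * minor (fst p) (snd p) Y)"
        using wedge_affine_minors[OF g] by blast
      then show ?thesis unfolding H_def by (auto intro!: continuous_intros continuous_on_minor F)
    qed
    have cont: "continuous_on W (\<lambda>x. covol J (H x) L)" for L
      unfolding covol_def wnorm_def using cont_w
      by (intro continuous_on_Max_finite[where A = UNIV]) (auto intro: continuous_on_rabs)
    have goodL: "emeasure \<mu> {y \<in> ball x r. covol J (H y) L < \<epsilon>} \<le> ennreal c * emeasure \<mu> (ball x r)"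
      if x: "x \<in> ?S" "r > 0" "ball x r \<subseteq> W" and ex: "\<exists>z\<in>ball x r \<inter> ?S. \<rho> \<le> covol J (H z) L" for x r L
    proof -
      obtain z where z: "z \<in> ball x r \<inter> ?S" "\<rho> \<le> covol J (H z) L" using ex by blast
      let ?w = "\<lambda>b y. wedge (J (dim L)) b (min_frame J L ** H y)"
      \<comment> \<open>The coordinate \<open>b\<close> that realises the covolume at
        \<open>z\<close> has supremum at least \<rho> on the ball, and where the covolume is below
        \<epsilon> so is this coordinate.\<close>
      obtain b where b: "covol J (H z) L = \<bar>?w b z\<bar>" unfolding covol_def by (rule wnorm_attained)
      obtain c0 d where cd: "\<And>Y. wedge (J (dim L)) b (min_frame J L ** (unip Y ** diag_mat g)) =
          c0 + (\<Sum>p\<in>minor_indices. d p * minor (fst p) (snd p) Y)"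
        using wedge_affine_minors[OF g] by blast
      have fw: "?w b = (\<lambda>y. c0 + (\<Sum>p\<in>minor_indices. d p * minor (fst p) (snd p) (F y)))"
        unfolding H_def cd ..
      have gw: "C_alpha_good_on C \<alpha> (?w b) W \<mu>" unfolding fw by (rule good)
      have cb: "continuous_on (ball x r) (?w b)" using cont_w continuous_on_subset x(3) by blast
      have "open {y \<in> ball x r. \<bar>?w b y\<bar> < \<epsilon>}"
      proof -
        have "continuous_on (ball x r) (\<lambda>y. \<bar>?w b y\<bar>)" using cb by (rule continuous_on_rabs)
        then have "open (ball x r \<inter> (\<lambda>y. \<bar>?w b y\<bar>) -` {..<\<epsilon>})"
          by (rule continuous_open_preimage) auto
        then show ?thesis by (simp add: vimage_def Int_def)
      qed
      then have meas: "{y \<in> ball x r. \<bar>?w b y\<bar> < \<epsilon>} \<in> sets \<mu>"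
        using U x(3) by (auto simp: sets sets_restrict_space_iff)
      have "emeasure \<mu> {y \<in> ball x r. covol J (H y) L < \<epsilon>} \<le> emeasure \<mu> {y \<in> ball x r. \<bar>?w b y\<bar> < \<epsilon>}"
      proof (rule emeasure_mono[OF _ meas], safe)
        fix y assume "covol J (H y) L < \<epsilon>"
        then show "\<bar>?w b y\<bar> < \<epsilon>"
          using wedge_le_wnorm[of "J (dim L)" b "min_frame J L ** H y"] by (simp add: covol_def)
      qed
      also have "\<dots> \<le> ennreal C * ennpowr (ennreal \<epsilon> / sup_norm_on \<mu> (ball x r) (?w b)) \<alpha> * emeasure \<mu> (ball x r)"
        by (rule gw[unfolded C_alpha_good_on_def, rule_format, OF x \<epsilon>(1)])
      also have "\<dots> \<le> ennreal C * ennreal ((\<epsilon> / \<rho>) powr \<alpha>) * emeasure \<mu> (ball x r)"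
      proof (intro mult_right_mono mult_left_mono ennpowr_le \<rho>(1) \<epsilon>(1) C(2))
        have "ennreal \<rho> \<le> ennreal \<bar>?w b z\<bar>" using z(2) b by (simp add: ennreal_leI)
        also have "\<dots> \<le> sup_norm_on \<mu> (ball x r) (?w b)"
          unfolding sup_norm_on_def using z(1) by (rule SUP_upper)
        finally show "ennreal \<rho> \<le> sup_norm_on \<mu> (ball x r) (?w b)" .
      qed auto
      also have "ennreal C * ennreal ((\<epsilon> / \<rho>) powr \<alpha>) = ennreal c"
        using C by (simp add: c_def ennreal_mult)
      finally show ?thesis .
    qed
    have "\<exists>N\<in>sets \<mu>. emeasure \<mu> N \<le> ennreal (nondiv_const D ?k) * ennreal c * emeasure \<mu> (ball x0 r0) \<and>
      (\<forall>x\<in>ball x0 r0 \<inter> ?S - N. marked nested_subspaces (\<lambda>L x. covol J (H x) L) \<epsilon> \<rho> ?P x)"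
    proof (rule marked_points_bound[OF sets U fed])
      show "symp (nested_subspaces :: (real^('m + 'n)) set \<Rightarrow> _)" by (auto simp: symp_def nested_subspaces_def)
      show "\<exists>z\<in>ball x0 r0 \<inter> ?S. \<rho> \<le> covol J (H z) L" if "L \<in> ?P" for L
        using large[OF _ g, of L] that unfolding H_def by blast
    qed (rule cont goodL chain_of_subspaces_card x0; assumption)+
    then obtain N where N: "N \<in> sets \<mu>"
      "emeasure \<mu> N \<le> ennreal (nondiv_const D ?k) * ennreal c * emeasure \<mu> (ball x0 r0)"
      "\<And>x. x \<in> ball x0 r0 \<inter> ?S - N \<Longrightarrow> marked nested_subspaces (\<lambda>L x. covol J (H x) L) \<epsilon> \<rho> ?P x"
      by blast
    have "nondiv_const D ?k * c = K * \<epsilon> powr \<alpha>"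
      using \<epsilon>(1) \<rho>(1) by (simp add: K_def c_def powr_divide)
    then have "ennreal (nondiv_const D ?k) * ennreal c = ennreal (K * \<epsilon> powr \<alpha>)"
      using nondiv_const_nonneg[OF fed(2)] C by (simp add: c_def flip: ennreal_mult)
    moreover have "\<epsilon> \<le> (\<Sum>i\<in>UNIV. g i * \<bar>(v v* unip (F x)) $ i\<bar>)"
      if x: "x \<in> ball x0 r0 \<inter> ?S - N" and v: "v \<in> int_vecs" "v \<noteq> 0" for x v
    proof -
      have "\<epsilon> \<le> (\<Sum>i\<in>UNIV. \<bar>(v v* H x) $ i\<bar>)"
        by (rule marked_imp_no_short_vector[where H = H, OF J(1) \<rho>(2) \<epsilon>(2) N(3)[OF x] v])
      also have "\<dots> = (\<Sum>i\<in>UNIV. g i * \<bar>(v v* unip (F x)) $ i\<bar>)"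
      proof (rule sum.cong)
        fix i
        have "(v v* H x) $ i = ((v v* unip (F x)) v* diag_mat g) $ i"
          by (simp add: H_def vector_matrix_mul_assoc)
        also have "\<dots> = (\<Sum>j\<in>UNIV. if j = i then (v v* unip (F x)) $ j * g j else 0)"
          unfolding vector_matrix_mult_def diag_mat_def vec_lambda_beta by (intro sum.cong) auto
        also have "\<dots> = (v v* unip (F x)) $ i * g i" by simp
        finally show "\<bar>(v v* H x) $ i\<bar> = g i * \<bar>(v v* unip (F x)) $ i\<bar>"
          using expanding_pos[OF g, of i] by (simp add: abs_mult)
      qed simp
      finally show ?thesis .
    qed
    ultimately show ?thesis using N(2) by (intro bexI[OF _ N(1)] conjI ballI impI) auto
  qed
  show ?thesis by (rule that[OF K0 \<rho>(1) main])
qed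

section \<open>Short vectors from approximations\<close>

definition flow :: "('m + 'n \<Rightarrow> nat) \<Rightarrow> 'm + 'n \<Rightarrow> real" where
  "flow \<tau> c = (case c of Inl i \<Rightarrow> 2 ^ \<tau> c | Inr l \<Rightarrow> 1 / 2 ^ \<tau> c)"

lemma Dirichlet_approx_finite:
  fixes \<theta> :: "'m::finite \<Rightarrow> real" and N :: nat
  assumes "N > 0"
  obtains l :: int and p :: "'m \<Rightarrow> int" where "0 < l" "l \<le> int (N ^ CARD('m))"
    "\<And>i. \<bar>of_int l * \<theta> i - of_int (p i)\<bar> < 1 / N"
proof -
  obtain f :: "nat \<Rightarrow> 'm" where f: "bij_betw f {..<CARD('m)} UNIV"
    using bij_betw_from_nat_into_finite[of "UNIV :: 'm set"] by auto
  obtain l p where lp: "0 < l" "l \<le> int (N ^ CARD('m))"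
    "\<And>i. i < CARD('m) \<Longrightarrow> \<bar>of_int l * \<theta> (f i) - of_int (p i)\<bar> < 1 / N"
    using Dirichlet_approx_simult[OF assms, of "CARD('m)" "\<theta> \<circ> f"] by auto
  show ?thesis
  proof (rule that[OF lp(1,2), of "\<lambda>i. p (inv_into {..<CARD('m)} f i)"])
    fix i
    have "i \<in> f ` {..<CARD('m)}" using f by (simp add: bij_betw_def)
    then show "\<bar>of_int l * \<theta> i - of_int (p (inv_into {..<CARD('m)} f i))\<bar> < 1 / N"
      using lp(3)[of "inv_into {..<CARD('m)} f i"] inv_into_into[of i f "{..<CARD('m)}"]
      by (simp add: f_inv_into_f)
  qed
qed

lemma prod_flow:
  fixes \<tau> :: "'m::finite + 'n::finite \<Rightarrow> nat"
  shows "(\<Prod>c\<in>UNIV. flow \<tau> c) = 2 ^ (\<Sum>i\<in>UNIV. \<tau> (Inl i)) / 2 ^ (\<Sum>l\<in>UNIV. \<tau> (Inr l))"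
proof -
  have "(\<Prod>c\<in>UNIV. flow \<tau> c) = (\<Prod>c\<in>range Inl. flow \<tau> c) * (\<Prod>c\<in>range Inr. flow \<tau> c)"
    by (subst UNIV_sum, subst prod.union_disjoint) auto
  then show ?thesis by (simp add: prod.reindex flow_def prod_dividef power_sum)
qed

text \<open>The cap \<open>T\<close> covers small \<open>y\<close>, in particular
  \<open>y = 0\<close>, where no power of 2 would be the last one.\<close>

lemma greatest_contracting_exponent:
  fixes y r :: real
  assumes "y \<le> r"
  obtains t where "t \<le> T" "2 ^ t * y \<le> r" "t < T \<Longrightarrow> r < 2 ^ Suc t * y"
proof -
  define t where "t = (GREATEST t. t \<le> T \<and> 2 ^ t * y \<le> r)"
  have "t \<le> T \<and> 2 ^ t * y \<le> r" unfolding t_def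
    by (rule GreatestI_nat[of _ 0 T]) (use assms in auto)
  moreover have "r < 2 ^ Suc t * y" if "t < T"
  proof (rule ccontr)
    assume "\<not> r < 2 ^ Suc t * y"
    then have "Suc t \<le> t" unfolding t_def
      using that by (intro Greatest_le_nat[of _ _ T]) (auto simp: t_def)
    then show False by simp
  qed
  ultimately show ?thesis using that by blast
qed

lemma ex_power2_bracket:
  fixes x :: real
  assumes "1 \<le> x"
  obtains u where "x \<le> 2 ^ u" "2 ^ u \<le> 2 * x"
proof -
  define u where "u = (LEAST u. x \<le> 2 ^ u)"
  have "\<exists>u. x \<le> 2 ^ u" using real_arch_pow[of 2 x] less_imp_le by auto
  then have u: "x \<le> 2 ^ u" unfolding u_def by (rule LeastI_ex)
  have "2 ^ u \<le> 2 * x"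
  proof (cases u)
    case (Suc w)
    then have "\<not> x \<le> 2 ^ w" using not_less_Least[of w "\<lambda>u. x \<le> 2 ^ u"] by (simp add: u_def)
    then show ?thesis using Suc by simp
  qed (use assms in simp)
  with u show ?thesis using that by blast
qed

lemma ex_scale:
  fixes Q :: real and c a0 :: nat
  assumes "c > 0" "2 ^ (c * a0) \<le> Q"
  obtains a where "a0 \<le> a" "2 ^ (c * a) \<le> Q" "Q < 2 ^ (c * Suc a)"
proof -
  let ?P = "\<lambda>a. 2 ^ (c * a) \<le> Q"
  obtain b :: nat where b: "Q < 2 ^ b" using real_arch_pow[of 2 Q] by auto
  have bd: "a \<le> b" if "?P a" for a
  proof -
    have "(2::real) ^ (c * a) < 2 ^ b" using that b by linarith
    then have "c * a < b" by (rule power_less_imp_less_exp[rotated]) simp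
    moreover have "a \<le> c * a" using assms(1) by simp
    ultimately show ?thesis by linarith
  qed
  define a where "a = (GREATEST a. ?P a)"
  have "?P a" unfolding a_def by (rule GreatestI_nat[of _ a0 b]) (use assms bd in auto)
  moreover have "a0 \<le> a" unfolding a_def by (rule Greatest_le_nat[of _ _ b]) (use assms bd in auto)
  moreover have "\<not> ?P (Suc a)"
  proof
    assume "?P (Suc a)"
    then have "Suc a \<le> a" unfolding a_def by (rule Greatest_le_nat) (use bd in auto)
    then show False by simp
  qed
  ultimately show ?thesis using that by auto
qed

text \<open>
  A small product need not have small factors. Dirichlet's theorem provides a multiple \<open>l q\<close> for which
  all \<open>m\<close> coordinates are at most \<open>2^(-a)\<close>, at the cost of a power of \<open>2^a\<close> that is absorbed by
  \<open>Q^\<epsilon>\<close>.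
\<close>

theorem VWMA_imp_short_vectors:
  fixes Y :: "real^'n::finite^'m::finite"
  assumes "VWMA Y"
  obtains c :: nat where "\<And>a0. \<exists>a\<ge>a0. \<exists>\<tau> :: 'm + 'n \<Rightarrow> nat. (\<forall>i. \<tau> i \<le> c * a) \<and>
     (\<Sum>l\<in>UNIV. \<tau> (Inr l)) \<le> (\<Sum>i\<in>UNIV. \<tau> (Inl i)) \<and>
     (\<exists>v\<in>int_vecs. v \<noteq> 0 \<and> (\<forall>i. flow \<tau> i * \<bar>(v v* unip Y) $ i\<bar> \<le> 1 / 2 ^ a))"
proof -
  obtain \<epsilon> where \<epsilon>: "\<epsilon> > 0" and ex: "\<And>Q\<^sub>0. \<exists>Q>1. Q > Q\<^sub>0 \<and>
        (\<exists>(q :: int^'n) (p :: int^'m). q \<noteq> 0 \<and>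
           Pi_abs (Y *v real_of_int_vec q - real_of_int_vec p) < Q powr (- 1 - \<epsilon>) \<and>
           Pi_plus (real_of_int_vec q) \<le> Q)"
    using assms unfolding VWMA_def by blast
  define m where "m = CARD('m)"
  define n where "n = CARD('n)"
  \<comment> \<open>Per unit of \<open>a\<close>, the gain \<open>\<epsilon> * c0\<close> has to pay
    \<open>m\<close> for the target size \<open>2^(-a)\<close> in \<open>m\<close> coordinates,
    \<open>m * m\<close> and \<open>m * n\<close> for the multiplier
    \<open>l \<le> 2^(a * m)\<close>, and \<open>n\<close> for the extra contraction by
    \<open>2^(-a)\<close> of the last \<open>n\<close> coordinates. The final 1 absorbs the
    constants \<open>m + n + c0\<close>, because \<open>a\<close> is at least their sum.\<close>
  obtain c0 :: nat where "real (m + n + m * m + m * n + 1) / \<epsilon> < c0" using reals_Archimedean2 by blast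
  then have c0: "real (m + n + m * m + m * n + 1) \<le> \<epsilon> * c0" using \<epsilon> by (simp add: field_simps)
  have "0 < real (m + n + m * m + m * n + 1)" unfolding of_nat_0_less_iff by simp
  then have "0 < \<epsilon> * c0" using c0 by linarith
  then have "c0 > 0" using \<epsilon> by (simp add: zero_less_mult_iff)
  define c where "c = 2 * n + m * n + 2 * c0"
  have "\<exists>a\<ge>a0. \<exists>\<tau> :: 'm + 'n \<Rightarrow> nat. (\<forall>i. \<tau> i \<le> c * a) \<and>
     (\<Sum>l\<in>UNIV. \<tau> (Inr l)) \<le> (\<Sum>i\<in>UNIV. \<tau> (Inl i)) \<and>
     (\<exists>v\<in>int_vecs. v \<noteq> 0 \<and> (\<forall>i. flow \<tau> i * \<bar>(v v* unip Y) $ i\<bar> \<le> 1 / 2 ^ a))" for a0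
  proof -
    define a1 where "a1 = a0 + m + n + c0"
    obtain Q q p where Q: "Q > 1" "Q > 2 ^ (c0 * a1)" and q: "(q :: int^'n) \<noteq> 0"
      and small: "Pi_abs (Y *v real_of_int_vec q - real_of_int_vec p) < Q powr (- 1 - \<epsilon>)"
      and big: "Pi_plus (real_of_int_vec q) \<le> Q"
      using ex by blast
    obtain a where a: "a1 \<le> a" "2 ^ (c0 * a) \<le> Q" "Q < 2 ^ (c0 * Suc a)"
      using ex_scale[OF \<open>c0 > 0\<close> less_imp_le[OF Q(2)]] by blast
    have a_pos: "a \<ge> 1" using a(1) \<open>c0 > 0\<close> by (simp add: a1_def)
    define \<theta> where "\<theta> i = (Y *v real_of_int_vec q) $ i" for i
    obtain l p' where l: "0 < l" "l \<le> int ((2 ^ a) ^ m)" and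
      p': "\<And>i. \<bar>of_int l * \<theta> i - of_int (p' i)\<bar> < 1 / real (2 ^ a)"
      using Dirichlet_approx_finite[of "2 ^ a" \<theta>] unfolding m_def by auto
    have lr: "real_of_int l \<ge> 1" "real_of_int l \<le> 2 ^ (a * m)"
    proof -
      show "real_of_int l \<ge> 1" using l(1) by simp
      have "real_of_int l \<le> real_of_int (int ((2 ^ a) ^ m))" using l(2) by (simp only: of_int_le_iff)
      then show "real_of_int l \<le> 2 ^ (a * m)" by (simp add: power_mult)
    qed
    \<comment> \<open>The distance to the nearest integer inherits two bounds: \<open>2^(-a)\<close>
      in every coordinate from Dirichlet, and \<open>l\<close> times the original error, whose
      product over the coordinates is small.\<close>
    define y where "y i = \<bar>of_int l * \<theta> i - of_int (round (of_int l * \<theta> i))\<bar>" for i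
    have y1: "y i \<le> 1 / 2 ^ a" for i
      using round_diff_minimal[of "of_int l * \<theta> i" "p' i"] p'[of i] by (simp add: y_def)
    have y2: "y i \<le> of_int l * \<bar>\<theta> i - of_int (p $ i)\<bar>" for i
    proof -
      have "y i \<le> \<bar>of_int l * \<theta> i - of_int (l * p $ i)\<bar>" unfolding y_def by (rule round_diff_minimal)
      also have "\<dots> = \<bar>of_int l * (\<theta> i - of_int (p $ i))\<bar>" by (simp add: algebra_simps)
      also have "\<dots> = of_int l * \<bar>\<theta> i - of_int (p $ i)\<bar>" using l(1) by (simp add: abs_mult)
      finally show ?thesis .
    qed
    have prod_y: "(\<Prod>i\<in>UNIV. y i) \<le> 2 powr (real (a * m * m) - (1 + \<epsilon>) * real (c0 * a))"
    proof -
      have "(\<Prod>i\<in>UNIV. y i) \<le> (\<Prod>i\<in>UNIV. of_int l * \<bar>\<theta> i - of_int (p $ i)\<bar>)"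
        by (intro prod_mono) (simp add: y2, simp add: y_def)
      also have "\<dots> = of_int l ^ m * Pi_abs (Y *v real_of_int_vec q - real_of_int_vec p)"
        by (simp add: prod.distrib Pi_abs_def \<theta>_def real_of_int_vec_def m_def)
      also have "\<dots> \<le> (2 ^ (a * m)) ^ m * Q powr (- 1 - \<epsilon>)"
        using lr small by (intro mult_mono power_mono) (auto simp: Pi_abs_def intro!: prod_nonneg)
      also have "Q powr (- 1 - \<epsilon>) \<le> (2 ^ (c0 * a)) powr (- 1 - \<epsilon>)"
        using a(2) \<epsilon> by (intro powr_mono2') auto
      also have "(2 ^ (a * m)) ^ m * (2 ^ (c0 * a)) powr (- 1 - \<epsilon>)
          = 2 powr (real (a * m * m) - (1 + \<epsilon>) * real (c0 * a))"
        by (simp add: powr_powr powr_diff algebra_simps flip: powr_realpow power_mult powr_add)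
      finally show ?thesis by simp
    qed
    define X where "X j = max 1 \<bar>real_of_int (l * q $ j)\<bar>" for j
    have "\<exists>u. X j \<le> 2 ^ u \<and> 2 ^ u \<le> 2 * X j" for j
      by (rule ex_power2_bracket[of "X j"]) (auto simp: X_def)
    then obtain u where u: "\<And>j. X j \<le> 2 ^ u j" "\<And>j. 2 ^ u j \<le> 2 * X j" by metis
    \<comment> \<open>\<open>T\<close> bounds the total contraction (the exponents
      \<open>a + u j\<close>) and is also the cap for each expanding exponent.\<close>
    define T where "T = n * a + (n + a * m * n + c0 * Suc a)"
    have sum_u: "(\<Sum>j\<in>UNIV. u j) \<le> n + a * m * n + c0 * Suc a"
    proof -
      have "(2::real) ^ (\<Sum>j\<in>UNIV. u j) = (\<Prod>j\<in>UNIV. 2 ^ u j)" by (simp add: power_sum)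
      also have "\<dots> \<le> (\<Prod>j\<in>UNIV. 2 * (of_int l * max 1 \<bar>real_of_int (q $ j)\<bar>))"
      proof (intro prod_mono conjI)
        fix j
        have "X j \<le> of_int l * max 1 \<bar>real_of_int (q $ j)\<bar>"
          unfolding X_def
        proof (rule max.boundedI)
          show "1 \<le> of_int l * max 1 \<bar>real_of_int (q $ j)\<bar>"
            using mult_mono[of 1 "real_of_int l" 1 "max 1 \<bar>real_of_int (q $ j)\<bar>"] lr(1) by simp
          have "of_int l * \<bar>real_of_int (q $ j)\<bar> \<le> of_int l * max 1 \<bar>real_of_int (q $ j)\<bar>"
            using lr(1) by (intro mult_left_mono) auto
          then show "\<bar>real_of_int (l * q $ j)\<bar> \<le> of_int l * max 1 \<bar>real_of_int (q $ j)\<bar>"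
            using l(1) by (simp add: abs_mult)
        qed
        then show "(2::real) ^ u j \<le> 2 * (of_int l * max 1 \<bar>real_of_int (q $ j)\<bar>)" using u(2)[of j] by linarith
      qed simp
      also have "\<dots> = 2 ^ n * (of_int l ^ n * Pi_plus (real_of_int_vec q))"
        by (simp add: prod.distrib Pi_plus_def real_of_int_vec_def n_def)
      also have "\<dots> \<le> 2 ^ n * ((2 ^ (a * m)) ^ n * 2 ^ (c0 * Suc a))"
        using lr big a(3) by (intro mult_left_mono mult_mono power_mono)
          (auto simp: Pi_plus_def intro!: prod_nonneg)
      also have "\<dots> = 2 ^ (n + a * m * n + c0 * Suc a)" by (simp add: power_add power_mult)
      finally show ?thesis by (rule power_le_imp_le_exp[rotated]) simp
    qed
    have "\<forall>i. \<exists>t. t \<le> T \<and> 2 ^ t * y i \<le> 1 / 2 ^ a \<and> (t < T \<longrightarrow> 1 / 2 ^ a < 2 ^ Suc t * y i)"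
      using greatest_contracting_exponent[OF y1] by metis
    then obtain t where t: "\<And>i. t i \<le> T" "\<And>i. 2 ^ t i * y i \<le> 1 / 2 ^ a"
      "\<And>i. t i < T \<Longrightarrow> 1 / 2 ^ a < 2 ^ Suc (t i) * y i" by metis
    \<comment> \<open>One exponent at the cap suffices. Otherwise every \<open>2 ^ t i * y i\<close>
      is within a factor 2 of \<open>2^(-a)\<close>, and the smallness of the product of the
      \<open>y i\<close> forces the exponents to be large in total.\<close>
    have sum_t: "T \<le> (\<Sum>i\<in>UNIV. t i)"
    proof (cases "\<exists>i. t i = T")
      case True
      then obtain i where "t i = T" by blast
      then show ?thesis using member_le_sum[of i UNIV t] by simp
    next
      case False
      then have "1 / 2 ^ a \<le> 2 ^ Suc (t i) * y i" for i using t(1,3)[of i] by (metis le_neq_implies_less less_imp_le)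
      then have "(\<Prod>i\<in>(UNIV::'m set). 1 / 2 ^ a) \<le> (\<Prod>i\<in>UNIV. 2 ^ Suc (t i) * y i)"
        by (intro prod_mono) auto
      also have "(\<Prod>i\<in>UNIV. 2 ^ Suc (t i) * y i) = 2 ^ ((\<Sum>i\<in>UNIV. t i) + m) * (\<Prod>i\<in>UNIV. y i)"
        by (simp add: prod.distrib power_sum power_add m_def)
      also have "\<dots> \<le> 2 ^ ((\<Sum>i\<in>UNIV. t i) + m) * 2 powr (real (a * m * m) - (1 + \<epsilon>) * real (c0 * a))"
        by (intro mult_left_mono prod_y) simp
      also have "\<dots> = 2 powr (real ((\<Sum>i\<in>UNIV. t i) + m) + (real (a * m * m) - (1 + \<epsilon>) * real (c0 * a)))"
        by (subst powr_add, subst powr_realpow) simp_all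
      also have "(\<Prod>i\<in>(UNIV::'m set). 1 / 2 ^ a) = (2::real) powr (- real (a * m))"
        unfolding powr_minus powr_realpow[OF zero_less_numeral]
        by (simp add: m_def power_mult divide_inverse power_inverse)
      finally have "- real (a * m) \<le> real ((\<Sum>i\<in>UNIV. t i) + m) + (real (a * m * m) - (1 + \<epsilon>) * real (c0 * a))"
        by simp
      moreover have "real (m + n + m * m + m * n + 1) * real a \<le> \<epsilon> * c0 * a"
        using c0 by (intro mult_right_mono) auto
      moreover have "real a \<ge> real m + real n + real c0" using a(1) by (simp add: a1_def)
      ultimately have "real T \<le> real (\<Sum>i\<in>UNIV. t i)"
        unfolding T_def by (simp add: algebra_simps)
      then show ?thesis by (simp only: of_nat_le_iff)
    qed
    \<comment> \<open>The part \<open>u j\<close> brings the coordinate \<open>l * q $ j\<close>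
      down to size 1, the extra \<open>a\<close> down to \<open>2^(-a)\<close>.\<close>
    define \<tau> where "\<tau> r = (case r of Inl i \<Rightarrow> t i | Inr j \<Rightarrow> a + u j)" for r :: "'m + 'n"
    define v :: "real^('m + 'n)" where
      "v = (\<chi> r. case r of Inl i \<Rightarrow> of_int (round (of_int l * \<theta> i)) | Inr j \<Rightarrow> of_int (l * q $ j))"
    have sum_s: "(\<Sum>j\<in>UNIV. \<tau> (Inr j)) \<le> T"
      using sum_u by (simp add: \<tau>_def sum.distrib T_def n_def)
    have "T \<le> c * a"
    proof -
      have "n * 1 \<le> n * a" "c0 * 1 \<le> c0 * a" using a_pos by (intro mult_le_mono2; simp)+
      moreover have "T = n * a + a * m * n + c0 * a + n + c0" by (simp add: T_def)
      moreover have "c * a = 2 * (n * a) + a * m * n + 2 * (c0 * a)" by (simp add: c_def algebra_simps)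
      ultimately show ?thesis by linarith
    qed
    moreover have "\<tau> (Inr j) \<le> T" for j
      using member_le_sum[of j UNIV "\<lambda>j. \<tau> (Inr j)"] sum_s by simp
    ultimately have "\<tau> r \<le> c * a" for r
      using t(1) by (cases r) (auto simp: \<tau>_def intro: order_trans)
    moreover have "(\<Sum>j\<in>UNIV. \<tau> (Inr j)) \<le> (\<Sum>i\<in>UNIV. \<tau> (Inl i))"
      using sum_s sum_t by (simp add: \<tau>_def)
    moreover have "v \<in> int_vecs" by (auto simp: int_vecs_def v_def split: sum.split)
    moreover have "v \<noteq> 0"
    proof
      assume "v = 0"
      then have "v $ Inr j = 0" for j by simp
      then have "q $ j = 0" for j using l(1) by (simp add: v_def)
      with q show False by (simp add: vec_eq_iff)
    qed
    moreover have "flow \<tau> r * \<bar>(v v* unip Y) $ r\<bar> \<le> 1 / 2 ^ a" for r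
    proof (cases r)
      case (Inl i)
      have "bot_part v = of_int l *\<^sub>R real_of_int_vec q"
        by (simp add: bot_part_def v_def real_of_int_vec_def vec_eq_iff)
      then have "(Y *v bot_part v) $ i = of_int l * \<theta> i"
        by (simp add: \<theta>_def matrix_vector_mult_scaleR)
      then have "\<bar>(v v* unip Y) $ r\<bar> = y i" unfolding Inl vec_unip_Inl by (simp add: v_def y_def)
      then show ?thesis using t(2)[of i] by (simp add: Inl flow_def \<tau>_def)
    next
      case (Inr j)
      have "\<bar>(v v* unip Y) $ r\<bar> = \<bar>of_int (l * q $ j)\<bar>" unfolding Inr vec_unip_Inr by (simp add: v_def)
      also have "\<dots> \<le> 2 ^ u j" using u(1)[of j] by (simp add: X_def)
      finally show ?thesis by (simp add: Inr flow_def \<tau>_def power_add field_simps)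
    qed
    moreover have "a \<ge> a0" using a(1) by (simp add: a1_def)
    ultimately show ?thesis by blast
  qed
  then show ?thesis by (rule that)
qed

section \<open>The Borel-Cantelli argument\<close>

text \<open>The points off the support are covered by basic open sets of measure 0, of which there
  are countably many.\<close>

lemma AE_in_supp_measure:
  fixes \<mu> :: "'a::{second_countable_topology} measure"
  assumes "sets \<mu> = sets (restrict_space borel U)" "open U"
  shows "AE x in \<mu>. x \<in> supp_measure \<mu>"
proof -
  have sp: "space \<mu> = U" using sets_eq_imp_space_eq[OF assms(1)] by (simp add: space_restrict_space)
  obtain B :: "'a set set" where B: "countable B" "topological_basis B"
    using ex_countable_basis by blast
  let ?Z = "{b \<in> B. emeasure \<mu> (b \<inter> U) = 0}"
  have "b \<inter> U \<in> null_sets \<mu>" if "b \<in> ?Z" for b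
    using that topological_basis_open[OF B(2)] assms by (auto simp: null_sets_def sets_restrict_space_iff)
  then have "(\<Union>b\<in>?Z. b \<inter> U) \<in> null_sets \<mu>"
    using B(1) by (intro null_sets_UN') auto
  moreover have "{x \<in> space \<mu>. \<not> x \<in> supp_measure \<mu>} \<subseteq> (\<Union>b\<in>?Z. b \<inter> U)"
  proof
    fix x assume "x \<in> {x \<in> space \<mu>. \<not> x \<in> supp_measure \<mu>}"
    then obtain W where W: "x \<in> U" "open W" "x \<in> W" "emeasure \<mu> (W \<inter> U) = 0"
      by (auto simp: supp_measure_def sp)
    obtain b where b: "b \<in> B" "x \<in> b" "b \<subseteq> W" using topological_basisE[OF B(2) W(2,3)] by blast
    have "emeasure \<mu> (b \<inter> U) \<le> emeasure \<mu> (W \<inter> U)"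
      using b(3) W(2) assms by (intro emeasure_mono) (auto simp: sets_restrict_space_iff)
    then show "x \<in> (\<Union>b\<in>?Z. b \<inter> U)" using W b by auto
  qed
  ultimately show ?thesis by (rule AE_I')
qed

text \<open>For fixed \<open>\<epsilon>\<close> and \<open>Q\<^sub>0\<close> the condition is open, so the uncountable union over \<open>Q\<close> is harmless.\<close>

lemma borel_VWMA: "{Y :: real^'n^'m. VWMA Y} \<in> sets borel"
proof -
  let ?G = "\<lambda>\<epsilon> Q (q :: int^'n) (p :: int^'m). {Y :: real^'n^'m.
    Pi_abs (Y *v real_of_int_vec q - real_of_int_vec p) < Q powr (- 1 - \<epsilon>)}"
  let ?A = "\<lambda>Q. {(q :: int^'n, p :: int^'m). q \<noteq> 0 \<and> Pi_plus (real_of_int_vec q) \<le> Q}"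
  let ?V = "\<lambda>\<epsilon> Q0. \<Union>Q\<in>{max 1 Q0<..}. \<Union>(q, p)\<in>?A Q. ?G \<epsilon> Q q p"
  have V: "VWMA Y \<longleftrightarrow> (\<exists>\<epsilon>>0. \<forall>Q0. Y \<in> ?V \<epsilon> Q0)" for Y :: "real^'n^'m"
    unfolding VWMA_def by fastforce
  have mono_\<epsilon>: "?V \<epsilon> Q0 \<subseteq> ?V \<epsilon>' Q0" if "\<epsilon>' \<le> \<epsilon>" for \<epsilon> \<epsilon>' Q0
  proof
    fix Y assume "Y \<in> ?V \<epsilon> Q0"
    then obtain Q q p where Q: "Q \<in> {max 1 Q0<..}" "(q, p) \<in> ?A Q"
      and "Pi_abs (Y *v real_of_int_vec q - real_of_int_vec p) < Q powr (- 1 - \<epsilon>)" by auto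
    moreover have "Q powr (- 1 - \<epsilon>) \<le> Q powr (- 1 - \<epsilon>')" using Q that by (intro powr_mono) auto
    ultimately have "Pi_abs (Y *v real_of_int_vec q - real_of_int_vec p) < Q powr (- 1 - \<epsilon>')" by linarith
    then have "Y \<in> ?G \<epsilon>' Q q p" by simp
    with Q show "Y \<in> ?V \<epsilon>' Q0" by blast
  qed
  have mono_Q: "?V \<epsilon> Q0 \<subseteq> ?V \<epsilon> Q1" if "Q1 \<le> Q0" for \<epsilon> Q0 Q1
    using that by (intro UN_mono order_refl) auto
  have "{Y :: real^'n^'m. VWMA Y} = (\<Union>i::nat. \<Inter>j::nat. ?V (inverse (real (Suc i))) (real j))"
  proof (intro set_eqI iffI)
    fix Y :: "real^'n^'m" assume "Y \<in> {Y. VWMA Y}"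
    then obtain \<epsilon> where "\<epsilon> > 0" "\<And>Q0. Y \<in> ?V \<epsilon> Q0" unfolding V by blast
    moreover obtain i where "inverse (real (Suc i)) < \<epsilon>" using reals_Archimedean[OF \<open>\<epsilon> > 0\<close>] by blast
    ultimately have "Y \<in> ?V (inverse (real (Suc i))) (real j)" for j
      using mono_\<epsilon>[of "inverse (real (Suc i))" \<epsilon> "real j"] by (meson less_imp_le subsetD)
    then show "Y \<in> (\<Union>i::nat. \<Inter>j::nat. ?V (inverse (real (Suc i))) (real j))" by blast
  next
    fix Y assume "Y \<in> (\<Union>i::nat. \<Inter>j::nat. ?V (inverse (real (Suc i))) (real j))"
    then obtain i where i: "\<And>j. Y \<in> ?V (inverse (real (Suc i))) (real j)" by blast
    have "Y \<in> ?V (inverse (real (Suc i))) Q0" for Q0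
    proof -
      obtain j where "Q0 \<le> real j" using real_arch_simple by blast
      then show ?thesis by (rule subsetD[OF mono_Q i])
    qed
    moreover have "inverse (real (Suc i)) > 0" by simp
    ultimately have "VWMA Y" unfolding V by blast
    then show "Y \<in> {Y. VWMA Y}" by simp
  qed
  moreover have "open (?V \<epsilon> Q0)" for \<epsilon> Q0
  proof -
    have "open (?G \<epsilon> Q q p)" for Q q p
      unfolding Pi_abs_def matrix_vector_mult_def
      by (intro open_Collect_less) (simp_all, intro continuous_intros)
    then show ?thesis by (intro open_UN ballI) auto
  qed
  ultimately show ?thesis by (simp add: borel_open)
qed

text \<open>Termwise differentiation of a power series keeps it convergent in the unit disc and
  raises the degree of the coefficient polynomial by one.\<close>

lemma summable_power_mult_geometric:
  fixes x :: real
  assumes "\<bar>x\<bar> < 1"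
  shows "summable (\<lambda>n. real n ^ k * x ^ n)"
  using assms
proof (induction k arbitrary: x)
  case (Suc k)
  have "summable (\<lambda>n. diffs (\<lambda>n. real n ^ k) n * x ^ n)"
    by (rule termdiff_converges[of x 1]) (use Suc in auto)
  moreover have "diffs (\<lambda>n. real n ^ k) = (\<lambda>n. real (Suc n) ^ Suc k)" by (simp add: diffs_def fun_eq_iff)
  ultimately show ?case
    using summable_powser_split_head[of "\<lambda>n. real n ^ Suc k" x] by simp
qed (simp add: summable_geometric)

lemma summable_affine_power_mult_geometric:
  fixes x :: real
  assumes "0 \<le> x" "x < 1"
  shows "summable (\<lambda>n. real (c * n + 1) ^ k * x ^ n)"
proof (rule summable_comparison_test')
  have "summable (\<lambda>n. real (Suc n) ^ k * x ^ n)"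
    using summable_power_mult_geometric[of x k] assms
      summable_powser_split_head[of "\<lambda>n. real n ^ k" x] by simp
  then show "summable (\<lambda>n. real (Suc c) ^ k * (real (Suc n) ^ k * x ^ n))"
    by (rule summable_mult)
  fix n :: nat
  have "c * n + 1 \<le> Suc c * Suc n" by simp
  then have "real (c * n + 1) \<le> real (Suc c) * real (Suc n)" by (metis of_nat_le_iff of_nat_mult)
  then have "real (c * n + 1) ^ k \<le> (real (Suc c) * real (Suc n)) ^ k" by (rule power_mono) simp
  then have "real (c * n + 1) ^ k * x ^ n \<le> (real (Suc c) * real (Suc n)) ^ k * x ^ n"
    using assms by (intro mult_right_mono) auto
  then show "norm (real (c * n + 1) ^ k * x ^ n) \<le> real (Suc c) ^ k * (real (Suc n) ^ k * x ^ n)"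
    using assms by (simp only: power_mult_distrib norm_mult real_norm_def) (simp add: mult.assoc)
qed

lemma expanding_flow:
  assumes "(\<Sum>l\<in>UNIV. \<tau> (Inr l)) \<le> (\<Sum>i\<in>UNIV. \<tau> (Inl i))"
  shows "expanding (flow \<tau>)"
  unfolding expanding_def prod_flow
  using assms by (auto simp: flow_def divide_le_eq le_divide_eq intro!: power_increasing)

lemma card_bounded_functions: "card {\<tau> :: 'k::finite \<Rightarrow> nat. \<forall>i. \<tau> i \<le> b} = (b + 1) ^ CARD('k)"
proof -
  have "{\<tau> :: 'k \<Rightarrow> nat. \<forall>i. \<tau> i \<le> b} = PiE UNIV (\<lambda>_. {..b})" by (auto simp: PiE_UNIV_domain)
  then show ?thesis by (simp add: card_PiE)
qed

lemma finite_bounded_functions: "finite {\<tau> :: 'k::finite \<Rightarrow> nat. \<forall>i. \<tau> i \<le> b}"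
  by (rule card_ge_0_finite) (simp add: card_bounded_functions)

text \<open>At scale \<open>a\<close> there are at most \<open>(c * a + 1) ^ k\<close> elements
  \<open>g\<close>, each with an exceptional set of measure proportional to
  \<open>2 powr (- \<alpha> * a)\<close>; the sum over \<open>a\<close> converges.\<close>

lemma AE_not_VWMA_of_nondivergence:
  fixes \<mu> :: "'a::euclidean_space measure" and F :: "'a \<Rightarrow> real^'n::finite^'m::finite"
  assumes supp: "AE x in \<mu>. x \<in> supp_measure \<mu>" and fin: "emeasure \<mu> B < \<infinity>"
    and K: "K \<ge> 0" "0 < \<rho>" "0 < \<alpha>"
    and nondiv: "\<And>g \<epsilon>. expanding g \<Longrightarrow> 0 < \<epsilon> \<Longrightarrow> \<epsilon> \<le> \<rho> \<Longrightarrow> \<exists>N\<in>sets \<mu>.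
       emeasure \<mu> N \<le> ennreal (K * \<epsilon> powr \<alpha>) * emeasure \<mu> B \<and>
       (\<forall>x\<in>B \<inter> supp_measure \<mu> - N. \<forall>v\<in>int_vecs. v \<noteq> 0 \<longrightarrow>
          \<epsilon> \<le> (\<Sum>i\<in>UNIV. g i * \<bar>(v v* unip (F x)) $ i\<bar>))"
  shows "AE x in \<mu>. x \<in> B \<longrightarrow> \<not> VWMA (F x)"
proof -
  define k where "k = CARD('m + 'n)"
  \<comment> \<open>The sum over \<open>k\<close> coordinates, each at most
    \<open>1 / 2 ^ a\<close>, must be strictly below the threshold, hence
    \<open>k + 1\<close>.\<close>
  define \<epsilon> where "\<epsilon> a = real (k + 1) / 2 ^ a" for a :: nat
  have \<epsilon>0: "\<epsilon> a > 0" for a by (simp add: \<epsilon>_def)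
  have "\<epsilon> \<longlonglongrightarrow> 0" unfolding \<epsilon>_def by (rule LIMSEQ_divide_realpow_zero) simp
  then obtain a\<^sub>0 where a\<^sub>0: "\<And>a. a \<ge> a\<^sub>0 \<Longrightarrow> \<epsilon> a \<le> \<rho>"
    using order_tendstoD(2)[of \<epsilon> 0 sequentially \<rho>] K(2) unfolding eventually_sequentially
    by (meson less_imp_le)
  let ?nd = "\<lambda>\<tau> a N. N \<in> sets \<mu> \<and> emeasure \<mu> N \<le> ennreal (K * \<epsilon> a powr \<alpha>) * emeasure \<mu> B \<and>
       (\<forall>x\<in>B \<inter> supp_measure \<mu> - N. \<forall>v\<in>int_vecs. v \<noteq> 0 \<longrightarrow>
          \<epsilon> a \<le> (\<Sum>i\<in>UNIV. flow \<tau> i * \<bar>(v v* unip (F x)) $ i\<bar>))"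
  define N where "N \<tau> a = (SOME N. ?nd \<tau> a N)" for \<tau> a
  have N: "?nd \<tau> a (N \<tau> a)" if "expanding (flow \<tau>)" "a \<ge> a\<^sub>0" for \<tau> a
    unfolding N_def by (rule someI_ex) (use nondiv[OF that(1) \<epsilon>0 a\<^sub>0[OF that(2)]] in blast)
  let ?T = "\<lambda>c a. {\<tau> :: 'm + 'n \<Rightarrow> nat. (\<forall>i. \<tau> i \<le> c * a) \<and> expanding (flow \<tau>)}"
  define A where "A c a = (if a \<ge> a\<^sub>0 then \<Union>\<tau>\<in>?T c a. N \<tau> a else {})" for c a :: nat
  have finT: "finite (?T c a)" for c a
    by (rule finite_subset[OF _ finite_bounded_functions[of "c * a"]]) auto
  have cardT: "card (?T c a) \<le> (c * a + 1) ^ k" for c a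
    unfolding k_def card_bounded_functions[symmetric]
    by (intro card_mono finite_bounded_functions) auto
  have Ameas: "A c a \<in> sets \<mu>" for c a using N finT[of c a] by (auto simp: A_def)
  define q where "q = 2 powr (- \<alpha>)"
  have q: "0 \<le> q" "q < 1" using K(3) by (auto simp: q_def powr_less_one)
  define b where "b = K * real (k + 1) powr \<alpha> * measure \<mu> B"
  have \<epsilon>q: "\<epsilon> a powr \<alpha> = real (k + 1) powr \<alpha> * q ^ a" for a
  proof -
    have "\<epsilon> a = real (k + 1) * 2 powr (- real a)"
      by (simp add: \<epsilon>_def powr_minus powr_realpow divide_inverse)
    then have "\<epsilon> a powr \<alpha> = real (k + 1) powr \<alpha> * (2 powr (- real a)) powr \<alpha>" by (simp add: powr_mult)
    also have "(2 powr (- real a)) powr \<alpha> = q powr real a" by (simp add: q_def powr_powr mult.commute)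
    also have "\<dots> = q ^ a" by (subst powr_realpow) (simp_all add: q_def)
    finally show ?thesis .
  qed
  have Ale: "emeasure \<mu> (A c a) \<le> ennreal (b * (real (c * a + 1) ^ k * q ^ a))" for c a
  proof (cases "a \<ge> a\<^sub>0")
    case True
    have "emeasure \<mu> (A c a) \<le> (\<Sum>\<tau>\<in>?T c a. emeasure \<mu> (N \<tau> a))"
      unfolding A_def using True N finT[of c a] by (auto intro!: emeasure_subadditive_finite)
    also have "\<dots> \<le> (\<Sum>\<tau>\<in>?T c a. ennreal (K * \<epsilon> a powr \<alpha>) * emeasure \<mu> B)"
      using N True by (intro sum_mono) auto
    also have "\<dots> = ennreal (real (card (?T c a)) * (K * \<epsilon> a powr \<alpha> * measure \<mu> B))"
      using fin K(1) by (simp add: emeasure_eq_ennreal_measure ennreal_mult ennreal_of_nat_eq_real_of_nat)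
    also have "\<dots> \<le> ennreal (real ((c * a + 1) ^ k) * (K * \<epsilon> a powr \<alpha> * measure \<mu> B))"
      by (intro ennreal_leI mult_right_mono of_nat_mono cardT mult_nonneg_nonneg K(1)) auto
    also have "real ((c * a + 1) ^ k) * (K * \<epsilon> a powr \<alpha> * measure \<mu> B) = b * (real (c * a + 1) ^ k * q ^ a)"
      unfolding \<epsilon>q b_def by simp
    finally show ?thesis .
  qed (simp add: A_def)
  have b0: "b * (real (c * a + 1) ^ k * q ^ a) \<ge> 0" for c a using K(1) q by (simp add: b_def)
  \<comment> \<open>The constant \<open>c\<close> of \<open>VWMA_imp_short_vectors\<close> depends
    on the matrix and so on \<open>x\<close>; being a natural number, it can be treated one value at
    a time.\<close>
  have "AE x in \<mu>. eventually (\<lambda>a. x \<in> space \<mu> - A c a) sequentially" for c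
  proof (rule borel_cantelli_AE1)
    show "emeasure \<mu> (A c a) < \<infinity>" for a using Ale[of c a] by (rule le_less_trans) simp
    have "summable (\<lambda>a. b * (real (c * a + 1) ^ k * q ^ a))"
      by (intro summable_mult summable_affine_power_mult_geometric q)
    then show "summable (\<lambda>a. measure \<mu> (A c a))"
    proof (rule summable_comparison_test'[where N = 0])
      fix a :: nat
      show "norm (measure \<mu> (A c a)) \<le> b * (real (c * a + 1) ^ k * q ^ a)"
        using enn2real_mono[OF Ale[of c a]] b0[of c a] by (simp add: measure_def)
    qed
  qed (rule Ameas)
  then have "AE x in \<mu>. \<forall>c. eventually (\<lambda>a. x \<in> space \<mu> - A c a) sequentially"
    by (simp add: AE_all_countable)
  with supp show ?thesis
  proof eventually_elim
    case (elim x)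
    show ?case
    proof (intro impI notI)
      assume xB: "x \<in> B" and "VWMA (F x)"
      obtain c where c: "\<And>a0. \<exists>a\<ge>a0. \<exists>\<tau> :: 'm + 'n \<Rightarrow> nat. (\<forall>i. \<tau> i \<le> c * a) \<and>
        (\<Sum>l\<in>UNIV. \<tau> (Inr l)) \<le> (\<Sum>i\<in>UNIV. \<tau> (Inl i)) \<and>
        (\<exists>v\<in>int_vecs. v \<noteq> 0 \<and> (\<forall>i. flow \<tau> i * \<bar>(v v* unip (F x)) $ i\<bar> \<le> 1 / 2 ^ a))"
        using VWMA_imp_short_vectors[OF \<open>VWMA (F x)\<close>] by blast
      obtain a1 where a1: "\<And>a. a \<ge> a1 \<Longrightarrow> x \<notin> A c a"
        using elim(2) unfolding eventually_sequentially by blast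
      obtain a \<tau> v where a: "a \<ge> max a\<^sub>0 a1" and \<tau>: "\<forall>i. \<tau> i \<le> c * a"
        "(\<Sum>l\<in>UNIV. \<tau> (Inr l)) \<le> (\<Sum>i\<in>UNIV. \<tau> (Inl i :: 'm + 'n))"
        and v: "v \<in> int_vecs" "v \<noteq> 0" "\<And>i. flow \<tau> i * \<bar>(v v* unip (F x)) $ i\<bar> \<le> 1 / 2 ^ a"
        using c[of "max a\<^sub>0 a1"] by blast
      have ex: "expanding (flow \<tau>)" by (rule expanding_flow[OF \<tau>(2)])
      have "x \<notin> N \<tau> a" using a1[of a] a \<tau>(1) ex by (auto simp: A_def)
      then have "\<epsilon> a \<le> (\<Sum>i\<in>UNIV. flow \<tau> i * \<bar>(v v* unip (F x)) $ i\<bar>)"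
        using N[OF ex, of a] a xB elim(1) v(1,2) by auto
      also have "\<dots> \<le> (\<Sum>i\<in>(UNIV :: ('m + 'n) set). 1 / 2 ^ a)" by (intro sum_mono v(3))
      also have "\<dots> = real k / 2 ^ a" by (simp add: k_def)
      also have "\<dots> < \<epsilon> a" by (simp add: \<epsilon>_def divide_strict_right_mono)
      finally show False by simp
    qed
  qed
qed

section \<open>From small balls to almost every point\<close>

lemma D_federer_on_subset: "D_federer_on D \<mu> W \<Longrightarrow> V \<subseteq> W \<Longrightarrow> D_federer_on D \<mu> V"
  unfolding D_federer_on_def by (meson subset_trans)

lemma C_alpha_good_on_subset: "C_alpha_good_on C \<alpha> f W \<mu> \<Longrightarrow> V \<subseteq> W \<Longrightarrow> C_alpha_good_on C \<alpha> f V \<mu>"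
  unfolding C_alpha_good_on_def by (meson subset_trans)

lemma locally_AE_not_VWMA:
  fixes \<mu> :: "'a::euclidean_space measure" and F :: "'a \<Rightarrow> real^'n::{finite,linorder}^'m::{finite,linorder}"
  assumes U: "open U" and radon: "radon_measure_on U \<mu>" and F: "continuous_on U F"
    and nonplanar: "weakly_nonplanar F U \<mu>"
    and x: "x \<in> supp_measure \<mu>"
    and W1: "open W1" "x \<in> W1" "W1 \<subseteq> space \<mu>" "D > 0" "D_federer_on D \<mu> W1"
    and W2: "open W2" "x \<in> W2" "W2 \<subseteq> U" "C > 0" "\<alpha> > 0"
      "\<And>c0 c. C_alpha_good_on C \<alpha> (\<lambda>y. c0 + (\<Sum>p\<in>minor_indices. c p * minor (fst p) (snd p) (F y))) W2 \<mu>"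
  shows "\<exists>r>0. AE y in \<mu>. y \<in> ball x r \<longrightarrow> \<not> VWMA (F y)"
proof -
  have sets: "sets \<mu> = sets (restrict_space borel U)" using radon by (simp add: radon_measure_on_def)
  obtain R where R: "R > 0" "cball x R \<subseteq> W1 \<inter> W2"
    using W1(1,2) W2(1,2) by (meson open_contains_cball open_Int IntI)
  let ?W = "ball x R" and ?k = "CARD('m + 'n)"
  have sub: "?W \<subseteq> W1" "?W \<subseteq> W2" "?W \<subseteq> U" using R(2) W2(3) ball_subset_cball[of x R] by blast+
  \<comment> \<open>The estimate on a ball needs its \<open>5 ^ ?k\<close>-fold dilate inside the
    set where the Federer and goodness bounds hold.\<close>
  define r where "r = R / 5 ^ ?k"
  have r: "r > 0" "ball x (5 ^ ?k * r) \<subseteq> ?W" using R(1) by (simp_all add: r_def)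
  have "r \<le> R" unfolding r_def using R(1) by (simp add: divide_le_eq mult_le_cancel_left1)
  then have rW: "ball x r \<subseteq> ?W" by (rule subset_ball)
  have good: "C_alpha_good_on C \<alpha> (\<lambda>y. c0 + (\<Sum>p\<in>minor_indices. c p * minor (fst p) (snd p) (F y))) ?W \<mu>" for c0 c
    by (rule C_alpha_good_on_subset[OF W2(6) sub(2)])
  have np: "\<not> F ` (ball x r \<inter> supp_measure \<mu>) \<subseteq> H" if "H \<in> H_collection" for H
    using nonplanar x r(1) rW sub(3) that unfolding weakly_nonplanar_def by blast
  obtain K \<rho> where K: "K \<ge> 0" "0 < \<rho>"
    "\<And>g \<epsilon>. expanding g \<Longrightarrow> 0 < \<epsilon> \<Longrightarrow> \<epsilon> \<le> \<rho> \<Longrightarrow> \<exists>N\<in>sets \<mu>.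
       emeasure \<mu> N \<le> ennreal (K * \<epsilon> powr \<alpha>) * emeasure \<mu> (ball x r) \<and>
       (\<forall>y\<in>ball x r \<inter> supp_measure \<mu> - N. \<forall>v\<in>int_vecs. v \<noteq> 0 \<longrightarrow>
          \<epsilon> \<le> (\<Sum>i\<in>UNIV. g i * \<bar>(v v* unip (F y)) $ i\<bar>))"
    by (rule quantitative_nondivergence[OF sets U sub(3) open_ball D_federer_on_subset[OF W1(5) sub(1)]
        less_imp_le[OF W1(4)] W2(4,5) continuous_on_subset[OF F sub(3)] good x r np])
      (assumption, (rule that; blast))
  \<comment> \<open>Finiteness of the measure of the ball, required by Borel-Cantelli, comes from a
    compact ball inside \<open>U\<close>.\<close>
  have "cball x R \<in> sets \<mu>"
    using R(2) W2(3) U by (auto simp: sets sets_restrict_space_iff)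
  then have "emeasure \<mu> (ball x r) \<le> emeasure \<mu> (cball x R)"
    using rW ball_subset_cball[of x R] by (intro emeasure_mono) blast+
  also have "\<dots> < \<infinity>" using radon R(2) W2(3) compact_cball[of x R] unfolding radon_measure_on_def by blast
  finally have "AE y in \<mu>. y \<in> ball x r \<longrightarrow> \<not> VWMA (F y)"
    by (rule AE_not_VWMA_of_nondivergence[OF AE_in_supp_measure[OF sets U] _ K(1,2) W2(5) K(3)])
  with r(1) show ?thesis by blast
qed

theorem theorem2p3:
  fixes U :: "(real^'d) set"
    and \<mu> :: "(real^'d) measure"
    and F :: "real^'d \<Rightarrow> real^'n::{finite,linorder}^'m::{finite,linorder}"
  assumes "open U"
    and "radon_measure_on U \<mu>"
    and "federer \<mu>"
    and "continuous_on U F"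
    and "good_pair F U \<mu>"
    and "weakly_nonplanar F U \<mu>"
  shows "strongly_extremal (distr \<mu> borel F)"
proof -
  have sets: "sets \<mu> = sets (restrict_space borel U)"
    using assms(2) by (simp add: radon_measure_on_def)
  let ?ok = "\<lambda>x r. r > 0 \<and> (AE y in \<mu>. y \<in> ball x r \<longrightarrow> \<not> VWMA (F y))"
  have "AE x in \<mu>. x \<in> supp_measure \<mu>" by (rule AE_in_supp_measure[OF sets assms(1)])
  moreover have "AE x in \<mu>. \<exists>W D. open W \<and> x \<in> W \<and> W \<subseteq> space \<mu> \<and> D > 0 \<and> D_federer_on D \<mu> W"
    using assms(3) by (simp add: federer_def)
  moreover have "AE x in \<mu>. \<exists>W C \<alpha>. open W \<and> x \<in> W \<and> W \<subseteq> U \<and> C > 0 \<and> \<alpha> > 0 \<and>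
      (\<forall>c0 c. C_alpha_good_on C \<alpha> (\<lambda>y. c0 + (\<Sum>p\<in>minor_indices. c p * minor (fst p) (snd p) (F y))) W \<mu>)"
    using assms(5) unfolding good_pair_def good_family_def by (simp add: case_prod_beta)
  ultimately have ae: "AE x in \<mu>. \<exists>r. ?ok x r"
  proof eventually_elim
    case (elim x)
    then obtain W1 D W2 C \<alpha> where
      W1: "open W1" "x \<in> W1" "W1 \<subseteq> space \<mu>" "D > 0" "D_federer_on D \<mu> W1"
      and W2: "open W2" "x \<in> W2" "W2 \<subseteq> U" "C > 0" "\<alpha> > 0"
      "\<And>c0 c. C_alpha_good_on C \<alpha> (\<lambda>y. c0 + (\<Sum>p\<in>minor_indices. c p * minor (fst p) (snd p) (F y))) W2 \<mu>"
      by blast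
    show ?case
      using locally_AE_not_VWMA[OF assms(1,2,4,6) elim(1) W1 W2] by blast
  qed
  \<comment> \<open>Each good ball has its own null set, and there are uncountably many balls; a
    countable subfamily with the same union makes the total exceptional set null.\<close>
  let ?\<B> = "{ball x r | x r. ?ok x r}"
  obtain \<B>' where \<B>': "\<B>' \<subseteq> ?\<B>" "countable \<B>'" "\<Union>\<B>' = \<Union>?\<B>"
    using Lindelof[of ?\<B>] by auto
  have "AE y in \<mu>. \<forall>b\<in>\<B>'. y \<in> b \<longrightarrow> \<not> VWMA (F y)"
    using \<B>'(1,2) by (subst AE_ball_countable) auto
  with ae have "AE x in \<mu>. \<not> VWMA (F x)"
  proof eventually_elim
    case (elim x)
    then obtain r where "?ok x r" by blast
    then have "x \<in> \<Union>?\<B>" by (intro UnionI[of "ball x r"]) auto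
    with elim(2) \<B>'(3) show ?case by blast
  qed
  moreover have "F \<in> measurable \<mu> borel"
    using borel_measurable_continuous_on_restrict[OF assms(4)] by (simp add: measurable_cong_sets[OF sets refl])
  \<comment> \<open>An almost-everywhere statement passes through \<open>distr\<close> by taking
    preimages once the predicate is Borel.\<close>
  moreover have "{Y \<in> space (borel :: (real^'n::{finite,linorder}^'m::{finite,linorder}) measure). \<not> VWMA Y} \<in> sets borel"
  proof -
    have "{Y \<in> space (borel :: (real^'n::{finite,linorder}^'m::{finite,linorder}) measure). \<not> VWMA Y} = space borel - {Y. VWMA Y}" by auto
    then show ?thesis using sets.compl_sets[OF borel_VWMA] by simp
  qed
  ultimately show ?thesis
    unfolding strongly_extremal_def by (subst AE_distr_iff)
qed



end
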